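(* Let $f\in\mathrm{GT}_1(\mathbf{k})$ and let $\alpha_f\in\mathrm{Aut}(F_2(\mathbf{k}))$ be given by $\alpha_f(X)=f(X,Y^{-1}X^{-1})Xf(X,Y^{-1}X^{-1})^{-1}$, $\alpha_f(Y)=f(Y,Y^{-1}X^{-1})Yf(Y,Y^{-1}X^{-1})^{-1}$. Then, in $\mathrm{Aut}(F_3(\mathbf{k}))$, $$\mathrm{Ad}f(x_{12},x_{23})\circ\alpha_f^{\widetilde{12},3}\circ\alpha_f^{1,2}=\alpha_f^{1,\widetilde{23}}\circ\alpha_f^{2,3}.$$
   Context: $\mathbf{k}$ is a field of characteristic $0$; $\Gamma(\mathbf{k})$ denotes the prounipotent (Malcev) completion of a group $\Gamma$. $F_2$ is free on $X,Y$, $F_3$ is free on $X_1,X_2,X_3$. For $f\in F_2(\mathbf{k})$ and $g,h$ in a prounipotent group, $f(g,h)$ is the image of $f$ under $X\mapsto g$, $Y\mapsto h$. **Braids.** $B_4$ is the braid group with Artin generators $\sigma_0,\sigma_1,\sigma_2$ (strands indexed $0,1,2,3$), $\mathrm{PB}_4$ the pure braid group, with elements $x_{ij}=(\sigma_{j-2}\cdots\sigma_i)^{-1}\sigma_{j-1}^2(\sigma_{j-2}\cdots\sigma_i)$, $0\le i<j\le3$. The elements $x_{01},x_{02},x_{03}$ freely generate a normal subgroup of $\mathrm{PB}_4$, identified with $F_3$ via $X_i=x_{0i}$. $\mathrm{Ad}:\mathrm{PB}_4(\mathbf{k})\to\mathrm{Aut}(F_3(\mathbf{k}))$ is the resulting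 conjugation action $\mathrm{Ad}(g)(u)=gug^{-1}$. **$\mathrm{GT}_1(\mathbf{k})$.** The set of $f(X,Y)\in F_2(\mathbf{k})$ with $f(Y,X)=f(X,Y)^{-1}$, $f(X,Y)f(Y^{-1}X^{-1},X)f(Y,Y^{-1}X^{-1})=1$, and, in the prounipotent completion of the pure braid group on strands $1,2,3,4$ (generators $\sigma_1,\sigma_2,\sigma_3$ and $x_{ij}$, $1\le i<j\le4$, defined by the same formula), $f(x_{23},x_{34})f(x_{12}x_{13},x_{24}x_{34})f(x_{12},x_{23})=f(x_{12},x_{23}x_{24})f(x_{13}x_{23},x_{34})$. **Superscripts.** Put $P=f(X,Y^{-1}X^{-1})=:P(X,Y)$ and $Q=f(Y,Y^{-1}X^{-1})=:Q(X,Y)$. Then: $\alpha_f^{1,2}$ conjugates $X_1$ by $P(X_1,X_2)$, $X_2$ by $Q(X_1,X_2)$ and fixes $X_3$; $\alpha_f^{2,3}$ fixes $X_1$ and conjugates $X_2$ by $P(X_2,X_3)$, $X_3$ by $Q(X_2,X_3)$; $\alpha_f^{\widetilde{12},3}$ conjugates both $X_1$ and $X_2$ by $P(X_1X_2,X_3)$ and $X_3$ by $Q(X_1X_2,X_3)$; $\alpha_f^{1,\widetilde{23}}$ conjugates $X_1$ by $P(X_1,X_2X_3)$ and both $X_2,X_3$ by $Q(X_1,X_2X_3)$. (Conjugating $Z$ by $W$ means $Z\mapsto WZW^{-1}$.) *)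

theory Defs
  imports
    "HOL-Library.Poly_Mapping"
    "HOL-Library.Product_Plus"
    "HOL-Combinatorics.Transposition"
    "HOL-Algebra.Bij"
begin

section \<open>Groups given by generators and relations\<close>

text \<open>
  Discrete groups are types of class \<open>group_add\<close>: the (non-commutative) group law is written
  \<open>+\<close>, so that \<open>'g \<Rightarrow>\<^sub>0 'k\<close> with the convolution product of \<open>Poly_Mapping\<close> is the group algebra.
\<close>

datatype 'a letter = Pos 'a | Neg 'a

fun flip_letter :: "'a letter \<Rightarrow> 'a letter" where
  "flip_letter (Pos a) = Neg a"
| "flip_letter (Neg a) = Pos a"

class presented =
  fixes relators :: "('a letter list \<times> 'a letter list) set"

inductive word_eq :: "'a::presented letter list \<Rightarrow> 'a letter list \<Rightarrow> bool" where
  refl: "word_eq u u"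
| sym: "word_eq u v \<Longrightarrow> word_eq v u"
| trans: "word_eq u v \<Longrightarrow> word_eq v w \<Longrightarrow> word_eq u w"
| append: "word_eq u u' \<Longrightarrow> word_eq v v' \<Longrightarrow> word_eq (u @ v) (u' @ v')"
| cancel: "word_eq [l, flip_letter l] []"
| relator: "(u, v) \<in> relators \<Longrightarrow> word_eq u v"

lemma flip_flip [simp]: "flip_letter (flip_letter l) = l"
  by (cases l) auto

definition inverse_word :: "'a letter list \<Rightarrow> 'a letter list" where
  "inverse_word w = rev (map flip_letter w)"

lemma inverse_word_append: "inverse_word (u @ v) = inverse_word v @ inverse_word u"
  by (simp add: inverse_word_def)

lemma inverse_word_inverse_word [simp]: "inverse_word (inverse_word w) = w"
  by (simp add: inverse_word_def rev_map comp_def)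

lemma word_eq_inverse_right: "word_eq (w @ inverse_word w) []"
proof (induction w)
  case Nil
  show ?case by (simp add: inverse_word_def word_eq.refl)
next
  case (Cons l w)
  have "word_eq (w @ inverse_word w @ [flip_letter l]) ([] @ [flip_letter l])"
    using word_eq.append[OF Cons word_eq.refl[of "[flip_letter l]"]] by simp
  then have "word_eq ([l] @ (w @ inverse_word w @ [flip_letter l])) ([l] @ [flip_letter l])"
    using word_eq.append[OF word_eq.refl[of "[l]"]] by fastforce
  then show ?case
    using word_eq.trans[OF _ word_eq.cancel[of l]] by (simp add: inverse_word_def)
qed

lemma word_eq_inverse_left: "word_eq (inverse_word w @ w) []"
  using word_eq_inverse_right[of "inverse_word w"] by simp

lemma word_eq_inverse: assumes "word_eq u v" shows "word_eq (inverse_word u) (inverse_word v)"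
proof -
  have "word_eq (inverse_word u @ (v @ inverse_word v)) (inverse_word u @ [])"
    by (intro word_eq.append word_eq.refl word_eq_inverse_right)
  moreover have "word_eq ((inverse_word u @ v) @ inverse_word v)
      ((inverse_word u @ u) @ inverse_word v)"
    by (intro word_eq.append word_eq.refl word_eq.sym[OF assms])
  moreover have "word_eq ((inverse_word u @ u) @ inverse_word v) ([] @ inverse_word v)"
    by (intro word_eq.append word_eq.refl word_eq_inverse_left)
  ultimately show ?thesis
    unfolding append.assoc append_Nil append_Nil2
    by (blast intro: word_eq.sym word_eq.trans)
qed

quotient_type (overloaded) 'a presgroup = "'a::presented letter list" / "word_eq"
  by (intro equivpI reflpI sympI transpI) (fact word_eq.refl word_eq.sym word_eq.trans)+

instantiation presgroup :: (presented) group_add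
begin

lift_definition zero_presgroup :: "'a presgroup" is "[]" .
lift_definition plus_presgroup :: "'a presgroup \<Rightarrow> 'a presgroup \<Rightarrow> 'a presgroup" is "(@)"
  by (rule word_eq.append)
lift_definition uminus_presgroup :: "'a presgroup \<Rightarrow> 'a presgroup" is inverse_word
  by (rule word_eq_inverse)
definition minus_presgroup :: "'a presgroup \<Rightarrow> 'a presgroup \<Rightarrow> 'a presgroup" where
  "minus_presgroup x y = x + - y"

instance
proof
  fix a b c :: "'a presgroup"
  show "a + b + c = a + (b + c)" by transfer (simp add: word_eq.refl)
  show "0 + a = a" by transfer (simp add: word_eq.refl)
  show "a + 0 = a" by transfer (simp add: word_eq.refl)
  show "- a + a = 0" by transfer (rule word_eq_inverse_left)
  show "a + - b = a - b" by (simp add: minus_presgroup_def)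
qed

end

lift_definition gen :: "'a::presented \<Rightarrow> 'a presgroup" is "\<lambda>a. [Pos a]" .

text \<open>The homomorphism out of a presented group with prescribed values on the generators
  (evaluated on an arbitrary representing word; independent of it as soon as \<open>v\<close> takes values in
  the carrier of the group \<open>G\<close> and respects the relators).\<close>

definition hom_ext :: "('b, 'c) monoid_scheme \<Rightarrow> ('a::presented \<Rightarrow> 'b) \<Rightarrow> 'a presgroup \<Rightarrow> 'b" where
  "hom_ext G v w = foldr (\<lambda>l r. (case l of Pos a \<Rightarrow> v a | Neg a \<Rightarrow> inv\<^bsub>G\<^esub> v a) \<otimes>\<^bsub>G\<^esub> r)
     (rep_presgroup w) \<one>\<^bsub>G\<^esub>"


section \<open>The free groups on two and three generators\<close>

datatype gen2 = GX | GY
datatype gen3 = G1 | G2 | G3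

instantiation gen2 :: presented begin
definition relators_gen2 :: "(gen2 letter list \<times> gen2 letter list) set" where
  "relators_gen2 = {}"
instance ..
end

instantiation gen3 :: presented begin
definition relators_gen3 :: "(gen3 letter list \<times> gen3 letter list) set" where
  "relators_gen3 = {}"
instance ..
end

type_synonym F2 = "gen2 presgroup"
type_synonym F3 = "gen3 presgroup"


section \<open>Braids on four strands\<close>

datatype artin = S0 | S1 | S2

instantiation artin :: presented begin
definition relators_artin :: "(artin letter list \<times> artin letter list) set" where
  "relators_artin =
    {([Pos S0, Pos S1, Pos S0], [Pos S1, Pos S0, Pos S1]),
     ([Pos S1, Pos S2, Pos S1], [Pos S2, Pos S1, Pos S2]),
     ([Pos S0, Pos S2], [Pos S2, Pos S0])}"
instance ..
end

type_synonym B4 = "artin presgroup"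

fun artin_index :: "artin \<Rightarrow> nat" where
  "artin_index S0 = 0" | "artin_index S1 = 1" | "artin_index S2 = 2"

fun letter_perm :: "artin letter \<Rightarrow> nat \<Rightarrow> nat" where
  "letter_perm (Pos s) = transpose (artin_index s) (Suc (artin_index s))"
| "letter_perm (Neg s) = transpose (artin_index s) (Suc (artin_index s))"

definition word_perm :: "artin letter list \<Rightarrow> nat \<Rightarrow> nat" where
  "word_perm w = foldr (\<lambda>l p. letter_perm l \<circ> p) w id"

lemma word_perm_append: "word_perm (u @ v) = word_perm u \<circ> word_perm v"
  by (induction u) (simp_all add: word_perm_def o_assoc)

lift_definition braid_perm :: "B4 \<Rightarrow> nat \<Rightarrow> nat" is word_perm
proof -
  fix u v :: "artin letter list"
  assume "word_eq u v"
  then show "word_perm u = word_perm v"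
  proof induction
    case (cancel l)
    show ?case by (cases l) (simp_all add: word_perm_def)
  next
    case (relator u v)
    then show ?case
      by (auto simp: relators_artin_def word_perm_def fun_eq_iff transpose_def)
  qed (simp_all add: word_perm_append)
qed

lemma braid_perm_zero: "braid_perm 0 = id"
  by transfer (simp add: word_perm_def)

lemma braid_perm_plus: "braid_perm (a + b) = braid_perm a \<circ> braid_perm b"
  by transfer (simp add: word_perm_append)

lemma braid_perm_minus: "braid_perm (- a) \<circ> braid_perm a = id"
  by (metis braid_perm_plus braid_perm_zero add.left_inverse)

typedef PB4 = "{b :: B4. braid_perm b = id}"
  by (rule exI[of _ 0]) (simp add: braid_perm_zero)

setup_lifting type_definition_PB4

instantiation PB4 :: group_add
begin

lift_definition zero_PB4 :: PB4 is 0 by (rule braid_perm_zero)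
lift_definition plus_PB4 :: "PB4 \<Rightarrow> PB4 \<Rightarrow> PB4" is "(+)" by (simp add: braid_perm_plus)
lift_definition uminus_PB4 :: "PB4 \<Rightarrow> PB4" is uminus by (metis braid_perm_minus comp_id)
definition minus_PB4 :: "PB4 \<Rightarrow> PB4 \<Rightarrow> PB4" where "minus_PB4 x y = x + - y"

instance
proof
  fix a b c :: PB4
  show "a + b + c = a + (b + c)" by transfer (simp add: add.assoc)
  show "0 + a = a" by transfer simp
  show "a + 0 = a" by transfer simp
  show "- a + a = 0" by transfer simp
  show "a + - b = a - b" by (simp add: minus_PB4_def)
qed

end

definition sigma :: "nat \<Rightarrow> B4" where
  "sigma k = gen (if k = 0 then S0 else if k = 1 then S1 else S2)"

lemma braid_perm_sigma_sigma: "braid_perm (sigma k + sigma k) = id"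
  unfolding sigma_def by transfer (simp add: word_perm_def fun_eq_iff)

text \<open>\<open>xpure i j\<close> (\<open>0 \<le> i < j \<le> 3\<close>) is
  \<open>(\<sigma>\<^sub>j\<^sub>-\<^sub>2 \<cdots> \<sigma>\<^sub>i)\<^sup>-\<^sup>1 \<sigma>\<^sub>j\<^sub>-\<^sub>1\<^sup>2 (\<sigma>\<^sub>j\<^sub>-\<^sub>2 \<cdots> \<sigma>\<^sub>i)\<close>, the indices in \<open>\<sigma>\<^sub>j\<^sub>-\<^sub>2 \<cdots> \<sigma>\<^sub>i\<close> decreasing.\<close>

lift_definition xpure :: "nat \<Rightarrow> nat \<Rightarrow> PB4" is
  "\<lambda>i j. let w = sum_list (map sigma (rev [i..<j - 1]))
         in - w + (sigma (j - 1) + sigma (j - 1)) + w"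
  by (metis (no_types, lifting) braid_perm_minus braid_perm_plus braid_perm_sigma_sigma comp_id)


section \<open>The completed group algebra\<close>

definition augm :: "('g::group_add \<Rightarrow>\<^sub>0 'k::field) \<Rightarrow> 'k" where
  "augm a = (\<Sum>g\<in>Poly_Mapping.keys a. Poly_Mapping.lookup a g)"

inductive_set ideal_prod :: "'r::ring_1 set \<Rightarrow> 'r set \<Rightarrow> 'r set" for A B where
  zero: "0 \<in> ideal_prod A B"
| add: "u \<in> A \<Longrightarrow> v \<in> B \<Longrightarrow> w \<in> ideal_prod A B \<Longrightarrow> u * v + w \<in> ideal_prod A B"

fun aug_pow :: "nat \<Rightarrow> ('g::group_add \<Rightarrow>\<^sub>0 'k::field) set" where
  "aug_pow 0 = UNIV"
| "aug_pow (Suc n) = ideal_prod {a. augm a = 0} (aug_pow n)"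

lemma augm_superset:
  "finite S \<Longrightarrow> Poly_Mapping.keys a \<subseteq> S \<Longrightarrow> augm a = (\<Sum>g\<in>S. Poly_Mapping.lookup a g)"
  unfolding augm_def by (rule sum.mono_neutral_left) (auto simp: in_keys_iff)

lemma augm_zero [simp]: "augm 0 = 0"
  by (simp add: augm_def)

lemma augm_single [simp]: "augm (Poly_Mapping.single g c) = c"
  by (subst augm_superset[of "{g}"]) auto

lemma augm_add [simp]: "augm (a + b) = augm a + augm b"
proof -
  let ?S = "Poly_Mapping.keys a \<union> Poly_Mapping.keys b"
  have "augm (a + b) = (\<Sum>g\<in>?S. Poly_Mapping.lookup (a + b) g)"
    by (rule augm_superset) (auto simp: Poly_Mapping.keys_add)
  moreover have "augm a = (\<Sum>g\<in>?S. Poly_Mapping.lookup a g)"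
    by (rule augm_superset) auto
  moreover have "augm b = (\<Sum>g\<in>?S. Poly_Mapping.lookup b g)"
    by (rule augm_superset) auto
  ultimately show ?thesis by (simp add: lookup_add sum.distrib)
qed

lemma single_add_induct:
  assumes "P 0" and "\<And>g c a. P a \<Longrightarrow> P (Poly_Mapping.single g c + a)"
  shows "P (a :: 'g \<Rightarrow>\<^sub>0 'k::comm_monoid_add)"
proof (induction a rule: update_induct)
  case const
  show ?case by (rule assms(1))
next
  case (update a g c)
  have "Poly_Mapping.update g c a = Poly_Mapping.single g c + a"
    using update(1)
    by (intro poly_mapping_eqI)
      (auto simp: lookup_update lookup_add lookup_single when_def in_keys_iff)
  then show ?case using assms(2) update by simp
qed

lemma augm_mult [simp]: "augm (a * b) = augm a * augm b"
proof (induction a rule: single_add_induct)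
  case (2 g c a)
  have "augm (Poly_Mapping.single g c * b) = c * augm b" for b
    by (induction b rule: single_add_induct) (simp_all add: distrib_left mult_single)
  with 2 show ?case by (simp add: distrib_right)
qed simp

lemma ideal_prod_add:
  "x \<in> ideal_prod A B \<Longrightarrow> y \<in> ideal_prod A B \<Longrightarrow> x + y \<in> ideal_prod A B"
  by (induction rule: ideal_prod.induct) (auto simp: add.assoc intro: ideal_prod.add)

lemma ideal_prod_mult_left:
  assumes "x \<in> ideal_prod A B" and "\<And>u. u \<in> A \<Longrightarrow> r * u \<in> A"
  shows "r * x \<in> ideal_prod A B"
  using assms(1)
  by induction
    (auto simp: distrib_left mult.assoc[symmetric] intro: ideal_prod.intros assms(2))

lemma ideal_prod_mult_right:
  assumes "x \<in> ideal_prod A B" and "\<And>u. u \<in> B \<Longrightarrow> u * r \<in> B"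
  shows "x * r \<in> ideal_prod A B"
  using assms(1)
  by induction (auto simp: distrib_right mult.assoc intro: ideal_prod.intros assms(2))

lemma aug_pow_zero: "0 \<in> aug_pow n"
  by (cases n) (auto intro: ideal_prod.zero)

lemma aug_pow_add: "x \<in> aug_pow n \<Longrightarrow> y \<in> aug_pow n \<Longrightarrow> x + y \<in> aug_pow n"
  by (cases n) (auto intro: ideal_prod_add)

lemma aug_pow_mult_left: "x \<in> aug_pow n \<Longrightarrow> r * x \<in> aug_pow n"
  by (cases n) (auto intro: ideal_prod_mult_left)

lemma aug_pow_mult_right: "x \<in> aug_pow n \<Longrightarrow> x * r \<in> aug_pow n"
  by (induction n arbitrary: x) (auto intro: ideal_prod_mult_right)

lemma aug_pow_uminus: "x \<in> aug_pow n \<Longrightarrow> - x \<in> aug_pow n"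
  using aug_pow_mult_left[of x n "- 1"] by simp

lemma aug_pow_diff: "x \<in> aug_pow n \<Longrightarrow> y \<in> aug_pow n \<Longrightarrow> x - y \<in> aug_pow n"
  using aug_pow_add[of x n "- y"] aug_pow_uminus by fastforce

lemma aug_pow_1: "aug_pow (Suc 0) \<subseteq> {a. augm a = 0}"
proof
  fix x :: "'g::group_add \<Rightarrow>\<^sub>0 'k::field"
  assume "x \<in> aug_pow (Suc 0)"
  then have "x \<in> ideal_prod {a. augm a = 0} UNIV" by simp
  then show "x \<in> {a. augm a = 0}" by induction simp_all
qed

text \<open>An element of \<open>lim\<^sub>n k[G]/I\<^sup>n\<close> is represented by a sequence whose \<open>n\<close>-th entry is a
  representative of its component in \<open>k[G]/I\<^sup>n\<close>.\<close>

definition coherent :: "(nat \<Rightarrow> ('g::group_add \<Rightarrow>\<^sub>0 'k::field)) \<Rightarrow> bool" where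
  "coherent a \<longleftrightarrow> (\<forall>n. a (Suc n) - a n \<in> aug_pow n)"

definition coherent_eq ::
    "(nat \<Rightarrow> ('g::group_add \<Rightarrow>\<^sub>0 'k::field)) \<Rightarrow> (nat \<Rightarrow> ('g \<Rightarrow>\<^sub>0 'k)) \<Rightarrow> bool" where
  "coherent_eq a b \<longleftrightarrow> coherent a \<and> coherent b \<and> (\<forall>n. a n - b n \<in> aug_pow n)"

lemma coherent_const: "coherent (\<lambda>n. a)"
  by (simp add: coherent_def aug_pow_zero)

quotient_type (overloaded) ('g, 'k) cga = "nat \<Rightarrow> ('g::group_add \<Rightarrow>\<^sub>0 'k::field)"
  / partial: "coherent_eq"
proof (rule part_equivpI)
  show "\<exists>a :: nat \<Rightarrow> ('g \<Rightarrow>\<^sub>0 'k). coherent_eq a a"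
    by (rule exI[of _ "\<lambda>n. 0"]) (simp add: coherent_eq_def coherent_const aug_pow_zero)
  show "symp (coherent_eq :: (nat \<Rightarrow> ('g \<Rightarrow>\<^sub>0 'k)) \<Rightarrow> _)"
  proof (rule sympI)
    fix a b :: "nat \<Rightarrow> ('g \<Rightarrow>\<^sub>0 'k)"
    assume "coherent_eq a b"
    then show "coherent_eq b a"
      using aug_pow_uminus[of "a n - b n" n for n] by (auto simp: coherent_eq_def)
  qed
  show "transp (coherent_eq :: (nat \<Rightarrow> ('g \<Rightarrow>\<^sub>0 'k)) \<Rightarrow> _)"
  proof (rule transpI)
    fix a b c :: "nat \<Rightarrow> ('g \<Rightarrow>\<^sub>0 'k)"
    assume "coherent_eq a b" "coherent_eq b c"
    then show "coherent_eq a c"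
      using aug_pow_add[of "a n - b n" n "b n - c n" for n] by (auto simp: coherent_eq_def)
  qed
qed

lemma coherent_eq_add:
  assumes "coherent_eq a a'" "coherent_eq b b'"
  shows "coherent_eq (\<lambda>n. a n + b n) (\<lambda>n. a' n + b' n)"
proof -
  have "x + y - (x' + y') \<in> aug_pow n"
    if "x - x' \<in> aug_pow n" "y - y' \<in> aug_pow n" for x y x' y' :: "'a \<Rightarrow>\<^sub>0 'b" and n
    using aug_pow_add[OF that] by (simp add: algebra_simps)
  with assms show ?thesis
    unfolding coherent_eq_def coherent_def by blast
qed

lemma coherent_eq_uminus:
  assumes "coherent_eq a a'"
  shows "coherent_eq (\<lambda>n. - a n) (\<lambda>n. - a' n)"
proof -
  have "- x - - y \<in> aug_pow n" if "x - y \<in> aug_pow n" for x y :: "'a \<Rightarrow>\<^sub>0 'b" and n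
    using aug_pow_uminus[OF that] by simp
  with assms show ?thesis
    unfolding coherent_eq_def coherent_def by blast
qed

lemma coherent_eq_mult:
  assumes "coherent_eq a a'" "coherent_eq b b'"
  shows "coherent_eq (\<lambda>n. a n * b n) (\<lambda>n. a' n * b' n)"
proof -
  have "x * y - x' * y' \<in> aug_pow n"
    if "x - x' \<in> aug_pow n" "y - y' \<in> aug_pow n" for x y x' y' :: "'a \<Rightarrow>\<^sub>0 'b" and n
  proof -
    have "x * y - x' * y' = (x - x') * y + x' * (y - y')"
      by (simp add: algebra_simps)
    then show ?thesis
      using that by (simp add: aug_pow_add aug_pow_mult_left aug_pow_mult_right)
  qed
  with assms show ?thesis
    unfolding coherent_eq_def coherent_def by blast
qed

instantiation cga :: (group_add, field) ring_1
begin

lift_definition zero_cga :: "('a, 'b) cga" is "\<lambda>n. 0"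
  by (simp add: coherent_eq_def coherent_const aug_pow_zero)
lift_definition one_cga :: "('a, 'b) cga" is "\<lambda>n. 1"
  by (simp add: coherent_eq_def coherent_const aug_pow_zero)
lift_definition plus_cga :: "('a, 'b) cga \<Rightarrow> ('a, 'b) cga \<Rightarrow> ('a, 'b) cga"
  is "\<lambda>a b n. a n + b n" by (rule coherent_eq_add)
lift_definition uminus_cga :: "('a, 'b) cga \<Rightarrow> ('a, 'b) cga"
  is "\<lambda>a n. - a n" by (rule coherent_eq_uminus)
lift_definition times_cga :: "('a, 'b) cga \<Rightarrow> ('a, 'b) cga \<Rightarrow> ('a, 'b) cga"
  is "\<lambda>a b n. a n * b n" by (rule coherent_eq_mult)
definition minus_cga :: "('a, 'b) cga \<Rightarrow> ('a, 'b) cga \<Rightarrow> ('a, 'b) cga" where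
  "minus_cga x y = x + - y"

instance
proof
  fix a b c :: "('a, 'b) cga"
  show "a + b + c = a + (b + c)"
    by transfer (simp only: add.assoc, intro coherent_eq_add)
  show "a + b = b + a"
    by transfer (subst add.commute, intro coherent_eq_add)
  show "0 + a = a" by transfer simp
  show "- a + a = 0"
    by transfer (simp add: coherent_eq_def coherent_const aug_pow_zero)
  show "a - b = a + - b" by (simp add: minus_cga_def)
  show "a * b * c = a * (b * c)"
    by transfer (simp only: mult.assoc, intro coherent_eq_mult)
  show "1 * a = a" by transfer simp
  show "a * 1 = a" by transfer simp
  show "(a + b) * c = a * c + b * c"
    by transfer (simp only: distrib_right, intro coherent_eq_add coherent_eq_mult)
  show "a * (b + c) = a * b + a * c"
    by transfer (simp only: distrib_left, intro coherent_eq_add coherent_eq_mult)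
  have "(1 :: 'a \<Rightarrow>\<^sub>0 'b) \<notin> aug_pow (Suc 0)"
    using aug_pow_1 augm_single[of "0::'a" "1::'b"]
    by (metis (mono_tags, lifting) mem_Collect_eq single_one subsetD zero_neq_one)
  then have "\<not> coherent_eq (\<lambda>n. 0) (\<lambda>n. 1 :: 'a \<Rightarrow>\<^sub>0 'b)"
    unfolding coherent_eq_def
    by (metis aug_pow_uminus diff_0 minus_minus)
  then show "(0 :: ('a, 'b) cga) \<noteq> 1" by transfer simp
qed

end

definition emb :: "('g::group_add \<Rightarrow>\<^sub>0 'k::field) \<Rightarrow> ('g, 'k) cga" where
  "emb a = abs_cga (\<lambda>n. a)"

definition of_grp :: "'g::group_add \<Rightarrow> ('g, 'k::field) cga" where
  "of_grp g = emb (Poly_Mapping.single g 1)"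

definition caugm :: "('g::group_add, 'k::field) cga \<Rightarrow> 'k" where
  "caugm x = augm (rep_cga x 1)"

text \<open>Linear and then continuous extension of a map \<open>\<rho>\<close> defined on group elements. The diagonal
  sequence converges, and the result is a continuous algebra homomorphism, when \<open>\<rho>\<close> is
  multiplicative with values of augmentation \<open>1\<close>.\<close>

definition lin_ext ::
    "('g::group_add \<Rightarrow> ('h::group_add, 'k::field) cga) \<Rightarrow> ('g \<Rightarrow>\<^sub>0 'k) \<Rightarrow> ('h, 'k) cga" where
  "lin_ext \<rho> a = (\<Sum>g\<in>Poly_Mapping.keys a.
     emb (Poly_Mapping.single 0 (Poly_Mapping.lookup a g)) * \<rho> g)"

definition cont_ext ::
    "('g::group_add \<Rightarrow> ('h::group_add, 'k::field) cga) \<Rightarrow> ('g, 'k) cga \<Rightarrow> ('h, 'k) cga" where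
  "cont_ext \<rho> x = abs_cga (\<lambda>n. rep_cga (lin_ext \<rho> (rep_cga x n)) n)"


section \<open>Malcev completion\<close>

text \<open>\<open>G(k)\<close> is the group of group-like elements of the completed group algebra. The completed
  tensor square of \<open>k[[G]]\<close> is \<open>k[[G \<times> G]]\<close>: under \<open>k[G] \<otimes> k[G] = k[G \<times> G]\<close> the augmentation ideal
  of \<open>G \<times> G\<close> is \<open>I \<otimes> 1 + 1 \<otimes> I\<close>.\<close>

definition coproduct :: "('g::group_add, 'k::field) cga \<Rightarrow> ('g \<times> 'g, 'k) cga" where
  "coproduct = cont_ext (\<lambda>g. of_grp (g, g))"

definition ctensor ::
    "('g::group_add, 'k::field) cga \<Rightarrow> ('g, 'k) cga \<Rightarrow> ('g \<times> 'g, 'k) cga" where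
  "ctensor x y = cont_ext (\<lambda>g. of_grp (g, 0)) x * cont_ext (\<lambda>g. of_grp (0, g)) y"

definition malcev :: "('g::group_add, 'k::field_char_0) cga monoid" where
  "malcev = \<lparr>carrier = {x. caugm x = 1 \<and> coproduct x = ctensor x x}, mult = (*), one = 1\<rparr>"

abbreviation malcev_mult (infixl "\<odot>" 70) where
  "x \<odot> y \<equiv> x \<otimes>\<^bsub>malcev\<^esub> y"

abbreviation minv :: "('g::group_add, 'k::field_char_0) cga \<Rightarrow> ('g, 'k) cga" where
  "minv x \<equiv> inv\<^bsub>malcev\<^esub> x"

definition conj_by ::
    "('g::group_add, 'k::field_char_0) cga \<Rightarrow> ('g, 'k) cga \<Rightarrow> ('g, 'k) cga" where
  "conj_by w z = w \<odot> z \<odot> minv w"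

text \<open>The morphism from the completion of a free group that takes the values \<open>v\<close> in \<open>H(k)\<close> on the
  generators.\<close>

definition malcev_subst :: "('a::presented \<Rightarrow> ('h::group_add, 'k::field_char_0) cga)
    \<Rightarrow> ('a presgroup, 'k) cga \<Rightarrow> ('h, 'k) cga" where
  "malcev_subst v = cont_ext (hom_ext malcev v)"

definition subst2 :: "(F2, 'k::field_char_0) cga \<Rightarrow> ('h::group_add, 'k) cga
    \<Rightarrow> ('h, 'k) cga \<Rightarrow> ('h, 'k) cga" where
  "subst2 f g h = malcev_subst (case_gen2 g h) f"

abbreviation cX :: "(F2, 'k::field_char_0) cga" where "cX \<equiv> of_grp (gen GX)"
abbreviation cY :: "(F2, 'k::field_char_0) cga" where "cY \<equiv> of_grp (gen GY)"

abbreviation cX1 :: "(F3, 'k::field_char_0) cga" where "cX1 \<equiv> of_grp (gen G1)"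
abbreviation cX2 :: "(F3, 'k::field_char_0) cga" where "cX2 \<equiv> of_grp (gen G2)"
abbreviation cX3 :: "(F3, 'k::field_char_0) cga" where "cX3 \<equiv> of_grp (gen G3)"

abbreviation cx :: "nat \<Rightarrow> nat \<Rightarrow> (PB4, 'k::field_char_0) cga" where
  "cx i j \<equiv> of_grp (xpure i j)"

text \<open>\<open>x\<^sub>i\<^sub>j\<close> for strands labelled \<open>1, 2, 3, 4\<close>, with Artin generators \<open>\<sigma>\<^sub>1, \<sigma>\<^sub>2, \<sigma>\<^sub>3\<close>: the same
  group with all labels lowered by one.\<close>

abbreviation cx_shift :: "nat \<Rightarrow> nat \<Rightarrow> (PB4, 'k::field_char_0) cga" where
  "cx_shift i j \<equiv> cx (i - 1) (j - 1)"

definition GT1 :: "(F2, 'k::field_char_0) cga set" where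
  "GT1 = {f \<in> carrier malcev.
     subst2 f cY cX = minv f \<and>
     f \<odot> subst2 f (minv cY \<odot> minv cX) cX \<odot> subst2 f cY (minv cY \<odot> minv cX) = \<one>\<^bsub>malcev\<^esub> \<and>
     subst2 f (cx_shift 2 3) (cx_shift 3 4)
       \<odot> subst2 f (cx_shift 1 2 \<odot> cx_shift 1 3) (cx_shift 2 4 \<odot> cx_shift 3 4)
       \<odot> subst2 f (cx_shift 1 2) (cx_shift 2 3)
     = subst2 f (cx_shift 1 2) (cx_shift 2 3 \<odot> cx_shift 2 4)
       \<odot> subst2 f (cx_shift 1 3 \<odot> cx_shift 2 3) (cx_shift 3 4)}"


section \<open>The automorphisms\<close>

definition alphaP :: "(F2, 'k::field_char_0) cga \<Rightarrow> (F2, 'k) cga" where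
  "alphaP f = subst2 f cX (minv cY \<odot> minv cX)"

definition alphaQ :: "(F2, 'k::field_char_0) cga \<Rightarrow> (F2, 'k) cga" where
  "alphaQ f = subst2 f cY (minv cY \<odot> minv cX)"

definition endF2 :: "(F2, 'k::field_char_0) cga \<Rightarrow> (F2, 'k) cga
    \<Rightarrow> (F2, 'k) cga \<Rightarrow> (F2, 'k) cga" where
  "endF2 u v = restrict (malcev_subst (case_gen2 u v)) (carrier malcev)"

definition endF3 :: "(F3, 'k::field_char_0) cga \<Rightarrow> (F3, 'k) cga \<Rightarrow> (F3, 'k) cga
    \<Rightarrow> (F3, 'k) cga \<Rightarrow> (F3, 'k) cga" where
  "endF3 u v w = restrict (malcev_subst (case_gen3 u v w)) (carrier malcev)"

definition alpha :: "(F2, 'k::field_char_0) cga \<Rightarrow> (F2, 'k) cga \<Rightarrow> (F2, 'k) cga" where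
  "alpha f = endF2 (conj_by (alphaP f) cX) (conj_by (alphaQ f) cY)"

definition alpha_1_2 :: "(F2, 'k::field_char_0) cga \<Rightarrow> (F3, 'k) cga \<Rightarrow> (F3, 'k) cga" where
  "alpha_1_2 f = endF3
     (conj_by (subst2 (alphaP f) cX1 cX2) cX1)
     (conj_by (subst2 (alphaQ f) cX1 cX2) cX2)
     cX3"

definition alpha_2_3 :: "(F2, 'k::field_char_0) cga \<Rightarrow> (F3, 'k) cga \<Rightarrow> (F3, 'k) cga" where
  "alpha_2_3 f = endF3
     cX1
     (conj_by (subst2 (alphaP f) cX2 cX3) cX2)
     (conj_by (subst2 (alphaQ f) cX2 cX3) cX3)"

definition alpha_12_3 :: "(F2, 'k::field_char_0) cga \<Rightarrow> (F3, 'k) cga \<Rightarrow> (F3, 'k) cga" where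
  "alpha_12_3 f = endF3
     (conj_by (subst2 (alphaP f) (cX1 \<odot> cX2) cX3) cX1)
     (conj_by (subst2 (alphaP f) (cX1 \<odot> cX2) cX3) cX2)
     (conj_by (subst2 (alphaQ f) (cX1 \<odot> cX2) cX3) cX3)"

definition alpha_1_23 :: "(F2, 'k::field_char_0) cga \<Rightarrow> (F3, 'k) cga \<Rightarrow> (F3, 'k) cga" where
  "alpha_1_23 f = endF3
     (conj_by (subst2 (alphaP f) cX1 (cX2 \<odot> cX3)) cX1)
     (conj_by (subst2 (alphaQ f) cX1 (cX2 \<odot> cX3)) cX2)
     (conj_by (subst2 (alphaQ f) cX1 (cX2 \<odot> cX3)) cX3)"

text \<open>The embedding of \<open>F\<^sub>3(k)\<close> as a normal subgroup of \<open>PB\<^sub>4(k)\<close>, \<open>X\<^sub>i \<mapsto> x\<^sub>0\<^sub>i\<close>, and the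
  conjugation action transported back along it.\<close>

definition F3_to_PB4 :: "(F3, 'k::field_char_0) cga \<Rightarrow> (PB4, 'k) cga" where
  "F3_to_PB4 = malcev_subst (case_gen3 (cx 0 1) (cx 0 2) (cx 0 3))"

definition Ad :: "(PB4, 'k::field_char_0) cga \<Rightarrow> (F3, 'k) cga \<Rightarrow> (F3, 'k) cga" where
  "Ad g = (\<lambda>u \<in> carrier malcev. the_inv_into (carrier malcev) F3_to_PB4 (conj_by g (F3_to_PB4 u)))"

end

theory Submission
  imports Defs
begin

text \<open>
  Linear maps between completed group algebras that respect the filtration by powers of the
  augmentation ideal are determined by their values on group elements, so identities of continuous
  maps reduce to discrete ones.

  The set \<open>B\<^sub>4 / \<langle>\<sigma>\<^sub>1, \<sigma>\<^sub>2\<rangle>\<close> is \<open>{0, \<dots>, 3} \<times> F\<^sub>3\<close>, and \<open>PB\<^sub>4\<close> preserves the component of \<open>0\<close>; there it acts by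
  affine maps \<open>u \<mapsto> c\<^sub>g \<theta>\<^sub>g(u)\<close>, where \<open>\<theta>\<^sub>g\<close> is trivial on the abelianization and \<open>x\<^sub>0\<^sub>i\<close> acts as left
  multiplication by \<open>X\<^sub>i\<close>. The orbit map \<open>g \<mapsto> c\<^sub>g\<close> therefore extends to a continuous retraction of
  \<open>k[[F\<^sub>3]] \<rightarrow> k[[PB\<^sub>4]]\<close>, which makes this map injective and lets normality pass to the completion.
  The \<open>X\<^sub>1\<close>-exponent of \<open>c\<^sub>g\<close> is a homomorphism, and the image of the pentagon under it is \<open>f(c, 1) = 1\<close>.
  Hence \<open>f\<close> does not see factors that commute with both arguments.

  It remains to compare both sides on \<open>X\<^sub>1, X\<^sub>2, X\<^sub>3\<close> inside \<open>PB\<^sub>4(k)\<close>, where \<open>Y\<^sup>-\<^sup>1X\<^sup>-\<^sup>1\<close> becomes one of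
  \<open>x\<^sub>1\<^sub>2\<close>, \<open>x\<^sub>2\<^sub>3\<close>, \<open>x\<^sub>1\<^sub>3x\<^sub>2\<^sub>3\<close>, \<open>x\<^sub>1\<^sub>2x\<^sub>1\<^sub>3\<close> up to such factors. On \<open>X\<^sub>1\<close> this is the pentagon; on \<open>X\<^sub>2\<close> and
  \<open>X\<^sub>3\<close> it follows from the hexagons and the conjugates of the pentagon by \<open>\<sigma>\<^sub>0\<^sup>-\<^sup>1\<close> and \<open>\<sigma>\<^sub>0\<^sup>-\<^sup>1\<sigma>\<^sub>1\<^sup>-\<^sup>1\<close>.
\<close>

section \<open>The filtration of the completed group algebra\<close>

text \<open>Completion need not preserve injectivity or normality of a subgroup. Both survive here
  because pure braids act unipotently, which makes the filtrations of the two group algebras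
  compatible. The orbit map records the free component in the semidirect product of
  \<open>F3\<close> with the pure braids on strands 1, 2, 3. It is a crossed homomorphism, so the
  retraction is linear but not multiplicative, and group-likeness of preimages is decided on the
  tensor square, by a second retraction of the same kind. The conjugated pentagons are the pentagon
  for the strand orders 1, 0, 2, 3 and 1, 2, 0, 3. Hexagons let strand 0 pass a neighbour or a
  ribbon, and for each position of strand 0 the resulting equation ends in a factor that centralizes
  the corresponding generator. The factors that \<open>f\<close> ignores are full twists of strands
  or ribbons.\<close>

lemma aug_pow_Suc_subset: "aug_pow (Suc n) \<subseteq> aug_pow n"
proof
  fix x :: "'g::group_add \<Rightarrow>\<^sub>0 'k::field"
  assume "x \<in> aug_pow (Suc n)"
  then have "x \<in> ideal_prod {a. augm a = 0} (aug_pow n)" by simp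
  then show "x \<in> aug_pow n"
    by induction (auto intro: aug_pow_zero aug_pow_add aug_pow_mult_left)
qed

lemma aug_pow_antimono: "m \<le> n \<Longrightarrow> aug_pow n \<subseteq> aug_pow m"
  by (induction n rule: dec_induct) (use aug_pow_Suc_subset in blast)+

lemma aug_pow_mult: "x \<in> aug_pow m \<Longrightarrow> y \<in> aug_pow n \<Longrightarrow> x * y \<in> aug_pow (m + n)"
proof (induction m arbitrary: x)
  case 0
  then show ?case by (simp add: aug_pow_mult_left)
next
  case (Suc m)
  from Suc.prems(1) have "x \<in> ideal_prod {a. augm a = 0} (aug_pow m)" by simp
  then have "x * y \<in> ideal_prod {a. augm a = 0} (aug_pow (m + n))"
    by induction
      (auto simp: distrib_right mult.assoc intro!: ideal_prod.intros Suc.IH Suc.prems(2))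
  then show ?case by simp
qed

lemma aug_pow_one: "aug_pow (Suc 0) = {a. augm a = 0}"
proof
  have "u * 1 + 0 \<in> ideal_prod {a. augm a = 0} UNIV" if "augm u = 0" for u :: "'g::group_add \<Rightarrow>\<^sub>0 'k::field"
    using that by (intro ideal_prod.intros) auto
  then show "{a :: 'g::group_add \<Rightarrow>\<^sub>0 'k::field. augm a = 0} \<subseteq> aug_pow (Suc 0)" by auto
qed (rule aug_pow_1)

text \<open>The kernel of the projection to \<open>k[G]/I^n\<close>. These two-sided ideals are a
  basis of neighbourhoods of zero; continuity is expressed by inclusions between them.\<close>

definition cfilt :: "nat \<Rightarrow> ('g::group_add, 'k::field) cga set" where
  "cfilt n = {x. rep_cga x n \<in> aug_pow n}"

lemma abs_rep_cga [simp]: "abs_cga (rep_cga x) = x"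
  by (rule Quotient3_abs_rep[OF Quotient3_cga])

lemma coherent_rep: "coherent (rep_cga x)"
  using Quotient3_rep_reflp[OF Quotient3_cga, of x] by (simp add: coherent_eq_def)

lemma coherent_eq_refl: "coherent a \<Longrightarrow> coherent_eq a a"
  by (simp add: coherent_eq_def aug_pow_zero)

lemma rep_abs_cga: "coherent a \<Longrightarrow> coherent_eq (rep_cga (abs_cga a)) a"
  using Quotient3_rel[OF Quotient3_cga, of "rep_cga (abs_cga a)" a]
  by (simp add: coherent_eq_refl coherent_rep)

lemma rep_abs_diff: "coherent a \<Longrightarrow> rep_cga (abs_cga a) n - a n \<in> aug_pow n"
  using rep_abs_cga by (auto simp: coherent_eq_def)

lemma aug_pow_cong: "a - b \<in> aug_pow n \<Longrightarrow> a \<in> aug_pow n \<longleftrightarrow> b \<in> aug_pow n"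
  using aug_pow_add[of "a - b" n b] aug_pow_diff[of a n "a - b"] by auto

lemma coherent_diff:
  assumes "coherent a" "m \<le> n"
  shows "a n - a m \<in> aug_pow m"
  using assms(2)
proof (induction n rule: dec_induct)
  case base
  show ?case by (simp add: aug_pow_zero)
next
  case (step n)
  have "a (Suc n) - a n \<in> aug_pow m"
    using assms(1) step aug_pow_antimono[of m n] by (auto simp: coherent_def)
  from aug_pow_add[OF this step.IH] show ?case by simp
qed

lemma abs_in_cfilt: "coherent a \<Longrightarrow> abs_cga a \<in> cfilt n \<longleftrightarrow> a n \<in> aug_pow n"
  unfolding cfilt_def using aug_pow_cong[OF rep_abs_diff] by blast

lemma coherent_plus: "coherent a \<Longrightarrow> coherent b \<Longrightarrow> coherent (\<lambda>n. a n + b n)"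
  using coherent_eq_add[of a a b b] by (simp add: coherent_eq_refl) (simp add: coherent_eq_def)

lemma coherent_uminus: "coherent a \<Longrightarrow> coherent (\<lambda>n. - a n)"
  using coherent_eq_uminus[of a a] by (simp add: coherent_eq_refl) (simp add: coherent_eq_def)

lemma coherent_mult: "coherent a \<Longrightarrow> coherent b \<Longrightarrow> coherent (\<lambda>n. a n * b n)"
  using coherent_eq_mult[of a a b b] by (simp add: coherent_eq_refl) (simp add: coherent_eq_def)

lemma plus_abs: "coherent a \<Longrightarrow> coherent b \<Longrightarrow> abs_cga a + abs_cga b = abs_cga (\<lambda>n. a n + b n)"
  by (rule plus_cga.abs_eq) (auto simp: coherent_eq_refl)

lemma uminus_abs: "coherent a \<Longrightarrow> - abs_cga a = abs_cga (\<lambda>n. - a n)"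
  by (rule uminus_cga.abs_eq) (auto simp: coherent_eq_refl)

lemma times_abs: "coherent a \<Longrightarrow> coherent b \<Longrightarrow> abs_cga a * abs_cga b = abs_cga (\<lambda>n. a n * b n)"
  by (rule times_cga.abs_eq) (auto simp: coherent_eq_refl)

lemma cga_cases: obtains a where "coherent a" "x = abs_cga a"
  using coherent_rep[of x] abs_rep_cga[of x] by metis

lemma abs_cga_eq_iff: "coherent a \<Longrightarrow> coherent b \<Longrightarrow> abs_cga a = abs_cga b \<longleftrightarrow> (\<forall>n. a n - b n \<in> aug_pow n)"
  using Quotient3_rel[OF Quotient3_cga, of a b] by (auto simp: coherent_eq_def coherent_eq_refl aug_pow_zero)

lemma cfilt_0 [simp]: "x \<in> cfilt 0" by (simp add: cfilt_def)

lemma cfilt_zero [simp]: "0 \<in> cfilt n"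
  unfolding zero_cga_def by (subst abs_in_cfilt) (auto simp: coherent_const aug_pow_zero)

lemma cfilt_add: "x \<in> cfilt n \<Longrightarrow> y \<in> cfilt n \<Longrightarrow> x + y \<in> cfilt n"
  by (cases x rule: cga_cases, cases y rule: cga_cases)
    (simp add: plus_abs abs_in_cfilt coherent_plus aug_pow_add)

lemma cfilt_uminus: "x \<in> cfilt n \<Longrightarrow> - x \<in> cfilt n"
  by (cases x rule: cga_cases) (simp add: uminus_abs abs_in_cfilt coherent_uminus aug_pow_uminus)

lemma cfilt_diff: "x \<in> cfilt n \<Longrightarrow> y \<in> cfilt n \<Longrightarrow> x - y \<in> cfilt n"
  using cfilt_add[of x n "- y"] cfilt_uminus[of y n] by simp

lemma cfilt_antimono: "m \<le> n \<Longrightarrow> x \<in> cfilt n \<Longrightarrow> x \<in> cfilt m"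
  using aug_pow_antimono[of m n] aug_pow_cong[OF coherent_diff[OF coherent_rep, of m n x]]
  unfolding cfilt_def by auto

lemma cfilt_mult: "x \<in> cfilt m \<Longrightarrow> y \<in> cfilt n \<Longrightarrow> x * y \<in> cfilt (m + n)"
proof (cases x rule: cga_cases, cases y rule: cga_cases)
  fix a b
  assume *: "x \<in> cfilt m" "y \<in> cfilt n" "coherent a" "x = abs_cga a" "coherent b" "y = abs_cga b"
  then have "a m \<in> aug_pow m" "b n \<in> aug_pow n" by (auto simp: abs_in_cfilt)
  then have "a (m + n) \<in> aug_pow m" "b (m + n) \<in> aug_pow n"
    using aug_pow_cong[OF coherent_diff[OF *(3), of m "m + n"]]
      aug_pow_cong[OF coherent_diff[OF *(5), of n "m + n"]] by auto
  then have "a (m + n) * b (m + n) \<in> aug_pow (m + n)" by (rule aug_pow_mult)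
  with * show ?thesis by (simp add: times_abs abs_in_cfilt coherent_mult)
qed

lemma cfilt_mult_left: "x \<in> cfilt n \<Longrightarrow> r * x \<in> cfilt n"
  using cfilt_mult[of r 0 x n] by simp

lemma cfilt_mult_right: "x \<in> cfilt n \<Longrightarrow> x * r \<in> cfilt n"
  using cfilt_mult[of x n r 0] by simp

lemma cfilt_separated: "(\<And>n. x \<in> cfilt n) \<Longrightarrow> x = 0"
proof (cases x rule: cga_cases)
  fix a assume "\<And>n. x \<in> cfilt n" "coherent a" "x = abs_cga a"
  then show "x = 0"
    unfolding zero_cga_def by (simp add: abs_cga_eq_iff coherent_const abs_in_cfilt)
qed

lemma cfilt_eqI: "(\<And>n. x - y \<in> cfilt n) \<Longrightarrow> x = y"
  using cfilt_separated[of "x - y"] by simp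

lemma cfilt_trans: "x - y \<in> cfilt n \<Longrightarrow> y - z \<in> cfilt n \<Longrightarrow> x - z \<in> cfilt n"
  using cfilt_add[of "x - y" n "y - z"] by simp

lemma cfilt_commute: "x - y \<in> cfilt n \<Longrightarrow> y - x \<in> cfilt n"
  using cfilt_uminus[of "x - y" n] by simp

lemma minus_abs: "coherent a \<Longrightarrow> coherent b \<Longrightarrow> abs_cga a - abs_cga b = abs_cga (\<lambda>n. a n - b n)"
  using plus_abs[of a "\<lambda>n. - b n"] by (simp add: minus_cga_def uminus_abs coherent_uminus)

lemma coherent_minus: "coherent a \<Longrightarrow> coherent b \<Longrightarrow> coherent (\<lambda>n. a n - b n)"
  using coherent_plus[of a "\<lambda>n. - b n"] by (simp add: coherent_uminus)

lemma diff_in_cfilt: "x - y \<in> cfilt n \<longleftrightarrow> rep_cga x n - rep_cga y n \<in> aug_pow n"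
proof -
  have "x - y = abs_cga (\<lambda>n. rep_cga x n - rep_cga y n)"
    by (subst minus_abs[symmetric]) (auto simp: coherent_rep)
  then show ?thesis by (simp add: abs_in_cfilt coherent_minus coherent_rep)
qed

text \<open>The limit takes its \<open>n\<close>-th component from \<open>s n\<close>; the
  hypothesis says that this component no longer changes afterwards.\<close>

lemma cfilt_complete:
  assumes "\<And>n. s (Suc n) - s n \<in> cfilt n"
  obtains x where "\<And>n. x - s n \<in> cfilt n"
proof -
  let ?a = "\<lambda>n. rep_cga (s n) n"
  have "?a (Suc n) - ?a n \<in> aug_pow n" for n
    using aug_pow_add[of "rep_cga (s (Suc n)) (Suc n) - rep_cga (s (Suc n)) n" n
        "rep_cga (s (Suc n)) n - rep_cga (s n) n"]
      assms[of n] coherent_rep[of "s (Suc n)"] by (simp add: diff_in_cfilt coherent_def)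
  then have coh: "coherent ?a" by (simp add: coherent_def)
  have "abs_cga ?a - s n \<in> cfilt n" for n
    unfolding diff_in_cfilt by (rule rep_abs_diff[OF coh])
  then show thesis by (rule that)
qed

lemma emb_add: "emb (a + b) = emb a + emb b"
  by (simp add: emb_def plus_abs coherent_const)

lemma emb_diff: "emb (a - b) = emb a - emb b"
  by (simp add: emb_def minus_abs coherent_const)

lemma emb_mult: "emb (a * b) = emb a * emb b"
  by (simp add: emb_def times_abs coherent_const)

lemma emb_zero [simp]: "emb 0 = 0" by (simp add: emb_def zero_cga_def)

lemma emb_one [simp]: "emb 1 = 1" by (simp add: emb_def one_cga_def)

lemma emb_in_cfilt: "emb a \<in> cfilt n \<longleftrightarrow> a \<in> aug_pow n"
  by (simp add: emb_def abs_in_cfilt coherent_const)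

lemma emb_approx: "x - emb (rep_cga x n) \<in> cfilt n"
proof -
  have "rep_cga (emb (rep_cga x n)) n - rep_cga x n \<in> aug_pow n"
    unfolding emb_def by (rule rep_abs_diff[OF coherent_const])
  then show ?thesis
    unfolding diff_in_cfilt using aug_pow_uminus by fastforce
qed

section \<open>Scalars, group elements and augmentation in the completion\<close>

definition scal :: "'k::field \<Rightarrow> ('g::group_add, 'k) cga" where
  "scal c = emb (Poly_Mapping.single 0 c)"

lemma single_zero_commute: "Poly_Mapping.single 0 c * a = a * Poly_Mapping.single (0::'g::group_add) (c::'k::field)"
  by (induction a rule: single_add_induct) (simp_all add: distrib_left distrib_right mult_single mult.commute)

lemma scal_commute: "scal c * x = x * scal c"
proof (cases x rule: cga_cases)
  fix a assume a: "coherent a" "x = abs_cga a"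
  then show ?thesis
    by (simp add: scal_def emb_def times_abs coherent_const single_zero_commute)
qed

lemma scal_add: "scal (c + d) = scal c + scal d"
  by (simp add: scal_def single_add emb_add)

lemma scal_mult: "scal (c * d) = scal c * scal d"
  by (simp add: scal_def mult_single flip: emb_mult)

lemma scal_one [simp]: "scal 1 = 1" by (simp add: scal_def)

lemma scal_zero [simp]: "scal 0 = 0" by (simp add: scal_def)

lemma scal_left_commute: "x * (scal c * y) = scal c * (x * y)"
  by (metis mult.assoc scal_commute)

lemma of_grp_add: "of_grp (g + h) = of_grp g * of_grp h"
  by (simp add: of_grp_def mult_single flip: emb_mult)

lemma of_grp_zero [simp]: "of_grp 0 = 1"
  by (simp add: of_grp_def)

lemma of_grp_minus_right [simp]: "of_grp g * of_grp (- g) = 1"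
  by (simp flip: of_grp_add)

lemma of_grp_minus_left [simp]: "of_grp (- g) * of_grp g = 1"
  by (simp flip: of_grp_add)

lemma emb_single: "emb (Poly_Mapping.single g c) = scal c * of_grp g"
  by (simp add: scal_def of_grp_def mult_single flip: emb_mult)

lemma caugm_abs: "coherent a \<Longrightarrow> caugm (abs_cga a) = augm (a 1)"
proof -
  assume "coherent a"
  from rep_abs_diff[OF this, of 1] have "augm (rep_cga (abs_cga a) 1 - a 1) = 0"
    using aug_pow_1 by fastforce
  then show ?thesis
    unfolding caugm_def using augm_add[of "rep_cga (abs_cga a) 1 - a 1" "a 1"] by simp
qed

lemma caugm_add: "caugm (x + y) = caugm x + caugm y"
  by (cases x rule: cga_cases, cases y rule: cga_cases)
    (simp add: plus_abs caugm_abs coherent_plus)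

lemma caugm_mult: "caugm (x * y) = caugm x * caugm y"
  by (cases x rule: cga_cases, cases y rule: cga_cases)
    (simp add: times_abs caugm_abs coherent_mult)

lemma caugm_emb: "caugm (emb a) = augm a"
  by (simp add: emb_def caugm_abs coherent_const)

lemma caugm_one [simp]: "caugm (1 :: ('g::group_add, 'k::field) cga) = 1"
  using caugm_emb[of "1 :: 'g \<Rightarrow>\<^sub>0 'k"] augm_single[of "0::'g" "1::'k"] by (simp del: augm_single)

lemma caugm_of_grp [simp]: "caugm (of_grp g) = 1"
  by (simp add: of_grp_def caugm_emb)

lemma caugm_diff: "caugm (x - y) = caugm x - caugm y"
  using caugm_add[of "x - y" y] by simp

lemma cfilt_one_iff: "x \<in> cfilt (Suc 0) \<longleftrightarrow> caugm x = 0"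
  unfolding cfilt_def caugm_def aug_pow_one by simp

section \<open>Filtered linear maps\<close>

text \<open>Each \<open>cfilt n\<close> is preserved without loss of degree, so a value modulo
  \<open>cfilt n\<close> depends only on the argument modulo \<open>cfilt n\<close>.\<close>

definition clin :: "(('g::group_add, 'k::field) cga \<Rightarrow> ('h::group_add, 'k) cga) \<Rightarrow> bool" where
  "clin T \<longleftrightarrow> (\<forall>x y. T (x + y) = T x + T y) \<and> (\<forall>c x. T (scal c * x) = scal c * T x)
     \<and> (\<forall>n x. x \<in> cfilt n \<longrightarrow> T x \<in> cfilt n)"

lemma clin_add: "clin T \<Longrightarrow> T (x + y) = T x + T y"
  and clin_scal: "clin T \<Longrightarrow> T (scal c * x) = scal c * T x"
  and clin_cfilt: "clin T \<Longrightarrow> x \<in> cfilt n \<Longrightarrow> T x \<in> cfilt n"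
  by (auto simp: clin_def)

lemma clin_zero: "clin T \<Longrightarrow> T 0 = 0"
  using clin_add[of T 0 0] by simp

lemma clin_diff: "clin T \<Longrightarrow> T (x - y) = T x - T y"
  using clin_add[of T "x - y" y] by simp

lemma clin_id: "clin (\<lambda>x. x)"
  by (simp add: clin_def)

lemma clin_comp: "clin T \<Longrightarrow> clin U \<Longrightarrow> clin (\<lambda>x. T (U x))"
  by (simp add: clin_def)

lemma clin_mult_left: "clin T \<Longrightarrow> clin (\<lambda>x. r * T x)"
  by (simp add: clin_def distrib_left scal_left_commute cfilt_mult_left)

lemma clin_mult_right: "clin T \<Longrightarrow> clin (\<lambda>x. T x * r)"
  by (simp add: clin_def distrib_right mult.assoc cfilt_mult_right)

lemma clin_emb_eqI:
  assumes "clin T" "clin U" "\<And>g. T (of_grp g) = U (of_grp g)"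
  shows "T (emb a) = U (emb a)"
  by (induction a rule: single_add_induct)
    (simp_all add: emb_add emb_single clin_add[OF assms(1)] clin_add[OF assms(2)]
       clin_scal[OF assms(1)] clin_scal[OF assms(2)] clin_zero[OF assms(1)] clin_zero[OF assms(2)] assms(3))

lemma clin_eqI:
  assumes "clin T" "clin U" "\<And>g. T (of_grp g) = U (of_grp g)"
  shows "T x = U x"
proof (rule cfilt_eqI)
  fix n
  have "T x - U x = T (x - emb (rep_cga x n)) - U (x - emb (rep_cga x n))"
    using clin_emb_eqI[OF assms] by (simp add: clin_diff[OF assms(1)] clin_diff[OF assms(2)])
  also have "\<dots> \<in> cfilt n"
    by (intro cfilt_diff clin_cfilt[OF assms(1)] clin_cfilt[OF assms(2)] emb_approx)
  finally show "T x - U x \<in> cfilt n" .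
qed

section \<open>Continuous extension of maps given on group elements\<close>

lemma lin_ext_superset:
  "finite S \<Longrightarrow> Poly_Mapping.keys a \<subseteq> S \<Longrightarrow>
   lin_ext \<rho> a = (\<Sum>g\<in>S. scal (Poly_Mapping.lookup a g) * \<rho> g)"
  unfolding lin_ext_def scal_def by (rule sum.mono_neutral_left) (auto simp: in_keys_iff)

lemma lin_ext_add: "lin_ext \<rho> (a + b) = lin_ext \<rho> a + lin_ext \<rho> b"
proof -
  let ?S = "Poly_Mapping.keys a \<union> Poly_Mapping.keys b"
  have "lin_ext \<rho> (a + b) = (\<Sum>g\<in>?S. scal (Poly_Mapping.lookup (a + b) g) * \<rho> g)"
    by (rule lin_ext_superset) (auto simp: Poly_Mapping.keys_add)
  moreover have "lin_ext \<rho> a = (\<Sum>g\<in>?S. scal (Poly_Mapping.lookup a g) * \<rho> g)"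
    by (rule lin_ext_superset) auto
  moreover have "lin_ext \<rho> b = (\<Sum>g\<in>?S. scal (Poly_Mapping.lookup b g) * \<rho> g)"
    by (rule lin_ext_superset) auto
  ultimately show ?thesis by (simp add: lookup_add scal_add distrib_right sum.distrib)
qed

lemma lin_ext_single: "lin_ext \<rho> (Poly_Mapping.single g c) = scal c * \<rho> g"
  by (subst lin_ext_superset[of "{g}"]) auto

lemma lin_ext_zero [simp]: "lin_ext \<rho> 0 = 0"
  by (simp add: lin_ext_def)

lemma lin_ext_diff: "lin_ext \<rho> (a - b) = lin_ext \<rho> a - lin_ext \<rho> b"
  using lin_ext_add[of \<rho> "a - b" b] by simp

lemma lin_ext_scal: "lin_ext \<rho> (Poly_Mapping.single 0 c * a) = scal c * lin_ext \<rho> a"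
  by (induction a rule: single_add_induct)
    (simp_all add: distrib_left mult_single lin_ext_add lin_ext_single scal_mult mult.assoc)

definition filt_cont :: "('g::group_add \<Rightarrow> ('h::group_add, 'k::field) cga) \<Rightarrow> bool" where
  "filt_cont \<rho> \<longleftrightarrow> (\<forall>n a. a \<in> aug_pow n \<longrightarrow> lin_ext \<rho> a \<in> cfilt n)"

lemma cont_ext_approx:
  assumes "filt_cont \<rho>"
  shows "cont_ext \<rho> x - lin_ext \<rho> (rep_cga x n) \<in> cfilt n"
proof -
  let ?s = "\<lambda>n. lin_ext \<rho> (rep_cga x n)"
  have s: "?s (Suc n) - ?s n \<in> cfilt n" for n
    using assms coherent_rep[of x] by (simp add: filt_cont_def coherent_def flip: lin_ext_diff)
  have "rep_cga (?s (Suc n)) (Suc n) - rep_cga (?s n) n \<in> aug_pow n" for n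
    using aug_pow_add[of "rep_cga (?s (Suc n)) (Suc n) - rep_cga (?s (Suc n)) n" n
        "rep_cga (?s (Suc n)) n - rep_cga (?s n) n"]
      s[of n] coherent_rep[of "?s (Suc n)"] by (simp add: diff_in_cfilt coherent_def)
  then have "coherent (\<lambda>n. rep_cga (?s n) n)" by (simp add: coherent_def)
  from rep_abs_diff[OF this] show ?thesis
    unfolding diff_in_cfilt cont_ext_def .
qed

text \<open>\<open>cont_ext\<close> is defined through a chosen representing sequence. Here any
  element of the group algebra that approximates \<open>x\<close> serves instead, which makes
  linearity accessible.\<close>

lemma cont_ext_unique_approx:
  assumes "filt_cont \<rho>" and "x - emb a \<in> cfilt n"
  shows "cont_ext \<rho> x - lin_ext \<rho> a \<in> cfilt n"
proof -
  have "emb (rep_cga x n) - emb a \<in> cfilt n"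
    using cfilt_trans[OF cfilt_commute[OF emb_approx] assms(2)] .
  then have "lin_ext \<rho> (rep_cga x n) - lin_ext \<rho> a \<in> cfilt n"
    using assms(1) by (simp add: filt_cont_def emb_in_cfilt flip: emb_diff lin_ext_diff)
  with cfilt_trans[OF cont_ext_approx[OF assms(1)]] show ?thesis .
qed

lemma cont_ext_emb: "filt_cont \<rho> \<Longrightarrow> cont_ext \<rho> (emb a) = lin_ext \<rho> a"
  by (rule cfilt_eqI, rule cont_ext_unique_approx) auto

lemma cont_ext_of_grp: "filt_cont \<rho> \<Longrightarrow> cont_ext \<rho> (of_grp g) = \<rho> g"
  by (simp add: of_grp_def cont_ext_emb lin_ext_single)

lemma clin_cont_ext:
  fixes \<rho> :: "'g::group_add \<Rightarrow> ('h::group_add, 'k::field) cga"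
  assumes \<rho>: "filt_cont \<rho>"
  shows "clin (cont_ext \<rho>)"
  unfolding clin_def
proof (intro conjI allI impI)
  fix x y
  show "cont_ext \<rho> (x + y) = cont_ext \<rho> x + cont_ext \<rho> y"
  proof (rule cfilt_eqI)
    fix n
    have "x + y - emb (rep_cga x n + rep_cga y n) \<in> cfilt n"
      using cfilt_add[OF emb_approx[of x n] emb_approx[of y n]] by (simp add: emb_add algebra_simps)
    from cfilt_diff[OF cont_ext_unique_approx[OF \<rho> this]
        cfilt_add[OF cont_ext_approx[OF \<rho>, of x n] cont_ext_approx[OF \<rho>, of y n]]]
    show "cont_ext \<rho> (x + y) - (cont_ext \<rho> x + cont_ext \<rho> y) \<in> cfilt n"
      by (simp add: lin_ext_add algebra_simps)
  qed
next
  fix c x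
  show "cont_ext \<rho> (scal c * x) = scal c * cont_ext \<rho> x"
  proof (rule cfilt_eqI)
    fix n
    have "scal c * x - emb (Poly_Mapping.single 0 c * rep_cga x n) \<in> cfilt n"
      using cfilt_mult_left[OF emb_approx[of x n], of "scal c"] by (simp add: scal_def emb_mult right_diff_distrib)
    from cfilt_diff[OF cont_ext_unique_approx[OF \<rho> this]
        cfilt_mult_left[OF cont_ext_approx[OF \<rho>, of x n], of "scal c"]]
    show "cont_ext \<rho> (scal c * x) - scal c * cont_ext \<rho> x \<in> cfilt n"
      by (simp add: lin_ext_scal right_diff_distrib)
  qed
next
  fix n and x :: "('g, 'k) cga"
  assume "x \<in> cfilt n"
  then have "x - emb 0 \<in> cfilt n" by simp
  from cont_ext_unique_approx[OF \<rho> this] show "cont_ext \<rho> x \<in> cfilt n" by simp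
qed

text \<open>Unipotence says that \<open>g - 1\<close> raises the filtration by one. Hence so does
  every element of the augmentation ideal, and \<open>I^m\<close> raises it by \<open>m\<close>. The
  orbit map need not be multiplicative; it only has to come from an action.\<close>

lemma filt_cont_action:
  fixes A :: "'g::group_add \<Rightarrow> ('h::group_add, 'k::field) cga \<Rightarrow> ('h, 'k) cga"
  assumes clin: "\<And>g. clin (A g)"
    and zero: "\<And>y. A 0 y = y"
    and add: "\<And>g h y. A (g + h) y = A g (A h y)"
    and unip: "\<And>g n y. y \<in> cfilt n \<Longrightarrow> A g y - y \<in> cfilt (Suc n)"
  shows "filt_cont (\<lambda>g. A g y)"
proof -
  define L where "L a y = lin_ext (\<lambda>g. A g y) a" for a y
  have L_add: "L (a + b) y = L a y + L b y" for a b y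
    by (simp add: L_def lin_ext_add)
  have L_mult: "L (a * b) y = L a (L b y)" for a b y
  proof (induction a rule: single_add_induct)
    case (2 g c a)
    have "L (Poly_Mapping.single g c * b) y = L (Poly_Mapping.single g c) (L b y)" for b
    proof (induction b rule: single_add_induct)
      case 1
      then show ?case by (simp add: L_def lin_ext_single clin_zero[OF clin])
    next
      case (2 h d b)
      then show ?case
        by (simp add: L_add distrib_left mult_single clin_add[OF clin])
          (simp add: L_def lin_ext_single clin_add[OF clin] clin_scal[OF clin] distrib_left add
            scal_mult mult.assoc)
    qed
    then show ?case by (simp add: distrib_right L_add 2)
  qed (simp add: L_def)
  \<comment> \<open>Modulo the next filtration step an element of the group algebra acts as its
    augmentation, so augmentation zero gains a degree.\<close>
  have L_aug: "L a y - scal (augm a) * y \<in> cfilt (Suc n)" if "y \<in> cfilt n" for a y n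
  proof (induction a rule: single_add_induct)
    case (2 g c a)
    have "L (Poly_Mapping.single g c + a) y - scal (augm (Poly_Mapping.single g c + a)) * y
        = scal c * (A g y - y) + (L a y - scal (augm a) * y)"
      by (simp add: L_def lin_ext_add lin_ext_single scal_add algebra_simps)
    then show ?case
      using cfilt_add[OF cfilt_mult_left[OF unip[OF that]] 2] by simp
  qed (simp add: L_def)
  have "L a y \<in> cfilt (m + n)" if "y \<in> cfilt n" "a \<in> aug_pow m" for a y m n
    using that(2)
  proof (induction m arbitrary: a)
    case 0
    have "scal (augm a) * y \<in> cfilt n" using that by (intro cfilt_mult_left)
    from cfilt_add[OF cfilt_antimono[OF _ L_aug[OF that(1)]] this, of a] show ?case by simp
  next
    case (Suc m)
    from Suc.prems have "a \<in> ideal_prod {a. augm a = 0} (aug_pow m)" by simp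
    then show ?case
    proof induction
      case zero
      then show ?case by (simp add: L_def)
    next
      case (add u v w)
      have "L u (L v y) - scal (augm u) * L v y \<in> cfilt (Suc (m + n))"
        by (intro L_aug Suc.IH add.hyps)
      with add show ?case
        by (simp add: L_add L_mult cfilt_add)
    qed
  qed
  from this[of _ 0] show ?thesis
    unfolding filt_cont_def L_def by simp
qed

section \<open>Filtered algebra homomorphisms\<close>

definition calg :: "(('g::group_add, 'k::field) cga \<Rightarrow> ('h::group_add, 'k) cga) \<Rightarrow> bool" where
  "calg T \<longleftrightarrow> clin T \<and> T 1 = 1 \<and> (\<forall>x y. T (x * y) = T x * T y)"

text \<open>Augmentation one is the condition that makes the linear extension respect the
  filtration.\<close>

definition ghom :: "('g::group_add \<Rightarrow> ('h::group_add, 'k::field) cga) \<Rightarrow> bool" where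
  "ghom \<rho> \<longleftrightarrow> \<rho> 0 = 1 \<and> (\<forall>g h. \<rho> (g + h) = \<rho> g * \<rho> h) \<and> (\<forall>g. caugm (\<rho> g) = 1)"

lemma calg_clin: "calg T \<Longrightarrow> clin T"
  and calg_one: "calg T \<Longrightarrow> T 1 = 1"
  and calg_mult: "calg T \<Longrightarrow> T (x * y) = T x * T y"
  by (auto simp: calg_def)

lemma ghom_zero: "ghom \<rho> \<Longrightarrow> \<rho> 0 = 1"
  and ghom_add: "ghom \<rho> \<Longrightarrow> \<rho> (g + h) = \<rho> g * \<rho> h"
  and ghom_caugm: "ghom \<rho> \<Longrightarrow> caugm (\<rho> g) = 1"
  by (auto simp: ghom_def)

lemma calg_comp: "calg T \<Longrightarrow> calg U \<Longrightarrow> calg (\<lambda>x. T (U x))"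
  by (simp add: calg_def clin_comp)

lemma clin_scalar: "calg T \<Longrightarrow> T (scal c) = scal c"
  using clin_scal[of T c 1] by (simp add: calg_def)

lemma caugm_scal [simp]: "caugm (scal c) = c"
  by (simp add: scal_def caugm_emb)

lemma calg_caugm: "calg T \<Longrightarrow> caugm (T x) = caugm x"
proof -
  assume T: "calg T"
  have "x - scal (caugm x) \<in> cfilt (Suc 0)"
    by (simp add: cfilt_one_iff caugm_diff)
  from clin_cfilt[OF calg_clin[OF T] this] have "T x - scal (caugm x) \<in> cfilt (Suc 0)"
    by (simp add: clin_diff[OF calg_clin[OF T]] clin_scalar[OF T])
  then show ?thesis by (simp add: cfilt_one_iff caugm_diff)
qed

lemma caugm_one_unipotent:
  assumes "caugm r = 1" "y \<in> cfilt n"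
  shows "r * y - y \<in> cfilt (Suc n)" "y * r - y \<in> cfilt (Suc n)"
proof -
  have "r - 1 \<in> cfilt (Suc 0)" using assms(1) by (simp add: cfilt_one_iff caugm_diff)
  from cfilt_mult[OF this assms(2)] cfilt_mult[OF assms(2) this]
  show "r * y - y \<in> cfilt (Suc n)" "y * r - y \<in> cfilt (Suc n)"
    by (simp_all add: algebra_simps)
qed

text \<open>A homomorphism is the orbit map of \<open>1\<close> under left multiplication, and
  multiplication by an element of augmentation one is unipotent.\<close>

lemma ghom_filt_cont:
  assumes "ghom \<rho>"
  shows "filt_cont \<rho>"
proof -
  have "filt_cont (\<lambda>g. \<rho> g * 1)"
    by (rule filt_cont_action)
      (auto simp: ghom_zero[OF assms] ghom_add[OF assms] mult.assoc
        intro: clin_mult_left clin_id caugm_one_unipotent ghom_caugm[OF assms])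
  then show ?thesis by simp
qed

lemma calg_cont_ext:
  assumes \<rho>: "ghom \<rho>"
  shows "calg (cont_ext \<rho>)"
proof -
  note f = ghom_filt_cont[OF \<rho>]
  note c = clin_cont_ext[OF f]
  \<comment> \<open>Multiplicativity by density in two rounds: first in the right factor with a
    group element on the left, then in the left factor.\<close>
  have *: "cont_ext \<rho> (of_grp g * y) = \<rho> g * cont_ext \<rho> y" for g y
    by (rule clin_eqI)
      (auto intro!: clin_comp[OF c] clin_mult_left clin_id c
        simp: cont_ext_of_grp[OF f] ghom_add[OF \<rho>] simp flip: of_grp_add)
  have "cont_ext \<rho> (x * y) = cont_ext \<rho> x * cont_ext \<rho> y" for x y
    by (rule clin_eqI[where x = x])
      (auto intro!: clin_comp[OF c] clin_mult_right clin_id c simp: cont_ext_of_grp[OF f] *)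
  moreover have "cont_ext \<rho> 1 = 1"
    using cont_ext_of_grp[OF f, of 0] by (simp add: ghom_zero[OF \<rho>])
  ultimately show ?thesis using c by (simp add: calg_def)
qed

lemma ghom_calg: "calg T \<Longrightarrow> ghom \<rho> \<Longrightarrow> ghom (\<lambda>g. T (\<rho> g))"
  using calg_caugm[of T] by (simp add: ghom_def calg_def)

lemma ghom_of_grp:
  assumes "\<And>g h. \<phi> (g + h) = \<phi> g + \<phi> h"
  shows "ghom (\<lambda>g. of_grp (\<phi> g))"
proof -
  have "\<phi> 0 = 0" using assms[of 0 0] add_left_imp_eq[of "\<phi> 0" "\<phi> 0" 0] by simp
  then show ?thesis by (simp add: ghom_def assms of_grp_add)
qed

lemma ghom_calg_of_grp: "calg T \<Longrightarrow> ghom (\<lambda>g. T (of_grp g))"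
  using ghom_calg[of T "\<lambda>g. of_grp g"] ghom_of_grp[of "\<lambda>g. g"] by simp

lemma cont_ext_ghom_of_grp: "ghom \<rho> \<Longrightarrow> cont_ext \<rho> (of_grp g) = \<rho> g"
  by (rule cont_ext_of_grp[OF ghom_filt_cont])

lemma calg_eqI: "calg T \<Longrightarrow> calg U \<Longrightarrow> (\<And>g. T (of_grp g) = U (of_grp g)) \<Longrightarrow> T x = U x"
  using clin_eqI[of T U x] by (simp add: calg_def)

lemma ghom_prod:
  assumes "ghom \<rho>" "ghom \<sigma>" "\<And>g h. \<rho> g * \<sigma> h = \<sigma> h * \<rho> g"
  shows "ghom (\<lambda>p. \<rho> (fst p) * \<sigma> (snd p))"
  unfolding ghom_def
proof (intro conjI allI)
  fix p q
  show "\<rho> (fst (p + q)) * \<sigma> (snd (p + q)) = \<rho> (fst p) * \<sigma> (snd p) * (\<rho> (fst q) * \<sigma> (snd q))"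
    by (simp add: ghom_add[OF assms(1)] ghom_add[OF assms(2)] mult.assoc)
      (metis assms(3) mult.assoc)
qed (simp_all add: ghom_zero[OF assms(1)] ghom_zero[OF assms(2)] caugm_mult
      ghom_caugm[OF assms(1)] ghom_caugm[OF assms(2)])

section \<open>Tensor square and group-like elements\<close>

abbreviation in1 :: "('g::group_add, 'k::field) cga \<Rightarrow> ('g \<times> 'h::group_add, 'k) cga" where
  "in1 \<equiv> cont_ext (\<lambda>g. of_grp (g, 0))"

abbreviation in2 :: "('h::group_add, 'k::field) cga \<Rightarrow> ('g::group_add \<times> 'h, 'k) cga" where
  "in2 \<equiv> cont_ext (\<lambda>g. of_grp (0, g))"

lemma ghom_in1: "ghom (\<lambda>g. of_grp (g, 0))"
  by (rule ghom_of_grp) simp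

lemma ghom_in2: "ghom (\<lambda>g. of_grp (0, g))"
  by (rule ghom_of_grp) simp

lemma ghom_diagonal: "ghom (\<lambda>g. of_grp (g, g))"
  by (rule ghom_of_grp) simp

lemmas calg_in1 = calg_cont_ext[OF ghom_in1]
lemmas calg_in2 = calg_cont_ext[OF ghom_in2]
lemmas in1_of_grp = cont_ext_ghom_of_grp[OF ghom_in1]
lemmas in2_of_grp = cont_ext_ghom_of_grp[OF ghom_in2]

lemma of_grp_Pair: "of_grp (g, h) = in1 (of_grp g) * in2 (of_grp h)"
  by (simp add: in1_of_grp in2_of_grp flip: of_grp_add)

lemma in1_in2_commute:
  fixes x :: "('g::group_add, 'k::field) cga" and y :: "('h::group_add, 'k) cga"
  shows "in1 x * in2 y = in2 y * in1 x"
proof -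
  have l: "clin (\<lambda>y :: ('h, 'k) cga. r * in2 y)" "clin (\<lambda>y :: ('h, 'k) cga. in2 y * r)"
    for r :: "('g \<times> 'h, 'k) cga"
    by (rule clin_mult_left[OF calg_clin[OF calg_in2]] clin_mult_right[OF calg_clin[OF calg_in2]])+
  have r: "clin (\<lambda>x :: ('g, 'k) cga. r * in1 x)" "clin (\<lambda>x :: ('g, 'k) cga. in1 x * r)"
    for r :: "('g \<times> 'h, 'k) cga"
    by (rule clin_mult_left[OF calg_clin[OF calg_in1]] clin_mult_right[OF calg_clin[OF calg_in1]])+
  have "in1 (of_grp g) * in2 (of_grp h) = in2 (of_grp h) * in1 (of_grp g)" for g :: 'g and h :: 'h
    by (simp add: in1_of_grp in2_of_grp flip: of_grp_add)
  from clin_eqI[OF l this] have "in1 (of_grp g) * in2 y = in2 y * in1 (of_grp g)" for g :: 'g .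
  from clin_eqI[OF r(2) r(1) this] show ?thesis .
qed

lemma ctensor_mult: "ctensor x y * ctensor x' y' = ctensor (x * x') (y * y')"
proof -
  have "in1 x * (in2 y * in1 x') * in2 y' = in1 x * (in1 x' * in2 y) * in2 y'"
    by (simp only: in1_in2_commute[of x' y])
  then show ?thesis
    by (simp add: ctensor_def calg_mult[OF calg_in1] calg_mult[OF calg_in2] mult.assoc)
qed

lemma ctensor_of_grp: "ctensor (of_grp g) (of_grp h) = of_grp (g, h)"
  unfolding ctensor_def by (rule of_grp_Pair[symmetric])

lemma calg_coproduct: "calg coproduct"
  unfolding coproduct_def by (rule calg_cont_ext[OF ghom_diagonal])

lemma coproduct_of_grp: "coproduct (of_grp g) = of_grp (g, g)"
  unfolding coproduct_def by (rule cont_ext_ghom_of_grp[OF ghom_diagonal])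

text \<open>The universal property of the completed tensor square for two maps with commuting
  images; it turns \<open>coproduct f = ctensor f f\<close> into an identity between values of
  \<open>f\<close>.\<close>

lemma cont_ext_pair_ctensor:
  assumes "ghom \<rho>" "ghom \<sigma>" "\<And>g h. \<rho> g * \<sigma> h = \<sigma> h * \<rho> g"
  defines "\<tau> \<equiv> (\<lambda>p. \<rho> (fst p) * \<sigma> (snd p))"
  shows "cont_ext \<tau> (ctensor x y) = cont_ext \<rho> x * cont_ext \<sigma> y"
proof -
  have \<tau>: "ghom \<tau>" unfolding \<tau>_def by (rule ghom_prod[OF assms(1-3)])
  note c = calg_cont_ext[OF \<tau>]
  have "cont_ext \<tau> (in1 x) = cont_ext \<rho> x" for x
    by (rule calg_eqI[OF calg_comp[OF c calg_in1] calg_cont_ext[OF assms(1)]])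
      (simp add: in1_of_grp cont_ext_ghom_of_grp[OF \<tau>] cont_ext_ghom_of_grp[OF assms(1)],
        simp add: \<tau>_def ghom_zero[OF assms(2)])
  moreover have "cont_ext \<tau> (in2 x) = cont_ext \<sigma> x" for x
    by (rule calg_eqI[OF calg_comp[OF c calg_in2] calg_cont_ext[OF assms(2)]])
      (simp add: in2_of_grp cont_ext_ghom_of_grp[OF \<tau>] cont_ext_ghom_of_grp[OF assms(2)],
        simp add: \<tau>_def ghom_zero[OF assms(1)])
  ultimately show "cont_ext \<tau> (ctensor x y) = cont_ext \<rho> x * cont_ext \<sigma> y"
    by (simp add: ctensor_def calg_mult[OF c])
qed

section \<open>The group of group-like elements\<close>

lemma malcev_carrier: "x \<in> carrier malcev \<longleftrightarrow> caugm x = 1 \<and> coproduct x = ctensor x x"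
  by (simp add: malcev_def)

lemma malcev_mult [simp]: "x \<odot> y = x * y"
  by (simp add: malcev_def)

lemma malcev_one [simp]: "\<one>\<^bsub>malcev\<^esub> = 1"
  by (simp add: malcev_def)

lemma malcev_mult_closed: "x \<in> carrier malcev \<Longrightarrow> y \<in> carrier malcev \<Longrightarrow> x * y \<in> carrier malcev"
  by (simp add: malcev_carrier caugm_mult calg_mult[OF calg_coproduct] ctensor_mult)

lemma of_grp_malcev [simp]: "of_grp g \<in> carrier malcev"
  by (simp add: malcev_carrier coproduct_of_grp ctensor_of_grp)

lemma one_malcev [simp]: "1 \<in> carrier malcev"
  using of_grp_malcev[of 0] by simp

text \<open>A difference killed by \<open>T\<close> is minus its own correction term, so it always
  lies one filtration step deeper.\<close>

lemma unipotent_inj: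
  assumes "clin T" "\<And>n x. x \<in> cfilt n \<Longrightarrow> T x - x \<in> cfilt (Suc n)" "T x = T y"
  shows "x = y"
proof (rule cfilt_eqI)
  fix n
  show "x - y \<in> cfilt n"
  proof (induction n)
    case (Suc n)
    from assms(2)[OF this] have "- (x - y) \<in> cfilt (Suc n)"
      by (simp add: clin_diff[OF assms(1)] assms(3))
    from cfilt_uminus[OF this] show ?case by simp
  qed simp
qed

lemma unipotent_surj:
  assumes T: "clin T" and unip: "\<And>n x. x \<in> cfilt n \<Longrightarrow> T x - x \<in> cfilt (Suc n)"
  obtains x where "T x = y"
proof -
  \<comment> \<open>Successive approximation: the error \<open>y - T (s n)\<close> is added to the
    approximant, and unipotence pushes the new error one step deeper.\<close>
  define s where "s = rec_nat 0 (\<lambda>_ x. x + (y - T x))"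
  have s_Suc: "s (Suc n) = s n + (y - T (s n))" for n by (simp add: s_def)
  have err: "y - T (s n) \<in> cfilt n" for n
  proof (induction n)
    case (Suc n)
    from cfilt_uminus[OF unip[OF this]] show ?case
      by (simp add: s_Suc clin_add[OF T] diff_diff_eq)
  qed simp
  have "s (Suc n) - s n \<in> cfilt n" for n using err by (simp add: s_Suc)
  from cfilt_complete[OF this] obtain x where x: "\<And>n. x - s n \<in> cfilt n" by blast
  have "T x - y \<in> cfilt n" for n
    using cfilt_diff[OF clin_cfilt[OF T x[of n]] err[of n]] by (simp add: clin_diff[OF T])
  from cfilt_eqI[OF this] show thesis by (rule that)
qed

text \<open>Left and right multiplication by \<open>x\<close> are unipotent, so one-sided inverses
  exist; associativity identifies them.\<close>

lemma caugm_one_invertible: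
  assumes "caugm x = 1"
  obtains y where "x * y = 1" "y * x = 1"
proof -
  obtain y where y: "x * y = 1"
    using unipotent_surj[OF clin_mult_left[OF clin_id] caugm_one_unipotent(1)[OF assms]] by blast
  obtain z where z: "z * x = 1"
    using unipotent_surj[OF clin_mult_right[OF clin_id] caugm_one_unipotent(2)[OF assms]] by blast
  have "z = z * x * y" using y by (simp add: mult.assoc)
  then have "z = y" using z by simp
  with y z show thesis using that by blast
qed

lemma malcev_inverse:
  assumes "x \<in> carrier malcev"
  obtains y where "y \<in> carrier malcev" "x * y = 1" "y * x = 1"
proof -
  from assms obtain y where y: "x * y = 1" "y * x = 1"
    using caugm_one_invertible malcev_carrier by blast
  have "caugm y = 1"
    using caugm_mult[of x y] assms by (simp add: y malcev_carrier)
  \<comment> \<open>\<open>coproduct y\<close> is a left inverse and \<open>ctensor y y\<close> a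
    right inverse of \<open>ctensor x x\<close>.\<close>
  moreover have "coproduct y = ctensor y y"
  proof -
    have one: "ctensor 1 1 = 1" using ctensor_of_grp[of 0 0] by (simp flip: zero_prod_def)
    have 1: "ctensor x x * ctensor y y = 1" by (simp add: ctensor_mult y one)
    have "coproduct y * coproduct x = 1"
      by (simp add: y calg_one[OF calg_coproduct] flip: calg_mult[OF calg_coproduct])
    then have 2: "coproduct y * ctensor x x = 1" using assms by (simp add: malcev_carrier)
    have "coproduct y = coproduct y * (ctensor x x * ctensor y y)" by (simp add: 1)
    also have "\<dots> = ctensor y y" by (simp add: 2 flip: mult.assoc)
    finally show ?thesis .
  qed
  ultimately show thesis using that y by (simp add: malcev_carrier)
qed

lemma group_malcev: "group malcev"
  by (rule groupI) (auto simp: malcev_mult_closed mult.assoc intro: malcev_inverse)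

interpretation malcev: group malcev
  rewrites "mult malcev = (*)" and "one malcev = 1"
  by (rule group_malcev) (simp_all add: malcev_def)

lemma minv_left [simp]: "x \<in> carrier malcev \<Longrightarrow> minv x * x = 1"
  and minv_right [simp]: "x \<in> carrier malcev \<Longrightarrow> x * minv x = 1"
  by (simp_all add: malcev.l_inv malcev.r_inv)

lemma minv_unique:
  assumes "x \<in> carrier malcev" "x * y = 1"
  shows "minv x = y"
proof -
  have "minv x = minv x * (x * y)" using assms(2) by simp
  also have "\<dots> = y" using assms(1) by (simp flip: mult.assoc)
  finally show ?thesis .
qed

lemma minv_of_grp: "minv (of_grp g) = of_grp (- g)"
  by (rule minv_unique) auto

section \<open>Continuous homomorphisms between Malcev completions\<close>

definition mhom :: "(('g::group_add, 'k::field_char_0) cga \<Rightarrow> ('h::group_add, 'k) cga) \<Rightarrow> bool" where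
  "mhom T \<longleftrightarrow> calg T \<and> (\<forall>x\<in>carrier malcev. T x \<in> carrier malcev)"

lemma mhom_calg: "mhom T \<Longrightarrow> calg T"
  and mhom_closed: "mhom T \<Longrightarrow> x \<in> carrier malcev \<Longrightarrow> T x \<in> carrier malcev"
  by (auto simp: mhom_def)

lemma mhom_one: "mhom T \<Longrightarrow> T 1 = 1"
  and mhom_mult: "mhom T \<Longrightarrow> T (x * y) = T x * T y"
  by (auto simp: mhom_def calg_def)

lemma mhom_comp: "mhom T \<Longrightarrow> mhom U \<Longrightarrow> mhom (\<lambda>x. T (U x))"
  by (simp add: mhom_def calg_comp)

lemma mhom_minv:
  assumes "mhom T" "x \<in> carrier malcev"
  shows "T (minv x) = minv (T x)"
proof -
  have "T x * T (minv x) = 1"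
    using assms(2) by (simp flip: mhom_mult[OF assms(1)] add: mhom_one[OF assms(1)])
  from minv_unique[OF mhom_closed[OF assms] this] show ?thesis by simp
qed

text \<open>The map \<open>T\<close> tensored with itself, on the completed group algebra of the
  product group; it compares coproducts before and after \<open>T\<close>.\<close>

definition tensor_square ::
    "(('g::group_add, 'k::field) cga \<Rightarrow> ('h::group_add, 'k) cga) \<Rightarrow> ('g \<times> 'g, 'k) cga \<Rightarrow> ('h \<times> 'h, 'k) cga" where
  "tensor_square T = cont_ext (\<lambda>p. in1 (T (of_grp (fst p))) * in2 (T (of_grp (snd p))))"

lemma calg_in1_in2:
  assumes "calg T"
  shows "ghom (\<lambda>g. in1 (T (of_grp g)))" "ghom (\<lambda>g. in2 (T (of_grp g)))"
  by (rule ghom_calg[OF calg_in1 ghom_calg_of_grp[OF assms]] ghom_calg[OF calg_in2 ghom_calg_of_grp[OF assms]])+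

lemma calg_tensor_square: "calg T \<Longrightarrow> calg (tensor_square T)"
  unfolding tensor_square_def
  by (intro calg_cont_ext ghom_prod calg_in1_in2 in1_in2_commute)

lemma tensor_square_of_grp:
  "calg T \<Longrightarrow> tensor_square T (of_grp (g, h)) = ctensor (T (of_grp g)) (T (of_grp h))"
  unfolding tensor_square_def ctensor_def
  by (subst cont_ext_ghom_of_grp) (auto intro: ghom_prod calg_in1_in2 in1_in2_commute)

lemma tensor_square_ctensor:
  fixes T :: "('g::group_add, 'k::field) cga \<Rightarrow> ('h::group_add, 'k) cga"
  assumes "calg T"
  shows "tensor_square T (ctensor x y) = ctensor (T x) (T y)"
proof -
  have "cont_ext (\<lambda>g. in1 (T (of_grp g))) x = (in1 (T x) :: ('h \<times> 'h, 'k) cga)" for x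
    by (rule calg_eqI[OF calg_cont_ext[OF calg_in1_in2(1)[OF assms]] calg_comp[OF calg_in1 assms]])
      (simp add: cont_ext_ghom_of_grp[OF calg_in1_in2(1)[OF assms]])
  moreover have "cont_ext (\<lambda>g. in2 (T (of_grp g))) x = (in2 (T x) :: ('h \<times> 'h, 'k) cga)" for x
    by (rule calg_eqI[OF calg_cont_ext[OF calg_in1_in2(2)[OF assms]] calg_comp[OF calg_in2 assms]])
      (simp add: cont_ext_ghom_of_grp[OF calg_in1_in2(2)[OF assms]])
  ultimately show ?thesis
    unfolding tensor_square_def
    by (subst cont_ext_pair_ctensor[OF calg_in1_in2[OF assms] in1_in2_commute]) (simp add: ctensor_def)
qed

text \<open>Both sides are continuous homomorphisms, and on a group element the equation says that
  its image is group-like.\<close>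

lemma tensor_square_coproduct:
  assumes "calg T" "\<And>g. T (of_grp g) \<in> carrier malcev"
  shows "tensor_square T (coproduct x) = coproduct (T x)"
  by (rule calg_eqI[OF calg_comp[OF calg_tensor_square[OF assms(1)] calg_coproduct]
        calg_comp[OF calg_coproduct assms(1)]])
    (use assms in \<open>simp add: coproduct_of_grp tensor_square_of_grp malcev_carrier\<close>)

lemma mhomI:
  fixes T :: "('g::group_add, 'k::field_char_0) cga \<Rightarrow> ('h::group_add, 'k) cga"
  assumes "calg T" "\<And>g. T (of_grp g) \<in> carrier malcev"
  shows "mhom T"
  unfolding mhom_def
proof (intro conjI ballI)
  fix x :: "('g, 'k) cga"
  assume "x \<in> carrier malcev"
  then show "T x \<in> carrier malcev"
    using tensor_square_coproduct[OF assms, of x]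
    by (simp add: malcev_carrier calg_caugm[OF assms(1)] tensor_square_ctensor[OF assms(1)])
qed (fact assms)

lemma mhom_cont_ext: "ghom \<rho> \<Longrightarrow> (\<And>g. \<rho> g \<in> carrier malcev) \<Longrightarrow> mhom (cont_ext \<rho>)"
  by (intro mhomI calg_cont_ext) (simp_all add: cont_ext_ghom_of_grp)

text \<open>The equation \<open>coproduct x = ctensor x x\<close> is tested after applying the
  tensor square, where it becomes group-likeness of \<open>T x\<close>. This handles preimages that
  are known only as elements of the completed group algebra.\<close>

lemma mhom_reflects_grouplike:
  assumes T: "mhom T" and inj: "inj (tensor_square T)" and x: "T x \<in> carrier malcev"
  shows "x \<in> carrier malcev"
proof -
  have "tensor_square T (coproduct x) = tensor_square T (ctensor x x)"
    using x tensor_square_coproduct[OF mhom_calg[OF T] mhom_closed[OF T of_grp_malcev], of x]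
    by (simp add: malcev_carrier tensor_square_ctensor[OF mhom_calg[OF T]])
  then show ?thesis
    using x injD[OF inj] by (simp add: malcev_carrier calg_caugm[OF mhom_calg[OF T]])
qed

text \<open>The hypothesis makes \<open>T\<close> the identity on \<open>I / I^2\<close>. Products
  of elements of \<open>I\<close> span \<open>I^n / I^(n+1)\<close>, so \<open>T\<close> is the
  identity on every graded piece.\<close>

lemma calg_unipotent:
  assumes T: "calg T" and gr: "\<And>g. T (of_grp g) - of_grp g \<in> cfilt 2" and x: "x \<in> cfilt n"
  shows "T x - x \<in> cfilt (Suc n)"
proof -
  note c = calg_clin[OF T]
  have aug: "T (emb u) - emb u - scal (augm u) * 0 \<in> cfilt 2" for u
  proof (induction u rule: single_add_induct)
    case (2 g c a)
    from cfilt_add[OF cfilt_mult_left[OF gr[of g], of "scal c"] this]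
    show ?case
      by (simp add: emb_add emb_single clin_add[OF calg_clin[OF T]] clin_scal[OF calg_clin[OF T]] algebra_simps)
  qed (simp add: clin_zero[OF c])
  have *: "T (emb a) - emb a \<in> cfilt (Suc n)" if "a \<in> aug_pow n" for a n
    using that
  proof (induction n arbitrary: a)
    case 0
    then show ?case by (simp add: cfilt_one_iff caugm_diff calg_caugm[OF T])
  next
    case (Suc n)
    from Suc.prems have "a \<in> ideal_prod {a. augm a = 0} (aug_pow n)" by simp
    then show ?case
    proof induction
      case zero
      then show ?case by (simp add: clin_zero[OF c])
    next
      case (add u v w)
      \<comment> \<open>The difference of products splits as
        \<open>(T u - u) * T v + u * (T v - v)\<close>. The first summand has degree
        \<open>2 + n\<close> by the hypothesis on group elements, the second
        \<open>1 + (n + 1)\<close> by induction.\<close>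
      have "(T (emb u) - emb u) * T (emb v) \<in> cfilt (2 + n)"
        using aug[of u] clin_cfilt[OF c, of "emb v" n] add.hyps
        by (intro cfilt_mult) (simp_all add: emb_in_cfilt)
      moreover have "emb u * (T (emb v) - emb v) \<in> cfilt (Suc 0 + Suc n)"
        using add.hyps by (intro cfilt_mult Suc.IH) (auto simp: cfilt_one_iff caugm_emb)
      ultimately have "(T (emb u) - emb u) * T (emb v) + emb u * (T (emb v) - emb v)
          + (T (emb w) - emb w) \<in> cfilt (Suc (Suc n))"
        using add.IH by (intro cfilt_add) simp_all
      then show ?case
        by (simp add: emb_add emb_mult clin_add[OF c] calg_mult[OF T] algebra_simps)
    qed
  qed
  let ?a = "rep_cga x (Suc n)"
  have app: "x - emb ?a \<in> cfilt (Suc n)" by (rule emb_approx)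
  have "x - emb ?a \<in> cfilt n" by (rule cfilt_antimono[OF _ app]) simp
  from cfilt_diff[OF x this] have "?a \<in> aug_pow n" by (simp add: emb_in_cfilt)
  from cfilt_add[OF *[OF this] cfilt_diff[OF clin_cfilt[OF c app] app]]
  show ?thesis by (simp add: clin_diff[OF c])
qed

text \<open>Unipotent maps are bijective on the completed group algebra. That preimages of
  group-like elements are group-like needs the tensor square, which is unipotent as well.\<close>

lemma mhom_unipotent_bij:
  assumes T: "mhom T" and gr: "\<And>g. T (of_grp g) - of_grp g \<in> cfilt 2"
  shows "bij_betw T (carrier malcev) (carrier malcev)"
proof -
  note c = mhom_calg[OF T]
  note c2 = calg_tensor_square[OF c]
  have "tensor_square T (of_grp p) - of_grp p \<in> cfilt 2" for p
  proof (cases p)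
    case (Pair g h)
    have "in1 (T (of_grp g) - of_grp g) * in2 (T (of_grp h))
        + in1 (of_grp g) * in2 (T (of_grp h) - of_grp h) \<in> cfilt 2"
      by (intro cfilt_add cfilt_mult_left cfilt_mult_right
          clin_cfilt[OF calg_clin[OF calg_in1]] clin_cfilt[OF calg_clin[OF calg_in2]] gr)
    moreover have "tensor_square T (of_grp p) - of_grp p
        = in1 (T (of_grp g)) * in2 (T (of_grp h)) - in1 (of_grp g) * in2 (of_grp h)"
      unfolding Pair tensor_square_of_grp[OF c] ctensor_def by (subst of_grp_Pair[of g h]) (rule HOL.refl)
    moreover have "in1 (T (of_grp g)) * in2 (T (of_grp h)) - in1 (of_grp g) * in2 (of_grp h)
        = in1 (T (of_grp g) - of_grp g) * in2 (T (of_grp h))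
          + in1 (of_grp g) * in2 (T (of_grp h) - of_grp h)"
      unfolding clin_diff[OF calg_clin[OF calg_in1]] clin_diff[OF calg_clin[OF calg_in2]]
      by (simp add: left_diff_distrib right_diff_distrib)
    ultimately show ?thesis by (simp only:)
  qed
  then have "inj (tensor_square T)"
    using unipotent_inj[OF calg_clin[OF c2] calg_unipotent[OF c2]] by (blast intro: injI)
  note refl = mhom_reflects_grouplike[OF T this]
  have "inj_on T (carrier malcev)"
    using unipotent_inj[OF calg_clin[OF c] calg_unipotent[OF c gr]] by (blast intro: inj_onI)
  moreover have "\<exists>x\<in>carrier malcev. T x = y" if "y \<in> carrier malcev" for y
    using unipotent_surj[OF calg_clin[OF c] calg_unipotent[OF c gr], of y] refl that by metis
  ultimately show ?thesis
    using mhom_closed[OF T] by (auto simp: bij_betw_def)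
qed

section \<open>Homomorphisms out of presented and free groups\<close>

lemma gen_abs: "gen a = abs_presgroup [Pos a]"
  by (simp add: gen_def)

lemma uminus_gen_abs: "- gen a = abs_presgroup [Neg a]"
  by (simp add: gen_abs uminus_presgroup.abs_eq inverse_word_def)

lemma presgroup_induct [case_names zero gen minus_gen]:
  assumes "P 0" "\<And>a w. P w \<Longrightarrow> P (gen a + w)" "\<And>a w. P w \<Longrightarrow> P (- gen a + w)"
  shows "P (w :: 'a::presented presgroup)"
proof -
  have "P (abs_presgroup l)" for l :: "'a letter list"
  proof (induction l)
    case Nil
    then show ?case using assms(1) by (simp add: zero_presgroup_def)
  next
    case (Cons x l)
    then show ?case
      using assms(2)[OF Cons] assms(3)[OF Cons]
      by (cases x) (simp_all add: gen_abs uminus_gen_abs[unfolded gen_abs] plus_presgroup.abs_eq)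
  qed
  from this[of "rep_presgroup w"] show ?thesis
    by (simp add: Quotient3_abs_rep[OF Quotient3_presgroup])
qed

abbreviation letter_value ::
    "('a \<Rightarrow> ('h::group_add, 'k::field_char_0) cga) \<Rightarrow> 'a letter \<Rightarrow> ('h, 'k) cga" where
  "letter_value v l \<equiv> (case l of Pos a \<Rightarrow> v a | Neg a \<Rightarrow> minv (v a))"

definition word_value ::
    "('a \<Rightarrow> ('h::group_add, 'k::field_char_0) cga) \<Rightarrow> 'a letter list \<Rightarrow> ('h, 'k) cga" where
  "word_value v w = foldr (\<lambda>l r. letter_value v l * r) w 1"

lemma word_value_append: "word_value v (u @ w) = word_value v u * word_value v w"
  by (induction u) (simp_all add: word_value_def mult.assoc)

context
  fixes v :: "'a::presented \<Rightarrow> ('h::group_add, 'k::field_char_0) cga"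
  assumes v: "\<And>a. v a \<in> carrier malcev"
    and free: "(relators :: ('a letter list \<times> 'a letter list) set) = {}"
begin

lemma word_value_malcev: "word_value v w \<in> carrier malcev"
  by (induction w)
    (auto simp: word_value_def v intro!: malcev_mult_closed split: letter.split)

lemma word_value_cong: "word_eq u w \<Longrightarrow> word_value v u = word_value v w"
proof (induction rule: word_eq.induct)
  case (cancel l)
  then show ?case by (cases l) (simp_all add: word_value_def v)
qed (simp_all add: word_value_append free)

lemma hom_ext_abs: "hom_ext malcev v (abs_presgroup w) = word_value v w"
proof -
  have "word_eq (rep_presgroup (abs_presgroup w)) w"
    using Quotient3_rep_abs[OF Quotient3_presgroup, of w] by (simp add: word_eq.refl)
  then have "word_value v (rep_presgroup (abs_presgroup w)) = word_value v w"
    by (rule word_value_cong)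
  then show ?thesis by (simp add: hom_ext_def word_value_def)
qed

lemma hom_ext_rep: "hom_ext malcev v g = word_value v (rep_presgroup g)"
  by (simp add: hom_ext_def word_value_def)

lemma hom_ext_malcev: "hom_ext malcev v g \<in> carrier malcev"
  by (simp add: hom_ext_rep word_value_malcev)

lemma hom_ext_add: "hom_ext malcev v (g + h) = hom_ext malcev v g * hom_ext malcev v h"
proof -
  have "g + h = abs_presgroup (rep_presgroup g @ rep_presgroup h)"
    by (simp add: Quotient3_abs_rep[OF Quotient3_presgroup] flip: plus_presgroup.abs_eq)
  then show ?thesis by (simp add: hom_ext_abs word_value_append) (simp add: hom_ext_rep)
qed

lemma ghom_hom_ext: "ghom (hom_ext malcev v)"
proof -
  have "hom_ext malcev v 0 = 1" by (simp add: zero_presgroup_def hom_ext_abs word_value_def)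
  then show ?thesis using hom_ext_malcev by (simp add: ghom_def hom_ext_add malcev_carrier)
qed

lemma hom_ext_gen: "hom_ext malcev v (gen a) = v a"
  by (simp add: gen_abs hom_ext_abs word_value_def)

lemma mhom_malcev_subst: "mhom (malcev_subst v)"
  unfolding malcev_subst_def by (intro mhom_cont_ext ghom_hom_ext hom_ext_malcev)

lemma malcev_subst_gen: "malcev_subst v (of_grp (gen a)) = v a"
  by (simp add: malcev_subst_def cont_ext_ghom_of_grp[OF ghom_hom_ext] hom_ext_gen)

end

lemma mhom_of_grp_minus: "mhom T \<Longrightarrow> T (of_grp (- g)) = minv (T (of_grp g))"
  using mhom_minv[of T "of_grp g"] by (simp add: minv_of_grp)

lemma presgroup_mhom_eqI:
  fixes T U :: "('a::presented presgroup, 'k::field_char_0) cga \<Rightarrow> ('h::group_add, 'k) cga"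
  assumes T: "mhom T" and U: "mhom U" and gen: "\<And>a. T (of_grp (gen a)) = U (of_grp (gen a))"
  shows "T x = U x"
proof (rule calg_eqI[OF mhom_calg[OF T] mhom_calg[OF U]])
  fix g
  show "T (of_grp g) = U (of_grp g)"
    by (induction g rule: presgroup_induct)
      (simp_all add: mhom_one[OF T] mhom_one[OF U] of_grp_add mhom_mult[OF T] mhom_mult[OF U]
        mhom_of_grp_minus[OF T] mhom_of_grp_minus[OF U] gen)
qed

lemma gen2_free: "(relators :: (gen2 letter list \<times> gen2 letter list) set) = {}"
  by (simp add: relators_gen2_def)

lemma gen3_free: "(relators :: (gen3 letter list \<times> gen3 letter list) set) = {}"
  by (simp add: relators_gen3_def)

lemma mhom_malcev_subst2:
  "g \<in> carrier malcev \<Longrightarrow> h \<in> carrier malcev \<Longrightarrow> mhom (malcev_subst (case_gen2 g h))"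
  by (rule mhom_malcev_subst[OF _ gen2_free]) (auto split: gen2.split)

lemma mhom_malcev_subst3:
  "g \<in> carrier malcev \<Longrightarrow> h \<in> carrier malcev \<Longrightarrow> k \<in> carrier malcev \<Longrightarrow>
    mhom (malcev_subst (case_gen3 g h k))"
  by (rule mhom_malcev_subst[OF _ gen3_free]) (auto split: gen3.split)

lemma malcev_subst2_gen:
  assumes "g \<in> carrier malcev" "h \<in> carrier malcev"
  shows "malcev_subst (case_gen2 g h) cX = g" "malcev_subst (case_gen2 g h) cY = h"
  using assms by (subst malcev_subst_gen[OF _ gen2_free]; simp split: gen2.split)+

lemma malcev_subst3_gen:
  assumes "g \<in> carrier malcev" "h \<in> carrier malcev" "k \<in> carrier malcev"
  shows "malcev_subst (case_gen3 g h k) cX1 = g"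
    "malcev_subst (case_gen3 g h k) cX2 = h"
    "malcev_subst (case_gen3 g h k) cX3 = k"
  using assms by (subst malcev_subst_gen[OF _ gen3_free]; simp split: gen3.split)+

lemma mhom_subst2:
  "g \<in> carrier malcev \<Longrightarrow> h \<in> carrier malcev \<Longrightarrow> mhom (\<lambda>f. subst2 f g h)"
  unfolding subst2_def by (rule mhom_malcev_subst2)

lemma subst2_malcev [simp]:
  "f \<in> carrier malcev \<Longrightarrow> g \<in> carrier malcev \<Longrightarrow> h \<in> carrier malcev \<Longrightarrow> subst2 f g h \<in> carrier malcev"
  using mhom_closed[OF mhom_subst2] by blast

lemma subst2_cX [simp]: "g \<in> carrier malcev \<Longrightarrow> h \<in> carrier malcev \<Longrightarrow> subst2 cX g h = g"
  and subst2_cY [simp]: "g \<in> carrier malcev \<Longrightarrow> h \<in> carrier malcev \<Longrightarrow> subst2 cY g h = h"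
  by (simp_all add: subst2_def malcev_subst2_gen)

lemma mhom_subst2_eq:
  assumes T: "mhom T" and g: "g \<in> carrier malcev" "h \<in> carrier malcev"
  shows "T (subst2 f g h) = subst2 f (T g) (T h)"
proof -
  note Tg = mhom_closed[OF T g(1)] mhom_closed[OF T g(2)]
  show ?thesis
  proof (rule presgroup_mhom_eqI[where x = f, OF mhom_comp[OF T mhom_subst2[OF g]] mhom_subst2[OF Tg]])
    fix a show "T (subst2 (of_grp (gen a)) g h) = subst2 (of_grp (gen a)) (T g) (T h)"
      by (cases a) (simp_all add: g Tg)
  qed
qed

lemma mhom_conj:
  assumes "w \<in> carrier malcev"
  shows "mhom (\<lambda>z. w * z * minv w)"
proof (rule mhomI)
  have "w * (x * y) * minv w = w * x * minv w * (w * y * minv w)" for x y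
  proof -
    have "w * x * minv w * (w * y * minv w) = w * x * (minv w * w) * y * minv w"
      by (simp only: mult.assoc)
    then show ?thesis by (simp add: assms mult.assoc)
  qed
  then show "calg (\<lambda>z. w * z * minv w)"
    unfolding calg_def
    by (intro conjI allI clin_mult_right clin_mult_left clin_id) (simp_all add: assms)
qed (simp add: assms malcev_mult_closed)

lemma conj_by_eq: "conj_by w z = w * z * minv w"
  by (simp add: conj_by_def)

lemma conj_fixes_iff:
  assumes "w \<in> carrier malcev"
  shows "w * z * minv w = z \<longleftrightarrow> w * z = z * w"
proof
  assume "w * z * minv w = z"
  then have "w * z * (minv w * w) = z * w" by (simp only: flip: mult.assoc)
  then show "w * z = z * w" by (simp add: assms)
next
  assume "w * z = z * w"
  then have "w * z * minv w = z * (w * minv w)" by (simp only: mult.assoc)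
  then show "w * z * minv w = z" by (simp add: assms)
qed

text \<open>Conjugation by \<open>c\<close> is a continuous homomorphism that fixes \<open>g\<close>
  and \<open>h\<close>, hence fixes every value of a substitution at them.\<close>

lemma subst2_commute:
  assumes "c \<in> carrier malcev" "g \<in> carrier malcev" "h \<in> carrier malcev" "c * g = g * c" "c * h = h * c"
  shows "c * subst2 f g h = subst2 f g h * c"
proof -
  have "c * g * minv c = g" "c * h * minv c = h"
    by (rule conj_fixes_iff[OF assms(1), THEN iffD2] assms(4,5))+
  then have "c * subst2 f g h * minv c = subst2 f g h"
    using mhom_subst2_eq[OF mhom_conj[OF assms(1)] assms(2,3), of f] by simp
  then show ?thesis by (simp only: conj_fixes_iff[OF assms(1)])
qed

text \<open>Uses that \<open>f\<close> is group-like: its coproduct is evaluated on the two commuting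
  substitutions.\<close>

lemma subst2_mult_commuting:
  assumes f: "f \<in> carrier malcev"
    and c: "g \<in> carrier malcev" "h \<in> carrier malcev" "g' \<in> carrier malcev" "h' \<in> carrier malcev"
    and comm: "g * g' = g' * g" "g * h' = h' * g" "h * g' = g' * h" "h * h' = h' * h"
  shows "subst2 f (g * g') (h * h') = subst2 f g h * subst2 f g' h'"
proof -
  define \<rho> \<sigma> where "\<rho> = (\<lambda>w. subst2 (of_grp w) g h)" and "\<sigma> = (\<lambda>w. subst2 (of_grp w) g' h')"
  have \<rho>: "ghom \<rho>" and \<sigma>: "ghom \<sigma>"
    unfolding \<rho>_def \<sigma>_def using c by (auto intro: ghom_calg_of_grp[OF mhom_calg[OF mhom_subst2]])
  have "\<sigma> w * g = g * \<sigma> w" "\<sigma> w * h = h * \<sigma> w" for w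
    unfolding \<sigma>_def using subst2_commute[of g g' h'] subst2_commute[of h g' h'] c comm by auto
  then have comm': "\<rho> v * \<sigma> w = \<sigma> w * \<rho> v" for v w
    unfolding \<rho>_def using subst2_commute[of "\<sigma> w" g h] c by (simp add: \<sigma>_def)
  have ext: "cont_ext \<rho> x = subst2 x g h" "cont_ext \<sigma> x = subst2 x g' h'" for x
    by (rule calg_eqI[OF calg_cont_ext[OF \<rho>] mhom_calg[OF mhom_subst2[OF c(1,2)]]],
        simp add: cont_ext_ghom_of_grp[OF \<rho>], simp add: \<rho>_def)
      (rule calg_eqI[OF calg_cont_ext[OF \<sigma>] mhom_calg[OF mhom_subst2[OF c(3,4)]]],
        simp add: cont_ext_ghom_of_grp[OF \<sigma>], simp add: \<sigma>_def)
  let ?\<tau> = "\<lambda>p. \<rho> (fst p) * \<sigma> (snd p)"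
  note \<tau> = ghom_prod[OF \<rho> \<sigma> comm']
  let ?T = "\<lambda>x. cont_ext ?\<tau> (coproduct x)"
  have val: "?T (of_grp w) = \<rho> w * \<sigma> w" for w
    by (simp add: coproduct_of_grp cont_ext_ghom_of_grp[OF \<tau>])
  have T: "mhom ?T"
    by (rule mhomI[OF calg_comp[OF calg_cont_ext[OF \<tau>] calg_coproduct]])
      (unfold val, simp add: \<rho>_def \<sigma>_def malcev_mult_closed c)
  have "?T f = subst2 f (g * g') (h * h')"
  proof (rule presgroup_mhom_eqI[where x = f, OF T mhom_subst2])
    fix a show "?T (of_grp (gen a)) = subst2 (of_grp (gen a)) (g * g') (h * h')"
      unfolding val unfolding \<rho>_def \<sigma>_def by (cases a) (simp_all add: c malcev_mult_closed)
  qed (simp_all add: c malcev_mult_closed)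
  moreover have "?T f = subst2 f g h * subst2 f g' h'"
    using f cont_ext_pair_ctensor[OF \<rho> \<sigma> comm', of f f] by (simp add: malcev_carrier ext)
  ultimately show ?thesis by simp
qed

section \<open>Automorphisms conjugating the free generators\<close>

text \<open>The commutator \<open>w * z - z * w\<close> equals that of \<open>w - 1\<close> and
  \<open>z - 1\<close>, both of which lie in the first filtration step.\<close>

lemma conj_cfilt:
  assumes "w \<in> carrier malcev" "z \<in> carrier malcev"
  shows "w * z * minv w - z \<in> cfilt 2"
proof -
  have "w - 1 \<in> cfilt (Suc 0)" "z - 1 \<in> cfilt (Suc 0)"
    using assms by (simp_all add: cfilt_one_iff caugm_diff malcev_carrier)
  from cfilt_mult[OF this] cfilt_mult[OF this(2,1)]
  have "(w - 1) * (z - 1) - (z - 1) * (w - 1) \<in> cfilt 2"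
    by (intro cfilt_diff) (simp_all add: numeral_2_eq_2)
  from cfilt_mult_right[OF this, of "minv w"]
  have "(w * z - z * w) * minv w \<in> cfilt 2" by (simp add: algebra_simps)
  then show ?thesis using assms by (simp add: left_diff_distrib mult.assoc)
qed

text \<open>Congruence to the identity modulo \<open>cfilt 2\<close> passes to products and
  inverses, so generators suffice.\<close>

lemma presgroup_unipotent:
  fixes T :: "('a::presented presgroup, 'k::field_char_0) cga \<Rightarrow> ('a presgroup, 'k) cga"
  assumes T: "mhom T" and gen: "\<And>a. T (of_grp (gen a)) - of_grp (gen a) \<in> cfilt 2"
  shows "T (of_grp g) - of_grp g \<in> cfilt 2"
proof -
  have mult: "T (x * y) - x * y \<in> cfilt 2" if "T x - x \<in> cfilt 2" "T y - y \<in> cfilt 2" for x y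
  proof -
    have "(T x - x) * T y + x * (T y - y) \<in> cfilt 2"
      by (intro cfilt_add cfilt_mult_left cfilt_mult_right that)
    then show ?thesis by (simp add: mhom_mult[OF T] left_diff_distrib right_diff_distrib)
  qed
  have inv: "T (of_grp (- gen a)) - of_grp (- gen a) \<in> cfilt 2" for a
  proof -
    let ?x = "of_grp (gen a) :: ('a presgroup, 'k) cga" and ?y = "of_grp (- gen a) :: ('a presgroup, 'k) cga"
    have "T ?y * T ?x = 1" by (simp add: mhom_one[OF T] flip: mhom_mult[OF T])
    then have "T ?y * (T ?x - ?x) * ?y = ?y - T ?y"
      by (simp add: right_diff_distrib left_diff_distrib mult.assoc)
    moreover have "T ?y * (T ?x - ?x) * ?y \<in> cfilt 2"
      by (intro cfilt_mult_left cfilt_mult_right gen)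
    ultimately show ?thesis using cfilt_commute by simp
  qed
  show ?thesis
    by (induction g rule: presgroup_induct)
      (simp_all add: mhom_one[OF T] of_grp_add mult gen inv)
qed

lemma restrict_mhom_auto:
  assumes T: "mhom T" and bij: "bij_betw T (carrier malcev) (carrier malcev)"
  shows "restrict T (carrier malcev) \<in> carrier (AutoGroup malcev)"
  using bij mhom_closed[OF T]
  by (auto simp: AutoGroup_def auto_def Bij_def hom_def mhom_mult[OF T] malcev_mult_closed
      bij_betw_restrict_eq)

text \<open>Conjugating each generator, even by different elements, changes nothing modulo
  \<open>cfilt 2\<close>. Unipotence then gives an automorphism without exhibiting an
  inverse.\<close>

lemma free_conj_auto:
  fixes w :: "'a::presented \<Rightarrow> ('a presgroup, 'k::field_char_0) cga"
  assumes free: "(relators :: ('a letter list \<times> 'a letter list) set) = {}"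
    and w: "\<And>a. w a \<in> carrier malcev" and v: "\<And>a. v a = conj_by (w a) (of_grp (gen a))"
  shows "restrict (malcev_subst v) (carrier malcev) \<in> carrier (AutoGroup malcev)"
proof -
  have closed: "v a \<in> carrier malcev" for a
    by (simp add: v conj_by_eq w malcev_mult_closed)
  note T = mhom_malcev_subst[OF closed free]
  have "malcev_subst v (of_grp (gen a)) - of_grp (gen a) \<in> cfilt 2" for a
    using conj_cfilt[OF w of_grp_malcev] by (simp add: malcev_subst_gen[OF closed free] v conj_by_eq)
  from restrict_mhom_auto[OF T mhom_unipotent_bij[OF T presgroup_unipotent[OF T this]]]
  show ?thesis .
qed

lemma alphaP_malcev [simp]: "f \<in> carrier malcev \<Longrightarrow> alphaP f \<in> carrier malcev"
  and alphaQ_malcev [simp]: "f \<in> carrier malcev \<Longrightarrow> alphaQ f \<in> carrier malcev"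
  by (simp_all add: alphaP_def alphaQ_def malcev_mult_closed)

text \<open>Presents a fixed generator as a conjugated one, so that \<open>endF3_auto\<close> covers
  the maps that fix a generator.\<close>

lemma one_conj: "conj_by 1 z = z"
  using minv_unique[of 1 1] by (simp add: conj_by_eq)

lemma endF3_auto:
  assumes "u \<in> carrier malcev" "v \<in> carrier malcev" "w \<in> carrier malcev"
  shows "endF3 (conj_by u cX1) (conj_by v cX2) (conj_by w cX3) \<in> carrier (AutoGroup malcev)"
  unfolding endF3_def
  by (rule free_conj_auto[OF gen3_free, where w = "case_gen3 u v w"]) (simp_all add: assms split: gen3.split)

lemma alpha_auto:
  assumes "f \<in> carrier malcev"
  shows "alpha f \<in> carrier (AutoGroup malcev)"
  unfolding alpha_def endF2_def
  by (rule free_conj_auto[OF gen2_free, where w = "case_gen2 (alphaP f) (alphaQ f)"])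
    (simp_all add: assms split: gen2.split)

lemma alpha_F3_auto:
  fixes f :: "(F2, 'k::field_char_0) cga"
  assumes "f \<in> carrier malcev"
  shows "{alpha_12_3 f, alpha_1_2 f, alpha_1_23 f, alpha_2_3 f} \<subseteq> carrier (AutoGroup malcev)"
proof -
  have "endF3 (conj_by u cX1) (conj_by v cX2) cX3 \<in> carrier (AutoGroup malcev)"
    "endF3 cX1 (conj_by u cX2) (conj_by v cX3) \<in> carrier (AutoGroup malcev)"
    if "u \<in> carrier malcev" "v \<in> carrier malcev" for u v :: "(F3, 'k) cga"
    using that endF3_auto[of u v 1] endF3_auto[of 1 u v] by (simp_all add: one_conj)
  then show ?thesis
    using assms by (simp add: alpha_12_3_def alpha_1_2_def alpha_1_23_def alpha_2_3_def
        endF3_auto malcev_mult_closed)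
qed

section \<open>Relations between pure braids\<close>

abbreviation commutes :: "'g::group_add \<Rightarrow> 'g \<Rightarrow> bool" where
  "commutes x y \<equiv> x + y = y + x"

lemma commutes_add: "commutes x y \<Longrightarrow> commutes x z \<Longrightarrow> commutes x (y + z)" for x :: "'g::group_add"
proof -
  assume *: "commutes x y" "commutes x z"
  have "x + (y + z) = y + (x + z)" by (simp add: *(1) flip: add.assoc)
  then show ?thesis by (simp add: *(2) add.assoc)
qed

lemma commutes_minus: "commutes x y \<Longrightarrow> commutes x (- y)" for x :: "'g::group_add"
proof -
  assume *: "commutes x y"
  have "- y + (y + x) + - y = - y + (x + y) + - y" by (simp add: *)
  then show ?thesis by (simp add: add.assoc del: add_uminus_conv_diff)
qed

lemma commutes_add_left: "commutes x z \<Longrightarrow> commutes y z \<Longrightarrow> commutes (x + y) z" for x :: "'g::group_add"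
  using commutes_add[of z x y] by simp

lemma commutes_minus_left: "commutes x z \<Longrightarrow> commutes (- x) z" for x :: "'g::group_add"
  using commutes_minus[of z x] by simp

lemmas commutes_intros = commutes_add commutes_minus commutes_add_left commutes_minus_left

lemma commutes_conj:
  "commutes x y \<Longrightarrow> commutes (- a + (x + a)) (- a + (y + a))" for x :: "'g::group_add"
proof -
  assume "commutes x y"
  then have "- a + (x + y) + a = - a + (y + x) + a" by simp
  then show ?thesis by (simp add: add.assoc del: add_uminus_conv_diff)
qed

text \<open>Braid words are kept as right-nested sums with explicit negation; subtraction would hide
  cancellations between neighbouring letters.\<close>

declare add_uminus_conv_diff [simp del] diff_conv_add_uminus [simp]

section \<open>Words in two generators with the braid relation\<close>

context
  fixes a b :: "'g::group_add"
  assumes aba: "a + (b + a) = b + (a + b)"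
begin

lemma aba_left: "a + (b + (a + x)) = b + (a + (b + x))"
  using arg_cong[OF aba, of "\<lambda>y. y + x"] by (simp add: add.assoc)

text \<open>Equalities of positive words follow from the braid relation alone; the ones with
  inverses are obtained by multiplying these on either side.\<close>

lemma aba_positive:
  "b + (a + (a + (b + a))) = a + (b + (a + (a + b)))"
  "a + (b + (b + (a + b))) = b + (a + (b + (b + a)))"
  "b + (a + (a + (b + (a + a)))) = a + (a + (b + (a + (a + b))))"
  "a + (b + (a + a)) = b + (b + (a + b))"
  "a + (a + (b + a)) = b + (a + (b + b))"
  using aba aba_left by metis+

lemma aba_conj: "b + (a + (a + - b)) = - a + (b + (b + a))"
  using arg_cong[OF aba_positive(4), of "\<lambda>x. - a + (x + - b)"] by (simp add: add.assoc)

lemma aba_conj': "- b + (a + (a + b)) = a + (b + (b + - a))"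
  using arg_cong[OF aba_positive(5), of "\<lambda>x. - b + (x + - a)"] by (simp add: add.assoc)

text \<open>With \<open>a = s0\<close> and \<open>b = s1\<close> this is the action of
  \<open>s1\<close> on \<open>x02\<close>: the result is \<open>x01\<close> conjugated by
  \<open>x02\<close>.\<close>

lemma aba_conj2:
  "b + ((- a + (b + (b + a))) + - b)
    = - (- a + (b + (b + a))) + (a + (a + (- a + (b + (b + a)))))"
proof -
  have "(b + (a + (a + - b))) + (b + ((b + (a + (a + - b))) + - b))
      = (a + a) + (b + (a + (a + - b)))"
    using arg_cong[OF aba_positive(3), of "\<lambda>x. x + (- b)"] arg_cong[OF aba_positive(3), of "\<lambda>x. x + (- b + - b)"]
    by (simp add: add.assoc)
  then have "- (b + (a + (a + - b))) + ((b + (a + (a + - b))) + (b + ((b + (a + (a + - b))) + - b)))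
      = - (b + (a + (a + - b))) + ((a + a) + (b + (a + (a + - b))))"
    by (rule arg_cong)
  then have "b + ((b + (a + (a + - b))) + - b)
      = - (b + (a + (a + - b))) + ((a + a) + (b + (a + (a + - b))))"
    by (simp only: minus_add_cancel)
  then show ?thesis by (simp only: aba_conj add.assoc)
qed

text \<open>Two spellings of the square of the half twist \<open>a + (b + a)\<close>.\<close>

lemma Delta_square: "a + (b + (a + (a + (b + a)))) = a + (b + (b + (a + (b + b))))"
  using aba aba_left by metis

text \<open>Conjugation by the half twist exchanges \<open>a\<close> and \<open>b\<close>, so its
  square is central in the group they generate.\<close>

lemma Delta_square_commutes:
  "commutes (a + (b + (b + (a + (b + b))))) a"
  "commutes (a + (b + (b + (a + (b + b))))) b"
proof -
  have *: "a + (b + (a + a)) = b + (a + (b + a))" "a + (b + (a + b)) = a + (a + (b + a))"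
    using aba aba_left by metis+
  have "commutes ((a + (b + a)) + (a + (b + a))) a" "commutes ((a + (b + a)) + (a + (b + a))) b"
    using * arg_cong[OF *(1), of "\<lambda>x. x + (b + a)"] arg_cong[OF *(1), of "\<lambda>x. x + (a + (b + a))"]
      arg_cong[OF *(2), of "\<lambda>x. x + (b + a)"] arg_cong[OF *(2), of "\<lambda>x. x + (a + (b + a))"] aba_left aba
    unfolding add.assoc by metis+
  then show "commutes (a + (b + (b + (a + (b + b))))) a" "commutes (a + (b + (b + (a + (b + b))))) b"
    by (simp_all only: add.assoc Delta_square[symmetric])
qed

end

section \<open>Words in the braid group on four strands\<close>

context
  fixes a b c :: "'g::group_add"
  assumes aba: "a + (b + a) = b + (a + b)"
    and bcb: "b + (c + b) = c + (b + c)"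
    and ca: "c + a = a + c"
begin

lemma ca_left: "c + (a + x) = a + (c + x)"
  using arg_cong[OF ca, of "\<lambda>y. y + x"] by (simp add: add.assoc)

lemma ca_minus: "c + - a = - a + c" "c + (- a + x) = - a + (c + x)"
proof -
  show *: "c + - a = - a + c" using commutes_minus[OF ca] .
  show "c + (- a + x) = - a + (c + x)"
    using arg_cong[OF *, of "\<lambda>y. y + x"] by (simp only: add.assoc)
qed

lemma minus_ca: "- c + a = a + - c" "- c + (a + x) = a + (- c + x)"
    "- c + - a = - a + - c" "- c + (- a + x) = - a + (- c + x)"
proof -
  show *: "- c + a = a + - c" "- c + - a = - a + - c"
    using commutes_minus_left[OF ca] commutes_minus[OF commutes_minus_left[OF ca]] .
  show "- c + (a + x) = a + (- c + x)" "- c + (- a + x) = - a + (- c + x)"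
    using arg_cong[OF *(1), of "\<lambda>y. y + x"] arg_cong[OF *(2), of "\<lambda>y. y + x"]
    by (simp_all only: add.assoc)
qed

lemmas ca_simps = ca ca_left ca_minus minus_ca

lemmas aba_left' = aba_left[OF aba] and bcb_left' = aba_left[OF bcb]

abbreviation (input) "p01 \<equiv> a + a"
abbreviation (input) "p02 \<equiv> - a + (b + (b + a))"
abbreviation (input) "p03 \<equiv> - a + (- b + (c + (c + (b + a))))"
abbreviation (input) "p13 \<equiv> - b + (c + (c + b))"

text \<open>Artin's action of the second and third braid generator on the free group of the
  \<open>x0i\<close>; \<open>twist1\<close> and \<open>twist2\<close> are defined by the same
  formulas.\<close>

lemma conj_y:
  "b + (p01 + - b) = p02"
  "b + (p02 + - b) = - p02 + (p01 + p02)"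
  "b + (p03 + - b) = p03"
  "c + (p01 + - c) = p01"
  "c + (p02 + - c) = p03"
  "c + (p03 + - c) = - p03 + (p02 + p03)"
proof -
  show "b + (p01 + - b) = p02"
    using aba_conj[OF aba] by (simp add: add.assoc)
  show "b + (p02 + - b) = - p02 + (p01 + p02)"
    using aba_conj2[OF aba] by (simp only: add.assoc)
  show "c + (p01 + - c) = p01" by (simp add: add.assoc ca_simps)
  \<comment> \<open>Since \<open>c\<close> commutes with \<open>a\<close>, the remaining formulas
    for \<open>c\<close> are those for the pair \<open>b\<close>, \<open>c\<close>, conjugated by
    \<open>a\<close>.\<close>
  have "c + (b + (b + - c)) = - b + (c + (c + b))" by (rule aba_conj[OF bcb])
  from arg_cong[OF this, of "\<lambda>x. - a + (x + a)"]
  show "c + (p02 + - c) = p03" by (simp add: add.assoc ca_simps)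
  from arg_cong[OF aba_conj2[OF bcb], of "\<lambda>x. - a + (x + a)"]
  show "c + (p03 + - c) = - p03 + (p02 + p03)" by (simp add: add.assoc minus_add ca_simps)
  have 1: "b + (- a + - b) = - a + (- b + a)"
    using arg_cong[OF aba, of "\<lambda>x. - a + (- b + (x + (- a + - b)))"] by (simp add: add.assoc)
  have 2: "b + (a + - b) = - a + (b + a)"
    using arg_cong[OF aba, of "\<lambda>x. - a + (x + - b)"] by (simp add: add.assoc)
  have "b + (p03 + - b) = (b + (- a + - b)) + (c + (c + (b + (a + - b))))"
    by (simp only: add.assoc)
  also have "\<dots> = p03" unfolding 1 2 by (simp add: add.assoc ca_simps)
  finally show "b + (p03 + - b) = p03" .
qed

abbreviation (input) "full_twist3 \<equiv> b + (c + (c + (b + (c + c))))"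
abbreviation (input) "push0 \<equiv> a + (b + (c + (c + (b + a))))"

lemma full_twist3_commutes: "commutes full_twist3 b" "commutes full_twist3 c"
  using Delta_square_commutes[OF bcb] by auto

abbreviation (input) "half_twist4 \<equiv> a + (b + (a + (c + (b + a))))"

text \<open>Garside's half twist reverses the order of the strands, so conjugation by it exchanges
  the outer generators and fixes the middle one.\<close>

lemma half_twist4_conj: "c + half_twist4 = half_twist4 + a" "b + half_twist4 = half_twist4 + b" "a + half_twist4 = half_twist4 + c"
proof -
  have "c + (a + (b + (a + (c + (b + a))))) = a + (c + (b + (a + (c + (b + a)))))" by (metis ca ca_left)
  also have "\<dots> = a + (c + (b + (c + (a + (b + a)))))" by (metis ca ca_left)
  also have "\<dots> = a + (b + (c + (b + (a + (b + a)))))" by (metis bcb bcb_left')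
  also have "\<dots> = a + (b + (c + (b + (b + (a + b)))))" by (metis aba aba_left')
  finally have 1: "c + half_twist4 = a + (b + (c + (b + (b + (a + b)))))" .
  have "a + (b + (a + (c + (b + (a + a))))) = a + (b + (c + (a + (b + (a + a)))))" by (metis ca ca_left)
  also have "\<dots> = a + (b + (c + (b + (a + (b + a)))))" by (metis aba aba_left')
  also have "\<dots> = a + (b + (c + (b + (b + (a + b)))))" by (metis aba aba_left')
  finally have "c + half_twist4 = half_twist4 + a" unfolding 1 add.assoc by (rule HOL.sym)
  then show "c + half_twist4 = half_twist4 + a" .
  have "b + (a + (b + (a + (c + (b + a))))) = a + (b + (a + (a + (c + (b + a)))))" by (metis aba aba_left')
  then have 1: "b + half_twist4 = a + (b + (a + (a + (c + (b + a)))))" .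
  have "a + (b + (a + (c + (b + (a + b))))) = a + (b + (a + (c + (a + (b + a)))))" by (metis aba aba_left')
  also have "\<dots> = a + (b + (a + (a + (c + (b + a)))))" by (metis ca ca_left)
  finally have "b + half_twist4 = half_twist4 + b" unfolding 1 add.assoc by (rule HOL.sym)
  then show "b + half_twist4 = half_twist4 + b" .
  have "a + (b + (a + (c + (b + (a + c))))) = a + (b + (a + (c + (b + (c + a)))))" by (metis ca ca_left)
  also have "\<dots> = a + (b + (a + (b + (c + (b + a)))))" by (metis bcb bcb_left')
  also have "\<dots> = a + (a + (b + (a + (c + (b + a)))))" by (metis aba aba_left')
  finally have "a + half_twist4 = half_twist4 + c" unfolding add.assoc by (rule HOL.sym)
  then show "a + half_twist4 = half_twist4 + c" .
qed

lemma half_twist4_factor: "c + (b + (a + (b + (c + b)))) = half_twist4"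
proof -
  have "c + (b + (a + (b + (c + b)))) = c + (a + (b + (a + (c + b))))" by (metis aba aba_left')
  also have "\<dots> = a + (c + (b + (a + (c + b))))" by (metis ca ca_left)
  also have "\<dots> = a + (c + (b + (c + (a + b))))" by (metis ca ca_left)
  also have "\<dots> = a + (b + (c + (b + (a + b))))" by (metis bcb bcb_left')
  also have "\<dots> = a + (b + (c + (a + (b + a))))" by (metis aba aba_left')
  also have "\<dots> = a + (b + (a + (c + (b + a))))" by (metis ca ca_left)
  finally show ?thesis .
qed

text \<open>\<open>push0\<close> carries strand 0 around the other three and equals the product of
  \<open>p01\<close>, \<open>p02\<close>, \<open>p03\<close>. Together with the full twist of those
  three strands it is the full twist of all four, which is central.\<close>

lemma full_twist4_eq: "push0 + full_twist3 = half_twist4 + half_twist4"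
proof -
  have 2: "a + (b + (c + half_twist4)) = half_twist4 + (c + (b + a))"
  proof -
    have "a + (b + (c + half_twist4)) = a + ((b + half_twist4) + a)"
      by (simp only: half_twist4_conj(1)) (simp only: add.assoc)
    also have "\<dots> = (a + half_twist4) + (b + a)"
      by (simp only: half_twist4_conj(2)) (simp only: add.assoc)
    also have "\<dots> = half_twist4 + (c + (b + a))"
      by (simp only: half_twist4_conj(3)) (simp only: add.assoc)
    finally show ?thesis .
  qed
  have "push0 + full_twist3 = a + (b + (c + ((c + (b + (a + (b + (c + b))))) + (b + (c + b)))))"
    using Delta_square[OF bcb] by (simp add: add.assoc)
  also have "\<dots> = (a + (b + (c + half_twist4))) + (b + (c + b))" unfolding half_twist4_factor by (simp only: add.assoc)
  also have "\<dots> = half_twist4 + (c + (b + (a + (b + (c + b)))))" unfolding 2 by (simp only: add.assoc)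
  finally show ?thesis unfolding half_twist4_factor .
qed

lemma full_twist4_commutes: "commutes (push0 + full_twist3) a" "commutes (push0 + full_twist3) b" "commutes (push0 + full_twist3) c"
proof -
  have *: "x + (half_twist4 + half_twist4) = (half_twist4 + half_twist4) + x" if "x + half_twist4 = half_twist4 + y" "y + half_twist4 = half_twist4 + x" for x y
  proof -
    have "x + (half_twist4 + half_twist4) = (x + half_twist4) + half_twist4" by (simp only: add.assoc)
    also have "\<dots> = half_twist4 + (y + half_twist4)" unfolding that(1) by (simp only: add.assoc)
    also have "\<dots> = (half_twist4 + half_twist4) + x" unfolding that(2) by (simp only: add.assoc)
    finally show ?thesis .
  qed
  show "commutes (push0 + full_twist3) a" "commutes (push0 + full_twist3) b" "commutes (push0 + full_twist3) c"
    unfolding full_twist4_eq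
    by (rule *[symmetric]; rule half_twist4_conj)+
qed

text \<open>The full twist on three strands \<open>0, 1, 2\<close>, on \<open>0, 2, 3\<close>, and on the four strands with
  \<open>1, 2\<close> respectively \<open>2, 3\<close> or \<open>0, 1\<close> treated as one ribbon.\<close>

lemma twist_012:
  "commutes (p01 + (p02 + (b + b))) a" "commutes (p01 + (p02 + (b + b))) b"
  using Delta_square_commutes[OF aba] by (simp_all add: add.assoc)

lemma twist_023:
  "commutes (p02 + (p03 + (c + c))) p02" "commutes (p02 + (p03 + (c + c))) p03" "commutes (p02 + (p03 + (c + c))) (c + c)"
proof -
  \<comment> \<open>Conjugation by \<open>a\<close> moves the triple of strands 1, 2, 3 to 0, 2,
    3.\<close>
  have eq: "p02 + (p03 + (c + c)) = - a + (full_twist3 + a)" "c + c = - a + ((c + c) + a)"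
    "p03 = - a + (p13 + a)" "p02 = - a + ((b + b) + a)"
    by (simp_all add: add.assoc ca_simps)
  show "commutes (p02 + (p03 + (c + c))) p02" "commutes (p02 + (p03 + (c + c))) p03"
    "commutes (p02 + (p03 + (c + c))) (c + c)"
    unfolding eq(1) by (subst (1 2) eq, rule commutes_conj, intro commutes_intros full_twist3_commutes)+
qed

lemma twist_01_2_3:
  "commutes (p01 + (p02 + (p03 + (p13 + (c + c))))) (p01 + p02)"
  "commutes (p01 + (p02 + (p03 + (p13 + (c + c))))) (p13 + (c + c))"
proof -
  \<comment> \<open>The sum is the central four-strand twist with the twist \<open>b + b\<close> of
    strands 1, 2 removed.\<close>
  have "p01 + (p02 + (p03 + (p13 + (c + c)))) = push0 + (- b + (- b + full_twist3))"
    by (simp add: add.assoc)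
  also have "- b + (- b + full_twist3) = full_twist3 + (- b + - b)"
    using commutes_add[OF commutes_minus commutes_minus, OF full_twist3_commutes(1) full_twist3_commutes(1)]
    by (simp only: add.assoc)
  finally have eq: "p01 + (p02 + (p03 + (p13 + (c + c)))) = (push0 + full_twist3) + (- b + - b)"
    by (simp only: add.assoc)
  have s: "p01 + p02 = a + (b + (b + a))" by (simp add: add.assoc)
  have m: "p13 + (c + c) = - b + (- b + full_twist3)" by (simp add: add.assoc)
  have "commutes b (a + (b + (b + a)))"
    using aba_positive(2)[OF aba] by (simp add: add.assoc)
  moreover define Z where "Z = push0 + full_twist3"
  note Z = full_twist4_commutes[folded Z_def]
  ultimately show "commutes (p01 + (p02 + (p03 + (p13 + (c + c))))) (p01 + p02)"
    unfolding eq unfolding s Z_def[symmetric]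
    by (intro commutes_add_left commutes_minus_left) (intro commutes_add Z)
  show "commutes (p01 + (p02 + (p03 + (p13 + (c + c))))) (p13 + (c + c))"
    unfolding eq unfolding m Z_def[symmetric]
  proof -
    have *: "commutes x (- b + (- b + full_twist3))" if "commutes x b" "commutes x full_twist3" for x
      using that by (intro commutes_add[OF commutes_minus] commutes_minus)
    have "commutes Z full_twist3" by (intro commutes_add Z)
    then show "commutes (Z + (- b + - b)) (- b + (- b + full_twist3))"
      using Z full_twist3_commutes(1)[symmetric] by (intro commutes_add_left commutes_minus_left *) auto
  qed
qed

lemma twist_0_1_23:
  "commutes (p01 + (p02 + (p03 + (b + (b + p13))))) p01"
  "commutes (p01 + (p02 + (p03 + (b + (b + p13))))) (b + (b + p13))"
proof -
  have cM: "commutes c (b + (c + (c + b)))"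
    using aba_positive(1)[OF bcb[symmetric]] by (simp add: add.assoc)
  have m: "b + (b + p13) = b + (c + (c + b))" by (simp add: add.assoc)
  \<comment> \<open>Here the central four-strand twist loses the twist \<open>c + c\<close> of
    strands 2, 3.\<close>
  have "(push0 + full_twist3) + (- c + - c) = push0 + (b + (c + (c + b)))" by (simp add: add.assoc)
  then have eq: "p01 + (p02 + (p03 + (b + (b + p13)))) = (push0 + full_twist3) + (- c + - c)"
    by (simp add: add.assoc)
  define Z where "Z = push0 + full_twist3"
  note Z = full_twist4_commutes[folded Z_def]
  show "commutes (p01 + (p02 + (p03 + (b + (b + p13))))) p01"
    unfolding eq Z_def[symmetric] by (intro commutes_intros Z ca)
  show "commutes (p01 + (p02 + (p03 + (b + (b + p13))))) (b + (b + p13))"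
    unfolding eq unfolding m Z_def[symmetric]
    by (intro commutes_add_left commutes_minus_left cM) (intro commutes_add Z)
qed

end

section \<open>The Artin generators acting on cosets\<close>

definition free_hom :: "('a::presented \<Rightarrow> 'g::group_add) \<Rightarrow> 'a presgroup \<Rightarrow> 'g" where
  "free_hom v w = sum_list (map (\<lambda>l. case l of Pos a \<Rightarrow> v a | Neg a \<Rightarrow> - v a) (rep_presgroup w))"

context
  fixes v :: "'a::presented \<Rightarrow> 'g::group_add"
  assumes free: "(relators :: ('a letter list \<times> 'a letter list) set) = {}"
begin

lemma free_hom_abs:
  "free_hom v (abs_presgroup w) = sum_list (map (\<lambda>l. case l of Pos a \<Rightarrow> v a | Neg a \<Rightarrow> - v a) w)"
proof -
  let ?f = "\<lambda>l. case l of Pos a \<Rightarrow> v a | Neg a \<Rightarrow> - v a"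
  have "sum_list (map ?f u) = sum_list (map ?f w)" if "word_eq u w" for u w
    using that
  proof (induction rule: word_eq.induct)
    case (cancel l)
    show ?case by (cases l) simp_all
  qed (simp_all add: free)
  moreover have "word_eq (rep_presgroup (abs_presgroup w)) w"
    using Quotient3_rep_abs[OF Quotient3_presgroup, of w] by (simp add: word_eq.refl)
  ultimately show ?thesis by (simp add: free_hom_def)
qed

lemma free_hom_add: "free_hom v (g + h) = free_hom v g + free_hom v h"
proof -
  have "g + h = abs_presgroup (rep_presgroup g @ rep_presgroup h)"
    by (simp add: Quotient3_abs_rep[OF Quotient3_presgroup] flip: plus_presgroup.abs_eq)
  then show ?thesis by (simp add: free_hom_abs) (simp add: free_hom_def)
qed

lemma free_hom_gen: "free_hom v (gen a) = v a"
  by (simp add: gen_abs free_hom_abs)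

end

lemma group_hom_zero: "\<phi> 0 = 0" if "\<And>x y. \<phi> (x + y) = \<phi> x + \<phi> y"
  for \<phi> :: "'g::group_add \<Rightarrow> 'h::group_add"
  using that[of 0 0] add_left_imp_eq[of "\<phi> 0" "\<phi> 0" 0] by simp

lemma group_hom_minus: "\<phi> (- x) = - \<phi> x" if "\<And>x y. \<phi> (x + y) = \<phi> x + \<phi> y"
  for \<phi> :: "'g::group_add \<Rightarrow> 'h::group_add"
proof -
  have "\<phi> (- x) + \<phi> x = 0" using that[of "- x" x] group_hom_zero[of \<phi>, OF that] by simp
  then show ?thesis by (rule minus_unique[of "\<phi> (- x)" "\<phi> x", THEN arg_cong[of _ _ uminus], simplified])
qed

lemma presgroup_hom_eqI:
  fixes \<phi> \<psi> :: "'a::presented presgroup \<Rightarrow> 'g::group_add"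
  assumes "\<And>x y. \<phi> (x + y) = \<phi> x + \<phi> y" "\<And>x y. \<psi> (x + y) = \<psi> x + \<psi> y" "\<And>a. \<phi> (gen a) = \<psi> (gen a)"
  shows "\<phi> x = \<psi> x"
  by (induction x rule: presgroup_induct)
    (simp_all add: assms group_hom_zero[of \<phi>, OF assms(1)] group_hom_zero[of \<psi>, OF assms(2)]
      group_hom_minus[of \<phi>, OF assms(1)] group_hom_minus[of \<psi>, OF assms(2)])

lemmas free_hom3_add [simp] = free_hom_add[OF gen3_free]
lemmas free_hom3_gen [simp] = free_hom_gen[OF gen3_free]
lemmas free_hom3_zero [simp] = group_hom_zero[of "free_hom v", OF free_hom_add[OF gen3_free]] for v
lemmas free_hom3_minus [simp] = group_hom_minus[of "free_hom v", OF free_hom_add[OF gen3_free]] for v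

section \<open>Artin's automorphisms of the free group of rank three\<close>

definition twist1 :: "F3 \<Rightarrow> F3" where
  "twist1 = free_hom (case_gen3 (gen G2) (- gen G2 + (gen G1 + gen G2)) (gen G3))"

definition untwist1 :: "F3 \<Rightarrow> F3" where
  "untwist1 = free_hom (case_gen3 (gen G1 + (gen G2 + - gen G1)) (gen G1) (gen G3))"

definition twist2 :: "F3 \<Rightarrow> F3" where
  "twist2 = free_hom (case_gen3 (gen G1) (gen G3) (- gen G3 + (gen G2 + gen G3)))"

definition untwist2 :: "F3 \<Rightarrow> F3" where
  "untwist2 = free_hom (case_gen3 (gen G1) (gen G2 + (gen G3 + - gen G2)) (gen G2))"

lemma twist_add [simp]:
  "twist1 (x + y) = twist1 x + twist1 y" "untwist1 (x + y) = untwist1 x + untwist1 y"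
  "twist2 (x + y) = twist2 x + twist2 y" "untwist2 (x + y) = untwist2 x + untwist2 y"
  by (simp_all add: twist1_def untwist1_def twist2_def untwist2_def)

lemma twist_minus [simp]:
  "twist1 (- x) = - twist1 x" "untwist1 (- x) = - untwist1 x"
  "twist2 (- x) = - twist2 x" "untwist2 (- x) = - untwist2 x"
  by (simp_all add: twist1_def untwist1_def twist2_def untwist2_def)

lemma twist_gen [simp]:
  "twist1 (gen G1) = gen G2" "twist1 (gen G2) = - gen G2 + (gen G1 + gen G2)" "twist1 (gen G3) = gen G3"
  "untwist1 (gen G1) = gen G1 + (gen G2 + - gen G1)" "untwist1 (gen G2) = gen G1" "untwist1 (gen G3) = gen G3"
  "twist2 (gen G1) = gen G1" "twist2 (gen G2) = gen G3" "twist2 (gen G3) = - gen G3 + (gen G2 + gen G3)"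
  "untwist2 (gen G1) = gen G1" "untwist2 (gen G2) = gen G2 + (gen G3 + - gen G2)" "untwist2 (gen G3) = gen G2"
  by (simp_all add: twist1_def untwist1_def twist2_def untwist2_def)

lemma twist_untwist [simp]:
  "twist1 (untwist1 x) = x" "untwist1 (twist1 x) = x"
  "twist2 (untwist2 x) = x" "untwist2 (twist2 x) = x"
proof -
  have *: "\<phi> x = x" if "\<And>x y. \<phi> (x + y) = \<phi> x + \<phi> y" "\<And>a. \<phi> (gen a) = gen a" for \<phi> :: "F3 \<Rightarrow> F3"
    using presgroup_hom_eqI[of \<phi> "\<lambda>x. x"] that by simp
  have gen: "twist1 (untwist1 (gen a)) = gen a" "untwist1 (twist1 (gen a)) = gen a"
    "twist2 (untwist2 (gen a)) = gen a" "untwist2 (twist2 (gen a)) = gen a" for a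
    by (cases a; simp add: add.assoc minus_add)+
  show "twist1 (untwist1 x) = x" "untwist1 (twist1 x) = x"
    "twist2 (untwist2 x) = x" "untwist2 (twist2 x) = x"
    using *[of "\<lambda>x. twist1 (untwist1 x)"] *[of "\<lambda>x. untwist1 (twist1 x)"]
      *[of "\<lambda>x. twist2 (untwist2 x)"] *[of "\<lambda>x. untwist2 (twist2 x)"] gen by simp_all
qed

lemma twist_braid: "twist1 (twist2 (twist1 x)) = twist2 (twist1 (twist2 x))"
proof (rule presgroup_hom_eqI[where x = x])
  fix a show "twist1 (twist2 (twist1 (gen a))) = twist2 (twist1 (twist2 (gen a)))"
    by (cases a; simp add: add.assoc minus_add)
qed simp_all

text \<open>With \<open>t\<^sub>p = \<sigma>\<^sub>p\<^sub>-\<^sub>1 \<cdots> \<sigma>\<^sub>0\<close>, the pair \<open>(p, u)\<close> stands for the coset of \<open>t\<^sub>p u\<close>. The tables record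
  \<open>c\<close> and the conjugation by \<open>\<beta> \<in> {1, \<sigma>\<^sub>1\<^sup>\<plusminus>\<^sup>1, \<sigma>\<^sub>2\<^sup>\<plusminus>\<^sup>1}\<close> in the decomposition \<open>l t\<^sub>p = t\<^sub>q c \<beta>\<close>.\<close>

definition coset_shift :: "artin letter \<Rightarrow> nat \<Rightarrow> F3" where
  "coset_shift l p = (case l of
     Pos S0 \<Rightarrow> if p = 1 then gen G1 else 0
   | Pos S1 \<Rightarrow> if p = 2 then gen G2 else 0
   | Pos S2 \<Rightarrow> if p = 3 then gen G3 else 0
   | Neg S0 \<Rightarrow> if p = 0 then - gen G1 else 0
   | Neg S1 \<Rightarrow> if p = 1 then - gen G2 else 0
   | Neg S2 \<Rightarrow> if p = 2 then - gen G3 else 0)"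

definition coset_aut :: "artin letter \<Rightarrow> nat \<Rightarrow> F3 \<Rightarrow> F3" where
  "coset_aut l p = (case l of
     Pos S0 \<Rightarrow> if p = 2 \<or> p = 3 then twist1 else (\<lambda>u. u)
   | Pos S1 \<Rightarrow> if p = 0 then twist1 else if p = 3 then twist2 else (\<lambda>u. u)
   | Pos S2 \<Rightarrow> if p = 0 \<or> p = 1 then twist2 else (\<lambda>u. u)
   | Neg S0 \<Rightarrow> if p = 2 \<or> p = 3 then untwist1 else (\<lambda>u. u)
   | Neg S1 \<Rightarrow> if p = 0 then untwist1 else if p = 3 then untwist2 else (\<lambda>u. u)
   | Neg S2 \<Rightarrow> if p = 0 \<or> p = 1 then untwist2 else (\<lambda>u. u))"

fun letter_act :: "artin letter \<Rightarrow> nat \<times> F3 \<Rightarrow> nat \<times> F3" where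
  "letter_act l (p, u) = (letter_perm l p, coset_shift l p + coset_aut l p u)"

definition word_act :: "artin letter list \<Rightarrow> nat \<times> F3 \<Rightarrow> nat \<times> F3" where
  "word_act w = foldr (\<lambda>l f. letter_act l \<circ> f) w id"

lemma word_act_append: "word_act (u @ w) = word_act u \<circ> word_act w"
  by (induction u) (simp_all add: word_act_def o_assoc)

text \<open>The relations hold on the coset table entry by entry; on a component that both letters
  of a braid relation fix, the relation is \<open>twist_braid\<close>.\<close>

lemma word_act_cong: "word_eq u w \<Longrightarrow> word_act u = word_act w"
proof (induction rule: word_eq.induct)
  case (cancel l)
  have "letter_act l (letter_act (flip_letter l) (p, u)) = (p, u)" for p u
    by (cases l; rename_tac s; case_tac s)
      (auto simp: coset_shift_def coset_aut_def transpose_def add.assoc[symmetric])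
  then show ?case by (auto simp: word_act_def fun_eq_iff)
next
  case (relator u w)
  have 1: "letter_act (Pos S0) (letter_act (Pos S1) (letter_act (Pos S0) (p, u)))
      = letter_act (Pos S1) (letter_act (Pos S0) (letter_act (Pos S1) (p, u)))" for p u
    by (auto simp: coset_shift_def coset_aut_def transpose_def add.assoc twist_braid)
  have 2: "letter_act (Pos S1) (letter_act (Pos S2) (letter_act (Pos S1) (p, u)))
      = letter_act (Pos S2) (letter_act (Pos S1) (letter_act (Pos S2) (p, u)))" for p u
    by (auto simp: coset_shift_def coset_aut_def transpose_def add.assoc twist_braid)
  have 3: "letter_act (Pos S0) (letter_act (Pos S2) (p, u))
      = letter_act (Pos S2) (letter_act (Pos S0) (p, u))" for p u
    by (auto simp: coset_shift_def coset_aut_def transpose_def add.assoc)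
  from relator show ?case
    by (auto simp: relators_artin_def word_act_def fun_eq_iff 1 2 3 simp del: letter_act.simps)
qed (simp_all add: word_act_append)

text \<open>The shape shared by all linear parts. The permutation is carried along because single
  letters are not pure; once it is the identity, the map is trivial on the abelianization.\<close>

definition permuting_hom :: "(F3 \<Rightarrow> F3) \<Rightarrow> (gen3 \<Rightarrow> gen3) \<Rightarrow> bool" where
  "permuting_hom \<theta> \<tau> \<longleftrightarrow> (\<forall>x y. \<theta> (x + y) = \<theta> x + \<theta> y) \<and>
     (\<forall>i. \<exists>d. \<theta> (gen i) = d + (gen (\<tau> i) + - d))"

lemma permuting_hom_comp:
  assumes "permuting_hom \<theta> \<tau>" "permuting_hom \<theta>' \<tau>'"
  shows "permuting_hom (\<lambda>x. \<theta> (\<theta>' x)) (\<lambda>i. \<tau> (\<tau>' i))"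
  unfolding permuting_hom_def
proof (intro conjI allI)
  have add: "\<theta> (x + y) = \<theta> x + \<theta> y" for x y using assms(1) by (simp add: permuting_hom_def)
  show "\<theta> (\<theta>' (x + y)) = \<theta> (\<theta>' x) + \<theta> (\<theta>' y)" for x y
    using assms(2) by (simp add: permuting_hom_def add)
  fix i
  obtain d where d: "\<theta>' (gen i) = d + (gen (\<tau>' i) + - d)"
    using assms(2) unfolding permuting_hom_def by blast
  obtain e where e: "\<theta> (gen (\<tau>' i)) = e + (gen (\<tau> (\<tau>' i)) + - e)"
    using assms(1) unfolding permuting_hom_def by blast
  have "\<theta> (\<theta>' (gen i)) = (\<theta> d + e) + (gen (\<tau> (\<tau>' i)) + - (\<theta> d + e))"
    by (simp add: d e add group_hom_minus[of \<theta>, OF add] add.assoc minus_add)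
  then show "\<exists>d. \<theta> (\<theta>' (gen i)) = d + (gen (\<tau> (\<tau>' i)) + - d)" by blast
qed

lemma permuting_homI:
  assumes "\<And>x y. \<theta> (x + y) = \<theta> x + \<theta> y"
    and "\<theta> (gen G1) = d1 + (gen (\<tau> G1) + - d1)" "\<theta> (gen G2) = d2 + (gen (\<tau> G2) + - d2)"
      "\<theta> (gen G3) = d3 + (gen (\<tau> G3) + - d3)"
  shows "permuting_hom \<theta> \<tau>"
  unfolding permuting_hom_def
proof (intro conjI allI)
  fix i show "\<exists>d. \<theta> (gen i) = d + (gen (\<tau> i) + - d)" by (cases i) (use assms in blast)+
qed (rule assms(1))

lemma permuting_hom_twist:
  "permuting_hom (\<lambda>u. u) id"
  "permuting_hom twist1 (transpose G1 G2)" "permuting_hom untwist1 (transpose G1 G2)"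
  "permuting_hom twist2 (transpose G2 G3)" "permuting_hom untwist2 (transpose G2 G3)"
  by (rule permuting_homI[where ?d1.0 = 0 and ?d2.0 = 0 and ?d3.0 = 0]
      permuting_homI[where ?d1.0 = 0 and ?d2.0 = "- gen G2" and ?d3.0 = 0]
      permuting_homI[where ?d1.0 = "gen G1" and ?d2.0 = 0 and ?d3.0 = 0]
      permuting_homI[where ?d1.0 = 0 and ?d2.0 = 0 and ?d3.0 = "- gen G3"]
      permuting_homI[where ?d1.0 = 0 and ?d2.0 = "gen G2" and ?d3.0 = 0];
      simp; fail)+

fun strand_index :: "gen3 \<Rightarrow> nat" where
  "strand_index G1 = 1" | "strand_index G2 = 2" | "strand_index G3 = 3"

text \<open>The position of strand \<open>i\<close> after the coset representative
  \<open>\<sigma>\<^sub>p\<^sub>-\<^sub>1 \<cdots> \<sigma>\<^sub>0\<close>, which moves strand \<open>0\<close> to position \<open>p\<close>.\<close>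

definition strand_pos :: "nat \<Rightarrow> gen3 \<Rightarrow> nat" where
  "strand_pos p i = (if strand_index i \<le> p then strand_index i - 1 else strand_index i)"

definition coset_swap :: "artin letter \<Rightarrow> nat \<Rightarrow> gen3 \<Rightarrow> gen3" where
  "coset_swap l p = (case (case l of Pos s \<Rightarrow> s | Neg s \<Rightarrow> s) of
     S0 \<Rightarrow> if p = 2 \<or> p = 3 then transpose G1 G2 else id
   | S1 \<Rightarrow> if p = 0 then transpose G1 G2 else if p = 3 then transpose G2 G3 else id
   | S2 \<Rightarrow> if p = 0 \<or> p = 1 then transpose G2 G3 else id)"

lemma permuting_hom_coset: "permuting_hom (coset_aut l p) (coset_swap l p)"
  by (cases l; rename_tac s; case_tac s)
    (simp_all add: coset_aut_def coset_swap_def permuting_hom_twist)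

text \<open>Equivariance of the strand bookkeeping; it forces the permutation of the generators to
  be trivial when the whole braid is pure.\<close>

lemma letter_perm_strand_pos:
  assumes "p \<le> 3"
  shows "letter_perm l (strand_pos p i) = strand_pos (letter_perm l p) (coset_swap l p i)"
    and "letter_perm l p \<le> 3"
proof -
  have p: "p = 0 \<or> p = 1 \<or> p = 2 \<or> p = 3" using assms by auto
  show "letter_perm l (strand_pos p i) = strand_pos (letter_perm l p) (coset_swap l p i)"
    by (cases l; rename_tac s; case_tac s; cases i)
      (use p in \<open>auto simp: coset_swap_def strand_pos_def transpose_def\<close>)
  show "letter_perm l p \<le> 3"
    by (cases l; rename_tac s; case_tac s) (use p in \<open>auto simp: transpose_def\<close>)
qed

text \<open>Translation and linear part are carried along letter by letter, through changing
  components; purity of the braid comes in only afterwards.\<close>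

lemma word_act_coset:
  assumes "p \<le> 3"
  shows "\<exists>c \<theta> \<tau>. (\<forall>u. word_act w (p, u) = (word_perm w p, c + \<theta> u)) \<and> permuting_hom \<theta> \<tau> \<and>
    (\<forall>i. word_perm w (strand_pos p i) = strand_pos (word_perm w p) (\<tau> i)) \<and> word_perm w p \<le> 3"
proof (induction w)
  case Nil
  show ?case using assms permuting_hom_twist(1)
    by (intro exI[of _ 0] exI[of _ "\<lambda>u. u"] exI[of _ id]) (simp add: word_act_def word_perm_def id_def)
next
  case (Cons l w)
  then obtain c \<theta> \<tau> where IH: "\<And>u. word_act w (p, u) = (word_perm w p, c + \<theta> u)" "permuting_hom \<theta> \<tau>"
    "\<And>i. word_perm w (strand_pos p i) = strand_pos (word_perm w p) (\<tau> i)" "word_perm w p \<le> 3" by blast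
  let ?q = "word_perm w p"
  have perm: "word_perm (l # w) p = letter_perm l (word_perm w p)" for p by (simp add: word_perm_def)
  have add: "coset_aut l ?q (x + y) = coset_aut l ?q x + coset_aut l ?q y" for x y
    using permuting_hom_coset[of l ?q] by (simp add: permuting_hom_def)
  have "word_act (l # w) (p, u) = (word_perm (l # w) p,
      (coset_shift l ?q + coset_aut l ?q c) + coset_aut l ?q (\<theta> u))" for u
    using IH(1)[of u] by (simp add: word_act_def perm add add.assoc)
  then show ?case
    using permuting_hom_comp[OF permuting_hom_coset[of l ?q] IH(2)]
    by (intro exI[of _ "coset_shift l ?q + coset_aut l ?q c"] exI[of _ "\<lambda>u. coset_aut l ?q (\<theta> u)"]
        exI[of _ "\<lambda>i. coset_swap l ?q (\<tau> i)"])
      (simp add: perm IH letter_perm_strand_pos)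
qed

section \<open>The affine action of pure braids on the free group\<close>

definition braid_act :: "B4 \<Rightarrow> nat \<times> F3 \<Rightarrow> nat \<times> F3" where
  "braid_act b = word_act (rep_presgroup b)"

lemma braid_act_abs: "braid_act (abs_presgroup w) = word_act w"
  unfolding braid_act_def
  by (rule word_act_cong) (use Quotient3_rep_abs[OF Quotient3_presgroup, of w] in \<open>simp add: word_eq.refl\<close>)

lemma braid_act_add: "braid_act (b + b') x = braid_act b (braid_act b' x)"
proof -
  have "b + b' = abs_presgroup (rep_presgroup b @ rep_presgroup b')"
    by (simp add: Quotient3_abs_rep[OF Quotient3_presgroup] flip: plus_presgroup.abs_eq)
  then show ?thesis by (simp add: braid_act_abs word_act_append) (simp add: braid_act_def)
qed

lemma braid_act_zero: "braid_act 0 x = x"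
  by (simp add: zero_presgroup_def braid_act_abs word_act_def)

lemma braid_act_gen: "braid_act (gen s) x = letter_act (Pos s) x"
  by (simp add: gen_abs braid_act_abs word_act_def)

lemma braid_act_minus_gen: "braid_act (- gen s) x = letter_act (Neg s) x"
  by (simp add: uminus_gen_abs[unfolded gen_abs] gen_abs braid_act_abs word_act_def)

lemma braid_perm_rep: "braid_perm b = word_perm (rep_presgroup b)"
  by (simp add: braid_perm_def)

definition pure_act :: "PB4 \<Rightarrow> F3 \<Rightarrow> F3" where
  "pure_act g u = snd (braid_act (Rep_PB4 g) (0, u))"

lemma pure_act_coset:
  "\<exists>\<theta>. (\<forall>u. braid_act (Rep_PB4 g) (0, u) = (0, pure_act g 0 + \<theta> u)) \<and> permuting_hom \<theta> id"
proof -
  have id: "word_perm (rep_presgroup (Rep_PB4 g)) = id"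
    using Rep_PB4[of g] by (simp add: braid_perm_rep)
  obtain c \<theta> \<tau> where *: "\<And>u. braid_act (Rep_PB4 g) (0, u) = (0, c + \<theta> u)" "permuting_hom \<theta> \<tau>"
    "\<And>i. strand_pos 0 i = strand_pos 0 (\<tau> i)"
    using word_act_coset[OF le0, of "rep_presgroup (Rep_PB4 g)"]
    unfolding braid_act_def id id_apply by blast
  \<comment> \<open>\<open>strand_pos 0\<close> is injective, so a braid that fixes all positions
    fixes all generators.\<close>
  have "\<tau> i = i" for i
    using *(3)[of i] by (cases i; cases "\<tau> i") (simp_all add: strand_pos_def)
  then have "\<tau> = id" by (simp add: fun_eq_iff)
  moreover have "\<theta> 0 = 0"
    using *(2) by (intro group_hom_zero) (simp add: permuting_hom_def)
  ultimately show ?thesis using * by (intro exI[of _ \<theta>]) (simp add: pure_act_def)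
qed

lemma braid_act_pure: "braid_act (Rep_PB4 g) (0, u) = (0, pure_act g u)"
proof -
  obtain \<theta> where *: "\<And>u. braid_act (Rep_PB4 g) (0, u) = (0, pure_act g 0 + \<theta> u)"
    using pure_act_coset by blast
  show ?thesis by (simp only: pure_act_def[of g u] *[of u] snd_conv)
qed

lemma pure_act_zero: "pure_act 0 u = u"
  by (simp add: pure_act_def zero_PB4.rep_eq braid_act_zero)

lemma pure_act_add: "pure_act (g + h) u = pure_act g (pure_act h u)"
proof -
  have "braid_act (Rep_PB4 (g + h)) (0, u) = (0, pure_act g (pure_act h u))"
    by (simp only: plus_PB4.rep_eq braid_act_add braid_act_pure)
  then show ?thesis by (simp only: braid_act_pure prod.inject)
qed

abbreviation pure_aut :: "PB4 \<Rightarrow> F3 \<Rightarrow> F3" where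
  "pure_aut g u \<equiv> - pure_act g 0 + pure_act g u"

lemma permuting_hom_pure_aut: "permuting_hom (pure_aut g) id"
proof -
  obtain \<theta> where *: "\<And>u. braid_act (Rep_PB4 g) (0, u) = (0, pure_act g 0 + \<theta> u)" "permuting_hom \<theta> id"
    using pure_act_coset by blast
  then have eq: "pure_act g u = pure_act g 0 + \<theta> u" for u
    by (metis braid_act_pure prod.inject)
  have "pure_aut g u = \<theta> u" for u by (simp only: eq[of u] minus_add_cancel)
  with *(2) show ?thesis by simp
qed

declare One_nat_def [simp del]

section \<open>The free normal subgroup of the pure braid group\<close>

abbreviation (input) s0 :: B4 where "s0 \<equiv> gen S0"
abbreviation (input) s1 :: B4 where "s1 \<equiv> gen S1"
abbreviation (input) s2 :: B4 where "s2 \<equiv> gen S2"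

lemma artin_relations:
  "s0 + (s1 + s0) = s1 + (s0 + s1)" "s1 + (s2 + s1) = s2 + (s1 + s2)" "s2 + s0 = s0 + s2"
proof -
  have "word_eq [Pos S0, Pos S1, Pos S0] [Pos S1, Pos S0, Pos S1]"
    "word_eq [Pos S1, Pos S2, Pos S1] [Pos S2, Pos S1, Pos S2]" "word_eq [Pos S0, Pos S2] [Pos S2, Pos S0]"
    by (rule word_eq.relator, simp add: relators_artin_def)+
  then show "s0 + (s1 + s0) = s1 + (s0 + s1)" "s1 + (s2 + s1) = s2 + (s1 + s2)" "s2 + s0 = s0 + s2"
    by (simp_all add: gen_abs plus_presgroup.abs_eq presgroup.abs_eq_iff word_eq.sym)
qed

lemma Rep_xpure:
  "Rep_PB4 (xpure 0 1) = s0 + s0"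
  "Rep_PB4 (xpure 0 2) = - s0 + (s1 + (s1 + s0))"
  "Rep_PB4 (xpure 0 3) = - s0 + (- s1 + (s2 + (s2 + (s1 + s0))))"
  "Rep_PB4 (xpure 1 2) = s1 + s1"
  "Rep_PB4 (xpure 1 3) = - s1 + (s2 + (s2 + s1))"
  "Rep_PB4 (xpure 2 3) = s2 + s2"
  by (simp_all add: xpure.rep_eq sigma_def Let_def add.assoc minus_add upt_rec numeral_3_eq_3 numeral_2_eq_2)

definition iota :: "F3 \<Rightarrow> PB4" where
  "iota = free_hom (case_gen3 (xpure 0 1) (xpure 0 2) (xpure 0 3))"

lemma iota_add [simp]: "iota (x + y) = iota x + iota y"
  and iota_minus [simp]: "iota (- x) = - iota x"
  and iota_zero [simp]: "iota 0 = 0"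
  and iota_gen: "iota (gen G1) = xpure 0 1" "iota (gen G2) = xpure 0 2" "iota (gen G3) = xpure 0 3"
  by (simp_all add: iota_def)

lemma twist_zero [simp]: "twist1 0 = 0" "twist2 0 = 0" "untwist1 0 = 0" "untwist2 0 = 0"
  by (simp_all add: twist1_def twist2_def untwist1_def untwist2_def)

lemma pure_act_xpure:
  "pure_act (xpure 0 1) u = gen G1 + u" "pure_act (xpure 0 2) u = gen G2 + u" "pure_act (xpure 0 3) u = gen G3 + u"
  "pure_act (xpure 1 2) 0 = 0" "pure_act (xpure 1 3) 0 = 0" "pure_act (xpure 2 3) 0 = 0"
  by (simp_all add: pure_act_def Rep_xpure braid_act_add braid_act_gen braid_act_minus_gen
      coset_shift_def coset_aut_def transpose_def)

lemma pure_act_minus: "pure_act (- g) (pure_act g u) = u"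
  by (simp add: pure_act_zero flip: pure_act_add)

text \<open>At \<open>u = 0\<close> this says that the orbit map splits \<open>iota\<close>.\<close>

lemma pure_act_iota: "pure_act (iota v) u = v + u"
proof (induction v rule: presgroup_induct)
  case zero
  show ?case by (simp add: pure_act_zero)
next
  case (gen a w)
  then show ?case
    by (cases a) (simp_all add: pure_act_add iota_gen pure_act_xpure add.assoc)
next
  case (minus_gen a w)
  have "pure_act (iota (gen a)) (- gen a + (w + u)) = w + u"
    by (cases a) (simp_all add: iota_gen pure_act_xpure)
  with pure_act_minus[of "iota (gen a)" "- gen a + (w + u)"] show ?case
    by (simp add: pure_act_add minus_gen add.assoc)
qed

abbreviation (input) iota_braid :: "F3 \<Rightarrow> B4" where "iota_braid u \<equiv> Rep_PB4 (iota u)"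

lemma iota_braid_add: "iota_braid (x + y) = iota_braid x + iota_braid y"
  by (simp add: plus_PB4.rep_eq)

lemma iota_braid_minus: "iota_braid (- x) = - iota_braid x"
  by (simp add: uminus_PB4.rep_eq)

text \<open>Identifies conjugation inside \<open>B4\<close> with the linear parts of the coset
  table; generators suffice, by \<open>conj_y\<close>.\<close>

lemma iota_braid_twist:
  "s1 + (iota_braid u + - s1) = iota_braid (twist1 u)" "s2 + (iota_braid u + - s2) = iota_braid (twist2 u)"
proof -
  note y = conj_y[OF artin_relations]
  have additive: "b + (iota_braid (x + y) + - b) = b + (iota_braid x + - b) + (b + (iota_braid y + - b))" for b x y
    by (simp add: plus_PB4.rep_eq add.assoc)
  show "s1 + (iota_braid u + - s1) = iota_braid (twist1 u)"
  proof (rule presgroup_hom_eqI[where x = u and \<phi> = "\<lambda>u. s1 + (iota_braid u + - s1)"])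
    fix a show "s1 + (iota_braid (gen a) + - s1) = iota_braid (twist1 (gen a))"
      by (cases a) (simp_all only: twist_gen iota_braid_add iota_braid_minus iota_gen Rep_xpure y)
  qed (rule additive, simp only: twist_add iota_braid_add)
  show "s2 + (iota_braid u + - s2) = iota_braid (twist2 u)"
  proof (rule presgroup_hom_eqI[where x = u and \<phi> = "\<lambda>u. s2 + (iota_braid u + - s2)"])
    fix a show "s2 + (iota_braid (gen a) + - s2) = iota_braid (twist2 (gen a))"
      by (cases a) (simp_all only: twist_gen iota_braid_add iota_braid_minus iota_gen Rep_xpure y)
  qed (rule additive, simp only: twist_add iota_braid_add)
qed

section \<open>Normality of the free subgroup\<close>

fun coset_rep :: "nat \<Rightarrow> B4" where
  "coset_rep p = (if p = 0 then 0 else if p = 1 then s0 else if p = 2 then s1 + s0 else s2 + (s1 + s0))"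

text \<open>The conjugate of the free subgroup by \<open>t\<close>. \<open>PB4\<close> is given as a
  kernel, without generators, so normality is read off from the generators of \<open>B4\<close>,
  which permute the four conjugates by coset representatives.\<close>

definition iota_conj :: "B4 \<Rightarrow> B4 set" where
  "iota_conj t = range (\<lambda>u. t + (iota_braid u + - t))"

text \<open>The hypotheses mirror the coset table: \<open>c\<close> conjugates within the free
  subgroup and \<open>\<beta>\<close> induces the surjection \<open>\<theta>\<close> on it, so no
  part of the target conjugate is missed.\<close>

lemma iota_conj_image:
  assumes t: "b + t = t' + (iota_braid c + \<beta>)"
    and \<beta>: "\<And>u. \<beta> + (iota_braid u + - \<beta>) = iota_braid (\<theta> u)" and \<theta>: "surj \<theta>"
  shows "(\<lambda>x. b + (x + - b)) ` iota_conj t = iota_conj t'"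
proof -
  have *: "b + ((t + (iota_braid u + - t)) + - b) = t' + (iota_braid (c + (\<theta> u + - c)) + - t')" for u
  proof -
    have "b + ((t + (iota_braid u + - t)) + - b) = (b + t) + (iota_braid u + - (b + t))"
      by (simp add: add.assoc minus_add)
    also have "\<dots> = t' + ((iota_braid c + ((\<beta> + (iota_braid u + - \<beta>)) + - iota_braid c)) + - t')"
      by (simp add: t add.assoc minus_add)
    also have "\<dots> = t' + (iota_braid (c + (\<theta> u + - c)) + - t')"
      by (simp only: \<beta> iota_braid_add iota_braid_minus add.assoc)
    finally show ?thesis .
  qed
  have "surj (\<lambda>u. c + (\<theta> u + - c))"
  proof (rule surjI)
    fix v
    have "\<theta> (inv_into UNIV \<theta> (- c + (v + c))) = - c + (v + c)" by (rule surj_f_inv_f[OF \<theta>])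
    then show "c + (\<theta> (inv_into UNIV \<theta> (- c + (v + c))) + - c) = v" by (simp add: add.assoc)
  qed
  moreover have "(\<lambda>x. b + (x + - b)) ` iota_conj t
      = (\<lambda>v. t' + (iota_braid v + - t')) ` range (\<lambda>u. c + (\<theta> u + - c))"
    by (simp only: iota_conj_def image_image *)
  ultimately show ?thesis by (simp only: iota_conj_def)
qed

lemma surj_twist: "surj twist1" "surj twist2" "surj (\<lambda>u :: F3. u)"
  by (rule surjI[where f = untwist1], simp, rule surjI[where f = untwist2], simp, simp)

lemma iota_conj_gen:
  assumes "p \<le> 3"
  shows "(\<lambda>x. gen s + (x + - gen s)) ` iota_conj (coset_rep p)
    = iota_conj (coset_rep (transpose (artin_index s) (Suc (artin_index s)) p))"
proof -
  note r = artin_relations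
  have l: "s2 + (s0 + x) = s0 + (s2 + x)" for x by (simp add: r(3) flip: add.assoc)
  have l01: "s0 + (s1 + (s0 + x)) = s1 + (s0 + (s1 + x))" for x by (rule aba_left[OF r(1)])
  have l12: "s1 + (s2 + (s1 + x)) = s2 + (s1 + (s2 + x))" for x by (rule aba_left[OF r(2)])
  note id = iota_conj_image[where \<theta> = "\<lambda>u. u" and \<beta> = 0, OF _ _ surj_twist(3)]
    and tw1 = iota_conj_image[where c = 0 and \<theta> = twist1 and \<beta> = s1, OF _ iota_braid_twist(1) surj_twist(1)]
    and tw2 = iota_conj_image[where c = 0 and \<theta> = twist2 and \<beta> = s2, OF _ iota_braid_twist(2) surj_twist(2)]
  consider "p = 0" | "p = 1" | "p = 2" | "p = 3" using assms by linarith
  then show ?thesis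
  proof cases
    case 1
    then show ?thesis
    proof (cases s)
      case S0
      then show ?thesis using 1
        by (simp only:, intro id[of _ _ _ 0]) (simp_all add: transpose_def zero_PB4.rep_eq iota_gen Rep_xpure add.assoc)
    next
      case S1
      then show ?thesis using 1
        by (simp only:, intro tw1) (simp_all add: transpose_def zero_PB4.rep_eq  add.assoc)
    next
      case S2
      then show ?thesis using 1
        by (simp only:, intro tw2) (simp_all add: transpose_def zero_PB4.rep_eq  add.assoc)
    qed
  next
    case 2
    then show ?thesis
    proof (cases s)
      case S0
      then show ?thesis using 2
        by (simp only:, intro id[of _ _ _ "gen G1"]) (simp_all add: transpose_def zero_PB4.rep_eq iota_gen Rep_xpure add.assoc)
    next
      case S1
      then show ?thesis using 2
        by (simp only:, intro id[of _ _ _ 0]) (simp_all add: transpose_def zero_PB4.rep_eq iota_gen Rep_xpure add.assoc)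
    next
      case S2
      then show ?thesis using 2
        by (simp only:, intro tw2) (simp_all add: transpose_def zero_PB4.rep_eq r(3) add.assoc)
    qed
  next
    case 3
    then show ?thesis
    proof (cases s)
      case S0
      then show ?thesis using 3
        by (simp only:, intro tw1) (simp_all add: transpose_def zero_PB4.rep_eq r add.assoc)
    next
      case S1
      then show ?thesis using 3
        by (simp only:, intro id[of _ _ _ "gen G2"]) (simp_all add: transpose_def zero_PB4.rep_eq iota_gen Rep_xpure add.assoc)
    next
      case S2
      then show ?thesis using 3
        by (simp only:, intro id[of _ _ _ 0]) (simp_all add: transpose_def zero_PB4.rep_eq iota_gen Rep_xpure add.assoc)
    qed
  next
    case 4
    then show ?thesis
    proof (cases s)
      case S0
      then show ?thesis using 4
        by (simp only:, intro tw1) (simp_all add: transpose_def zero_PB4.rep_eq r(1) l[symmetric] add.assoc)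
    next
      case S1
      then show ?thesis using 4
        by (simp only:, intro tw2) (simp_all add: transpose_def zero_PB4.rep_eq l12 r(3) add.assoc)
    next
      case S2
      then show ?thesis using 4
        by (simp only:, intro id[of _ _ _ "gen G3"]) (simp_all add: transpose_def zero_PB4.rep_eq iota_gen Rep_xpure add.assoc)
    qed
  qed
qed

lemma braid_perm_gen: "braid_perm (gen s) = transpose (artin_index s) (Suc (artin_index s))"
  by transfer (simp add: word_perm_def)

lemma iota_conj_braid:
  assumes "p \<le> 3"
  shows "(\<lambda>x. b + (x + - b)) ` iota_conj (coset_rep p) = iota_conj (coset_rep (braid_perm b p)) \<and> braid_perm b p \<le> 3"
proof (induction b rule: presgroup_induct)
  case zero
  show ?case using assms by (simp add: braid_perm_zero)
next
  case (gen s w)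
  let ?q = "braid_perm w p" and ?t = "transpose (artin_index s) (Suc (artin_index s))"
  have "(\<lambda>x. gen s + w + (x + - (gen s + w))) ` iota_conj (coset_rep p)
      = (\<lambda>x. gen s + (x + - gen s)) ` (\<lambda>x. w + (x + - w)) ` iota_conj (coset_rep p)"
    by (simp only: image_image add.assoc minus_add)
  also have "\<dots> = (\<lambda>x. gen s + (x + - gen s)) ` iota_conj (coset_rep ?q)"
    using gen by (simp only:)
  also have "\<dots> = iota_conj (coset_rep (?t ?q))" using gen by (intro iota_conj_gen) simp
  finally show ?case
    using gen letter_perm_strand_pos(2)[of ?q "Pos s"]
    by (simp only: braid_perm_plus braid_perm_gen o_apply letter_perm.simps)
next
  case (minus_gen s w)
  let ?q = "braid_perm w p" and ?t = "transpose (artin_index s) (Suc (artin_index s))"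
  have "braid_perm (- gen s) \<circ> ?t = id"
    using braid_perm_minus[of "gen s"] by (simp only: braid_perm_gen)
  then have "(braid_perm (- gen s) \<circ> ?t) \<circ> ?t = ?t" by simp
  then have t: "braid_perm (- gen s) = ?t" by (simp only: comp_assoc transpose_comp_involutory comp_id)
  have le: "?t ?q \<le> 3" using minus_gen letter_perm_strand_pos(2)[of ?q "Pos s"] by simp
  have "(\<lambda>x. - gen s + w + (x + - (- gen s + w))) ` iota_conj (coset_rep p)
      = (\<lambda>x. - gen s + (x + gen s)) ` (\<lambda>x. w + (x + - w)) ` iota_conj (coset_rep p)"
    by (simp only: image_image add.assoc minus_add minus_minus)
  also have "\<dots> = (\<lambda>x. - gen s + (x + gen s)) ` iota_conj (coset_rep ?q)"
    using minus_gen by (simp only:)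
  also have "iota_conj (coset_rep ?q) = (\<lambda>x. gen s + (x + - gen s)) ` iota_conj (coset_rep (?t ?q))"
    using iota_conj_gen[OF le, of s] by (simp only: transpose_involutory)
  also have "(\<lambda>x. - gen s + (x + gen s)) ` \<dots> = iota_conj (coset_rep (?t ?q))"
    by (simp add: image_image add.assoc del: coset_rep.simps)
  finally show ?case
    using le by (simp only: braid_perm_plus t o_apply)
qed

text \<open>A pure braid keeps position 0, whose coset representative is trivial.\<close>

lemma iota_normal: "\<exists>v. g + (iota u + - g) = iota v"
proof -
  have "braid_perm (Rep_PB4 g) 0 = 0" using Rep_PB4[of g] by simp
  then have "(\<lambda>x. Rep_PB4 g + (x + - Rep_PB4 g)) ` iota_conj 0 = iota_conj 0"
    using iota_conj_braid[of 0 "Rep_PB4 g"] by simp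
  moreover have "iota_braid u \<in> iota_conj 0" by (simp add: iota_conj_def)
  ultimately have "Rep_PB4 g + (iota_braid u + - Rep_PB4 g) \<in> iota_conj 0" by blast
  then obtain v where "Rep_PB4 g + (iota_braid u + - Rep_PB4 g) = iota_braid v"
    by (auto simp: iota_conj_def)
  then have "g + (iota u + - g) = iota v"
    by (simp add: plus_PB4.rep_eq uminus_PB4.rep_eq flip: Rep_PB4_inject)
  then show ?thesis by blast
qed

text \<open>The linking number of the strands \<open>0\<close> and \<open>1\<close>.\<close>

definition winding :: "PB4 \<Rightarrow> int" where
  "winding g = free_hom (case_gen3 1 0 0) (pure_act g 0)"

text \<open>\<open>pure_act g 0\<close> is only a crossed homomorphism in \<open>g\<close>, but its
  twist is by maps that send each generator to a conjugate, which exponent sums do not see.\<close>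

lemma winding_add: "winding (g + h) = winding g + winding h"
proof -
  let ?e = "free_hom (case_gen3 1 0 0) :: F3 \<Rightarrow> int"
  have p: "permuting_hom (pure_aut g) id" by (rule permuting_hom_pure_aut)
  have "?e (pure_aut g x) = ?e x" for x
  proof (rule presgroup_hom_eqI[where x = x and \<phi> = "\<lambda>x. ?e (pure_aut g x)"])
    show "?e (pure_aut g (x + y)) = ?e (pure_aut g x) + ?e (pure_aut g y)" for x y
      using p unfolding permuting_hom_def by (metis free_hom3_add)
    fix a
    obtain d where "pure_aut g (gen a) = d + (gen a + - d)"
      using p unfolding permuting_hom_def id_apply by blast
    then have "?e (pure_aut g (gen a)) = ?e (d + (gen a + - d))" by (rule arg_cong)
    then show "?e (pure_aut g (gen a)) = ?e (gen a)" by simp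
  qed simp
  from this[of "pure_act h 0"] show ?thesis
    by (simp add: winding_def pure_act_add)
qed

lemma winding_xpure:
  "winding (xpure 0 1) = 1" "winding (xpure 0 2) = 0" "winding (xpure 1 2) = 0"
  "winding (xpure 1 3) = 0" "winding (xpure 2 3) = 0"
  using pure_act_xpure(1,2)[of 0] by (simp_all add: winding_def pure_act_xpure)

section \<open>Relations in the pure braid group\<close>

text \<open>Braids that permute the strands enter the completion only through these automorphisms of
  \<open>PB4\<close>.\<close>

definition pure_conj :: "B4 \<Rightarrow> PB4 \<Rightarrow> PB4" where
  "pure_conj b g = Abs_PB4 (b + (Rep_PB4 g + - b))"

lemma Rep_pure_conj: "Rep_PB4 (pure_conj b g) = b + (Rep_PB4 g + - b)"
proof -
  have "braid_perm b \<circ> (braid_perm (Rep_PB4 g) \<circ> braid_perm (- b)) = id"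
    using braid_perm_minus[of "- b"] Rep_PB4[of g] by simp
  then show ?thesis
    unfolding pure_conj_def by (intro Abs_PB4_inverse) (simp add: braid_perm_plus)
qed

lemma PB4_eq_iff: "g = h \<longleftrightarrow> Rep_PB4 g = Rep_PB4 h"
  by (simp add: Rep_PB4_inject)

lemma pure_conj_add: "pure_conj b (g + h) = pure_conj b g + pure_conj b h"
  by (simp add: PB4_eq_iff plus_PB4.rep_eq Rep_pure_conj add.assoc)

lemmas PB4_simps = PB4_eq_iff plus_PB4.rep_eq uminus_PB4.rep_eq Rep_pure_conj Rep_xpure
  add.assoc minus_add

lemma pure_conj_s0:
  "pure_conj (- s0) (xpure 0 1) = xpure 0 1"
  "pure_conj (- s0) (xpure 0 2) = - xpure 0 1 + (xpure 1 2 + xpure 0 1)"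
  "pure_conj (- s0) (xpure 1 2) = xpure 0 2"
  "pure_conj (- s0) (xpure 1 3) = xpure 0 3"
  "pure_conj (- s0) (xpure 2 3) = xpure 2 3"
  by (simp_all add: PB4_simps ca_simps[OF artin_relations])

text \<open>Up to one conjugation this relabels the strands 0, 1, 2 as 1, 2, 0, just as
  \<open>pure_conj_s0\<close> exchanges 0 and 1.\<close>

lemma pure_conj_s0_s1:
  "pure_conj (- s0 + - s1) (xpure 0 1) = xpure 1 2"
  "pure_conj (- s0 + - s1) (xpure 0 2) = xpure 0 1"
  "pure_conj (- s0 + - s1) (xpure 1 2) = xpure 0 2"
  "pure_conj (- s0 + - s1) (xpure 1 3) = - xpure 0 2 + (xpure 2 3 + xpure 0 2)"
  "pure_conj (- s0 + - s1) (xpure 2 3) = xpure 0 3"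
proof -
  note r = artin_relations
  have "- s1 + (s0 + (s0 + s1)) = s0 + (s1 + (s1 + - s0))" by (rule aba_conj'[OF r(1)])
  from arg_cong[OF this, of "\<lambda>x. - s0 + (x + s0)"]
  show "pure_conj (- s0 + - s1) (xpure 0 1) = xpure 1 2" by (simp add: PB4_simps)
  have "s1 + (s1 + (s0 + (s1 + s0))) = s0 + (s1 + (s0 + (s0 + s0)))"
    by (metis r(1) aba_left[OF r(1)])
  from arg_cong[OF this, of "\<lambda>x. - s0 + (- s1 + (- s0 + x))"]
  show "pure_conj (- s0 + - s1) (xpure 0 2) = xpure 0 1" by (simp add: PB4_simps)
  show "pure_conj (- s0 + - s1) (xpure 1 2) = xpure 0 2"
    "pure_conj (- s0 + - s1) (xpure 2 3) = xpure 0 3"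
    "pure_conj (- s0 + - s1) (xpure 1 3) = - xpure 0 2 + (xpure 2 3 + xpure 0 2)"
    by (simp_all add: PB4_simps ca_simps[OF r])
qed

lemma pure_twist_012:
  "commutes (xpure 0 1 + (xpure 0 2 + xpure 1 2)) (xpure 0 1)"
  "commutes (xpure 0 1 + (xpure 0 2 + xpure 1 2)) (xpure 0 2)"
  "commutes (xpure 0 1 + (xpure 0 2 + xpure 1 2)) (xpure 1 2)"
  unfolding PB4_eq_iff plus_PB4.rep_eq Rep_xpure
  by (intro commutes_add commutes_minus twist_012[OF artin_relations])+

lemma pure_twist_023:
  "commutes (xpure 0 2 + (xpure 0 3 + xpure 2 3)) (xpure 0 2)"
  "commutes (xpure 0 2 + (xpure 0 3 + xpure 2 3)) (xpure 0 3)"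
  "commutes (xpure 0 2 + (xpure 0 3 + xpure 2 3)) (xpure 2 3)"
  unfolding PB4_eq_iff plus_PB4.rep_eq Rep_xpure by (rule twist_023[OF artin_relations])+

lemma pure_twist_01_2_3:
  "commutes (xpure 0 1 + (xpure 0 2 + (xpure 0 3 + (xpure 1 3 + xpure 2 3)))) (xpure 0 1 + xpure 0 2)"
  "commutes (xpure 0 1 + (xpure 0 2 + (xpure 0 3 + (xpure 1 3 + xpure 2 3)))) (xpure 1 3 + xpure 2 3)"
  unfolding PB4_eq_iff plus_PB4.rep_eq Rep_xpure by (rule twist_01_2_3[OF artin_relations])+

lemma pure_twist_0_1_23:
  "commutes (xpure 0 1 + (xpure 0 2 + (xpure 0 3 + (xpure 1 2 + xpure 1 3)))) (xpure 0 1)"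
  "commutes (xpure 0 1 + (xpure 0 2 + (xpure 0 3 + (xpure 1 2 + xpure 1 3)))) (xpure 1 2 + xpure 1 3)"
  using twist_0_1_23[OF artin_relations]
  by (simp_all add: PB4_simps)

lemma pure_commutes: "commutes (xpure 0 1) (xpure 2 3)" "commutes (xpure 0 3) (xpure 1 2)"
proof -
  show "commutes (xpure 0 1) (xpure 2 3)"
    by (simp add: PB4_simps ca_simps[OF artin_relations])
  have "Rep_PB4 (xpure 1 2) + Rep_PB4 (xpure 0 3) = Rep_PB4 (xpure 0 3) + Rep_PB4 (xpure 1 2)"
  proof -
    have "commutes s1 (Rep_PB4 (xpure 0 3))"
      using arg_cong[OF conj_y(3)[OF artin_relations], of "\<lambda>x. x + s1"] by (simp add: Rep_xpure add.assoc)
    then show ?thesis unfolding Rep_xpure(4) by (intro commutes_add_left)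
  qed
  then show "commutes (xpure 0 3) (xpure 1 2)" by (simp add: PB4_eq_iff plus_PB4.rep_eq)
qed

declare diff_conv_add_uminus [simp del] add_uminus_conv_diff [simp]

section \<open>The embedding of the completed free group and the conjugation action\<close>

text \<open>A group acting on the set underlying a group \<open>G\<close> by affine maps with unipotent linear part acts
  by filtered linear maps on the completed group algebra; the orbit map of \<open>1\<close> is then continuous.\<close>

lemma filt_cont_orbit:
  fixes a :: "'h::group_add \<Rightarrow> 'g::group_add \<Rightarrow> 'g"
  assumes zero: "\<And>u. a 0 u = u" and add: "\<And>g h u. a (g + h) u = a g (a h u)"
    and hom: "\<And>g x y. - a g 0 + a g (x + y) = (- a g 0 + a g x) + (- a g 0 + a g y)"
    and unip: "\<And>g x. of_grp (- a g 0 + a g x) - of_grp x \<in> (cfilt 2 :: ('g, 'k::field) cga set)"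
  shows "filt_cont (\<lambda>g. of_grp (a g 0) :: ('g, 'k) cga)"
proof -
  let ?\<rho> = "\<lambda>g x. of_grp (- a g 0 + a g x) :: ('g, 'k) cga"
  let ?E = "\<lambda>g. cont_ext (?\<rho> g)"
  have \<rho>: "ghom (?\<rho> g)" for g by (rule ghom_of_grp) (rule hom)
  note E = calg_cont_ext[OF \<rho>]
  note E_of_grp = cont_ext_ghom_of_grp[OF \<rho>]
  define A where "A g y = of_grp (a g 0) * ?E g y" for g y
  have clin: "clin (A g)" for g
    unfolding A_def by (rule clin_mult_left[OF calg_clin[OF E]])
  have A_of_grp: "A g (of_grp x) = of_grp (a g x)" for g x
    by (simp add: A_def E_of_grp flip: of_grp_add)
  have "filt_cont (\<lambda>g. A g 1)"
  proof (rule filt_cont_action[OF clin])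
    show "A 0 y = y" for y
      by (rule clin_eqI[OF clin clin_id]) (simp add: A_of_grp zero)
    show "A (g + h) y = A g (A h y)" for g h y
      by (rule clin_eqI[OF clin clin_comp[OF clin clin]]) (simp add: A_of_grp add)
    fix g n and y :: "('g, 'k) cga"
    assume y: "y \<in> cfilt n"
    have "?E g y - y \<in> cfilt (Suc n)"
      by (rule calg_unipotent[OF E _ y]) (simp only: E_of_grp unip)
    from cfilt_add[OF cfilt_mult_left[OF this] caugm_one_unipotent(1)[OF caugm_of_grp y]]
    have "of_grp (a g 0) * (?E g y - y) + (of_grp (a g 0) * y - y) \<in> cfilt (Suc n)" .
    then show "A g y - y \<in> cfilt (Suc n)" by (simp add: A_def right_diff_distrib)
  qed
  then show ?thesis
    using A_of_grp[of _ 0] by simp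
qed

lemma permuting_hom_unipotent:
  assumes "permuting_hom \<theta> id"
  shows "of_grp (\<theta> x) - of_grp x \<in> (cfilt 2 :: (F3, 'k::field_char_0) cga set)"
proof -
  have "ghom (\<lambda>x. of_grp (\<theta> x) :: (F3, 'k) cga)"
    by (rule ghom_of_grp) (use assms in \<open>simp add: permuting_hom_def\<close>)
  note val = cont_ext_ghom_of_grp[OF this] and T = mhom_cont_ext[OF this of_grp_malcev]
  have "of_grp (\<theta> (gen i)) - of_grp (gen i) \<in> (cfilt 2 :: (F3, 'k) cga set)" for i
  proof -
    obtain d where "\<theta> (gen i) = d + (gen i + - d)"
      using assms unfolding permuting_hom_def id_apply by blast
    then show ?thesis
      using conj_cfilt[OF of_grp_malcev[of d] of_grp_malcev[of "gen i"]]
      by (simp add: of_grp_add minv_of_grp mult.assoc del: add_uminus_conv_diff)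
  qed
  then show ?thesis
    using presgroup_unipotent[OF T, of x] by (simp only: val)
qed

lemma cfilt_of_grp_Pair:
  fixes x x' :: "'g::group_add" and y y' :: "'h::group_add"
  assumes "of_grp x' - of_grp x \<in> (cfilt n :: ('g, 'k::field) cga set)"
    and "of_grp y' - of_grp y \<in> (cfilt n :: ('h, 'k) cga set)"
  shows "of_grp (x', y') - of_grp (x, y) \<in> (cfilt n :: ('g \<times> 'h, 'k) cga set)"
proof -
  have "in1 (of_grp x' - of_grp x) * in2 (of_grp y') + in1 (of_grp x) * in2 (of_grp y' - of_grp y)
      \<in> (cfilt n :: ('g \<times> 'h, 'k) cga set)"
    by (intro cfilt_add cfilt_mult_left cfilt_mult_right assms
        clin_cfilt[OF calg_clin[OF calg_in1]] clin_cfilt[OF calg_clin[OF calg_in2]])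
  also have "in1 (of_grp x' - of_grp x) * in2 (of_grp y') + in1 (of_grp x) * in2 (of_grp y' - of_grp y)
      = of_grp (x', y') - (of_grp (x, y) :: ('g \<times> 'h, 'k) cga)"
    unfolding clin_diff[OF calg_clin[OF calg_in1]] clin_diff[OF calg_clin[OF calg_in2]]
      in1_of_grp in2_of_grp left_diff_distrib right_diff_distrib of_grp_add[symmetric] by simp
  finally show ?thesis .
qed

section \<open>Retraction onto the completed free group\<close>

lemma ghom_iota: "ghom (\<lambda>v. of_grp (iota v))"
  by (rule ghom_of_grp) simp

lemma F3_to_PB4_eq: "F3_to_PB4 = cont_ext (\<lambda>v. of_grp (iota v))"
proof
  fix x :: "(F3, 'k::field_char_0) cga"
  show "F3_to_PB4 x = cont_ext (\<lambda>v. of_grp (iota v)) x"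
    unfolding F3_to_PB4_def
  proof (rule presgroup_mhom_eqI[OF mhom_malcev_subst3 mhom_cont_ext[OF ghom_iota]])
    fix a show "malcev_subst (case_gen3 (cx 0 1) (cx 0 2) (cx 0 3)) (of_grp (gen a))
        = cont_ext (\<lambda>v. of_grp (iota v)) (of_grp (gen a))"
      by (cases a) (simp_all add: malcev_subst3_gen cont_ext_ghom_of_grp[OF ghom_iota] iota_gen)
  qed simp_all
qed

lemma F3_to_PB4_of_grp: "F3_to_PB4 (of_grp v) = of_grp (iota v)"
  unfolding F3_to_PB4_eq by (rule cont_ext_ghom_of_grp[OF ghom_iota])

lemma mhom_F3_to_PB4: "mhom F3_to_PB4"
  unfolding F3_to_PB4_eq by (rule mhom_cont_ext[OF ghom_iota of_grp_malcev])

lemmas calg_F3_to_PB4 = mhom_calg[OF mhom_F3_to_PB4]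

lemma pure_aut_add: "pure_aut g (x + y) = pure_aut g x + pure_aut g y"
  using permuting_hom_pure_aut[of g] unfolding permuting_hom_def by blast

lemma filt_cont_retract: "filt_cont (\<lambda>g. of_grp (pure_act g 0) :: (F3, 'k::field_char_0) cga)"
  by (rule filt_cont_orbit)
    (rule pure_act_zero pure_act_add pure_aut_add permuting_hom_unipotent permuting_hom_pure_aut)+

text \<open>\<open>pure_act g 0\<close> is the free component of \<open>g\<close> and is not
  multiplicative in \<open>g\<close>, so this is a linear map and not an algebra
  homomorphism.\<close>

definition F3_retract :: "(PB4, 'k::field_char_0) cga \<Rightarrow> (F3, 'k) cga" where
  "F3_retract = cont_ext (\<lambda>g. of_grp (pure_act g 0))"

lemma clin_F3_retract: "clin F3_retract"
  unfolding F3_retract_def by (rule clin_cont_ext[OF filt_cont_retract])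

lemma F3_retract_of_grp: "F3_retract (of_grp g) = of_grp (pure_act g 0)"
  unfolding F3_retract_def by (rule cont_ext_of_grp[OF filt_cont_retract])

lemma F3_retract_F3_to_PB4: "F3_retract (F3_to_PB4 x) = x"
  by (rule clin_eqI[OF clin_comp[OF clin_F3_retract calg_clin[OF calg_F3_to_PB4]] clin_id])
    (simp add: F3_to_PB4_of_grp F3_retract_of_grp pure_act_iota)

lemma F3_to_PB4_inject: "F3_to_PB4 x = F3_to_PB4 y \<longleftrightarrow> x = y"
  by (metis F3_retract_F3_to_PB4)

text \<open>Coproducts live on the product group, so the retraction is built again there:
  \<open>PB4 \<times> PB4\<close> acts on \<open>F3 \<times> F3\<close> componentwise, again
  affinely with unipotent linear part.\<close>

lemma inj_tensor_square_F3_to_PB4: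
  "inj (tensor_square (F3_to_PB4 :: (F3, 'k::field_char_0) cga \<Rightarrow> _))"
proof -
  let ?a = "\<lambda>p q. (pure_act (fst p) (fst q), pure_act (snd p) (snd q))"
  have f: "filt_cont (\<lambda>p. of_grp (?a p 0) :: (F3 \<times> F3, 'k) cga)"
  proof (rule filt_cont_orbit)
    fix p p' :: "PB4 \<times> PB4" and q r :: "F3 \<times> F3"
    show "?a 0 q = q" by (simp add: pure_act_zero)
    show "?a (p + p') r = ?a p (?a p' r)" by (simp add: pure_act_add)
    show "- ?a p 0 + ?a p (q + r) = (- ?a p 0 + ?a p q) + (- ?a p 0 + ?a p r)"
      using pure_aut_add[of "fst p" "fst q" "fst r"] pure_aut_add[of "snd p" "snd q" "snd r"]
      by (simp add: prod_eq_iff)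
    have "- ?a p 0 + ?a p q = (pure_aut (fst p) (fst q), pure_aut (snd p) (snd q))"
      by (simp add: prod_eq_iff)
    then show "of_grp (- ?a p 0 + ?a p q) - of_grp q \<in> (cfilt 2 :: (F3 \<times> F3, 'k) cga set)"
      using cfilt_of_grp_Pair[OF permuting_hom_unipotent[OF permuting_hom_pure_aut, of "fst p" "fst q"]
          permuting_hom_unipotent[OF permuting_hom_pure_aut, of "snd p" "snd q"]] by simp
  qed
  let ?r = "cont_ext (\<lambda>p. of_grp (?a p 0) :: (F3 \<times> F3, 'k) cga)"
  have "tensor_square F3_to_PB4 (of_grp p) = (of_grp (iota (fst p), iota (snd p)) :: (PB4 \<times> PB4, 'k) cga)" for p
    by (cases p) (simp add: tensor_square_of_grp[OF calg_F3_to_PB4] F3_to_PB4_of_grp ctensor_of_grp)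
  then have "?r (tensor_square F3_to_PB4 (of_grp p)) = of_grp p" for p
    by (simp only: cont_ext_of_grp[OF f]) (simp add: pure_act_iota)
  from clin_eqI[OF clin_comp[OF clin_cont_ext[OF f] calg_clin[OF calg_tensor_square[OF calg_F3_to_PB4]]] clin_id this]
  have "?r (tensor_square F3_to_PB4 x) = x" for x .
  then show ?thesis by (rule inj_on_inverseI)
qed

lemma F3_to_PB4_reflects_grouplike: "F3_to_PB4 x \<in> carrier malcev \<Longrightarrow> x \<in> carrier malcev"
  by (rule mhom_reflects_grouplike[OF mhom_F3_to_PB4 inj_tensor_square_F3_to_PB4])

text \<open>For a group-like element \<open>a\<close> the continuous linear extension of \<open>g \<mapsto> g y g\<^sup>-\<^sup>1\<close> takes
  the value \<open>a y a\<^sup>-\<^sup>1\<close>, as it factors through the coproduct.\<close>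

definition two_sided :: "('g::group_add, 'k::field) cga \<Rightarrow> ('g \<times> 'g, 'k) cga \<Rightarrow> ('g, 'k) cga" where
  "two_sided y = cont_ext (\<lambda>p. of_grp (fst p) * y * of_grp (- snd p))"

lemma filt_cont_two_sided:
  fixes y :: "('g::group_add, 'k::field) cga"
  shows "filt_cont (\<lambda>p. of_grp (fst p) * y * of_grp (- snd p))"
proof (rule filt_cont_action)
  fix p q :: "'g \<times> 'g" and n and z :: "('g, 'k) cga"
  show "clin (\<lambda>y. of_grp (fst p) * y * of_grp (- snd p))"
    by (intro clin_mult_right clin_mult_left clin_id)
  show "of_grp (fst 0) * z * of_grp (- snd 0) = z" by simp
  show "of_grp (fst (p + q)) * z * of_grp (- snd (p + q))
      = of_grp (fst p) * (of_grp (fst q) * z * of_grp (- snd q)) * of_grp (- snd p)"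
    by (simp add: of_grp_add minus_add mult.assoc del: add_uminus_conv_diff)
  assume z: "z \<in> cfilt n"
  have "(of_grp (fst p) * z - z) * of_grp (- snd p) + (z * of_grp (- snd p) - z) \<in> cfilt (Suc n)"
    by (intro cfilt_add cfilt_mult_right caugm_one_unipotent z caugm_of_grp)
  then show "of_grp (fst p) * z * of_grp (- snd p) - z \<in> cfilt (Suc n)"
    by (simp add: left_diff_distrib)
qed

lemma clin_two_sided: "clin (two_sided y)"
  unfolding two_sided_def by (rule clin_cont_ext[OF filt_cont_two_sided])

lemma two_sided_of_grp: "two_sided y (of_grp (g, h)) = of_grp g * y * of_grp (- h)"
  unfolding two_sided_def by (simp add: cont_ext_of_grp[OF filt_cont_two_sided])

text \<open>\<open>two_sided 1 (in2 b)\<close> is the antipode of \<open>b\<close>: on group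
  elements it is inversion.\<close>

lemma two_sided_ctensor: "two_sided y (ctensor a b) = a * y * two_sided 1 (in2 b)"
proof -
  have 1: "two_sided y (in1 a * in2 (of_grp h)) = a * y * of_grp (- h)" for h
    by (rule clin_eqI[OF clin_comp[OF clin_two_sided clin_mult_right[OF calg_clin[OF calg_in1]]]
          clin_mult_right[OF clin_mult_right[OF clin_id]]])
      (simp only: of_grp_Pair[of _ h, symmetric] two_sided_of_grp)
  have 2: "two_sided 1 (in2 (of_grp h)) = of_grp (- h)" for h
    by (simp add: in2_of_grp two_sided_of_grp)
  have "two_sided y (in1 a * in2 b) = (a * y) * two_sided 1 (in2 b)"
    by (rule clin_eqI[OF clin_comp[OF clin_two_sided clin_mult_left[OF calg_clin[OF calg_in2]]]
          clin_mult_left[OF clin_comp[OF clin_two_sided calg_clin[OF calg_in2]]]])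
      (simp only: 1 2)
  then show ?thesis by (simp add: ctensor_def)
qed

lemma clin_caugm: "clin (\<lambda>x. scal (caugm x))"
  unfolding clin_def
proof (intro conjI allI impI)
  fix n and x :: "('g::group_add, 'k::field) cga"
  assume x: "x \<in> cfilt n"
  show "scal (caugm x) \<in> cfilt n"
  proof (cases n)
    case (Suc m)
    then have "x \<in> cfilt (Suc 0)" using x cfilt_antimono[of "Suc 0" n x] by simp
    then show ?thesis by (simp add: cfilt_one_iff)
  qed simp
qed (simp_all add: caugm_add caugm_mult scal_add scal_mult)

lemma two_sided_coproduct:
  assumes a: "a \<in> carrier malcev"
  shows "two_sided y (coproduct a) = a * y * minv a"
proof -
  \<comment> \<open>The antipode identity: group elements give \<open>1\<close>, hence the
    augmentation appears in general. For group-like \<open>a\<close> it identifies the antipode with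
    the inverse.\<close>
  have "two_sided 1 (coproduct a) = scal (caugm a)"
    by (rule clin_eqI[OF clin_comp[OF clin_two_sided calg_clin[OF calg_coproduct]] clin_caugm])
      (simp add: coproduct_of_grp two_sided_of_grp)
  then have "a * two_sided 1 (in2 a) = 1"
    using a two_sided_ctensor[of 1 a a] by (simp add: malcev_carrier)
  from minv_unique[OF a this] show ?thesis
    using a two_sided_ctensor[of y a a] by (simp add: malcev_carrier)
qed

text \<open>Both sides are linear and continuous in \<open>u\<close> and, through
  \<open>two_sided\<close>, extend so in \<open>a\<close>. This reduces the claim to conjugating a
  word of the free subgroup by a pure braid.\<close>

lemma F3_to_PB4_normal:
  fixes a :: "(PB4, 'k::field_char_0) cga"
  assumes "a \<in> carrier malcev"
  shows "F3_to_PB4 (F3_retract (a * F3_to_PB4 u * minv a)) = a * F3_to_PB4 u * minv a"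
proof -
  let ?p = "\<lambda>x :: (PB4, 'k) cga. F3_to_PB4 (F3_retract x)"
  note p = clin_comp[OF calg_clin[OF calg_F3_to_PB4] clin_F3_retract]
  have "?p (of_grp g * F3_to_PB4 (of_grp w) * of_grp (- g)) = of_grp g * F3_to_PB4 (of_grp w) * of_grp (- g)" for g w
  proof -
    obtain v where v: "g + (iota w + - g) = iota v" using iota_normal by blast
    have "of_grp g * F3_to_PB4 (of_grp w) * of_grp (- g) = (F3_to_PB4 (of_grp v) :: (PB4, 'k) cga)"
      by (simp only: F3_to_PB4_of_grp add.assoc v of_grp_add[symmetric])
    then show ?thesis by (simp add: F3_retract_F3_to_PB4)
  qed
  note 1 = this
  have 2: "?p (of_grp g * F3_to_PB4 u * of_grp (- g)) = of_grp g * F3_to_PB4 u * of_grp (- g)" for g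
  proof -
    have c: "clin (\<lambda>u. of_grp g * F3_to_PB4 u * of_grp (- g))"
      by (rule clin_mult_right[OF clin_mult_left[OF calg_clin[OF calg_F3_to_PB4]]])
    show ?thesis by (rule clin_eqI[OF clin_comp[OF p c] c 1])
  qed
  have c: "clin (\<lambda>x. two_sided (F3_to_PB4 u) (coproduct x))"
    by (rule clin_comp[OF clin_two_sided calg_clin[OF calg_coproduct]])
  have "?p (two_sided (F3_to_PB4 u) (coproduct a)) = two_sided (F3_to_PB4 u) (coproduct a)"
    by (rule clin_eqI[OF clin_comp[OF p c] c]) (simp only: coproduct_of_grp two_sided_of_grp 2)
  then show ?thesis by (simp only: two_sided_coproduct[OF assms])
qed

text \<open>Replaces the inverse image in \<open>Ad\<close> by a usable equation: the conjugated
  element has a preimage by normality, and that preimage is group-like.\<close>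

lemma Ad_spec:
  assumes a: "a \<in> carrier malcev" and u: "u \<in> carrier malcev"
  shows "Ad a u \<in> carrier malcev" "F3_to_PB4 (Ad a u) = a * F3_to_PB4 u * minv a"
proof -
  let ?v = "F3_retract (a * F3_to_PB4 u * minv a)"
  have v: "F3_to_PB4 ?v = a * F3_to_PB4 u * minv a" by (rule F3_to_PB4_normal[OF a])
  have "a * F3_to_PB4 u * minv a \<in> carrier malcev"
    using a mhom_closed[OF mhom_F3_to_PB4 u] by (simp add: malcev_mult_closed)
  then have mem: "?v \<in> carrier malcev" by (intro F3_to_PB4_reflects_grouplike) (simp only: v)
  have "Ad a u = the_inv_into (carrier malcev) F3_to_PB4 (F3_to_PB4 ?v)"
    using u by (simp add: Ad_def conj_by_eq v)
  also have "\<dots> = ?v"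
    using mem by (intro the_inv_into_f_f inj_onI) (simp_all add: F3_to_PB4_inject)
  finally show "Ad a u \<in> carrier malcev" "F3_to_PB4 (Ad a u) = a * F3_to_PB4 u * minv a"
    using mem v by simp_all
qed

lemma Ad_auto:
  assumes a: "a \<in> carrier malcev"
  shows "Ad a \<in> carrier (AutoGroup malcev)"
proof -
  have inv: "Ad a (Ad (minv a) u) = u" "Ad (minv a) (Ad a u) = u" if u: "u \<in> carrier malcev" for u
  proof -
    note i = malcev.inv_closed[OF a]
    have "F3_to_PB4 (Ad a (Ad (minv a) u)) = (a * minv a) * F3_to_PB4 u * (a * minv a)"
      by (simp only: Ad_spec(2)[OF a Ad_spec(1)[OF i u]] Ad_spec(2)[OF i u] malcev.inv_inv[OF a] mult.assoc)
    then show "Ad a (Ad (minv a) u) = u" using a by (simp add: F3_to_PB4_inject)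
    have "F3_to_PB4 (Ad (minv a) (Ad a u)) = (minv a * a) * F3_to_PB4 u * (minv a * a)"
      by (simp only: Ad_spec(2)[OF i Ad_spec(1)[OF a u]] Ad_spec(2)[OF a u] malcev.inv_inv[OF a] mult.assoc)
    then show "Ad (minv a) (Ad a u) = u" using a by (simp add: F3_to_PB4_inject)
  qed
  have "bij_betw (Ad a) (carrier malcev) (carrier malcev)"
    by (rule bij_betwI[where g = "Ad (minv a)"]) (use inv Ad_spec(1)[OF a] Ad_spec(1)[OF malcev.inv_closed[OF a]] in auto)
  moreover have "Ad a (x * y) = Ad a x * Ad a y" if "x \<in> carrier malcev" "y \<in> carrier malcev" for x y
  proof -
    have "F3_to_PB4 (Ad a (x * y)) = F3_to_PB4 (Ad a x * Ad a y)"
      using that a by (simp add: Ad_spec(2) mhom_mult[OF mhom_F3_to_PB4] malcev_mult_closed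
          mhom_mult[OF mhom_conj[OF a]])
    then show ?thesis by (simp only: F3_to_PB4_inject)
  qed
  moreover have "Ad a \<in> extensional (carrier malcev)" by (simp add: Ad_def)
  ultimately show ?thesis
    using Ad_spec(1)[OF a] by (auto simp: AutoGroup_def auto_def Bij_def hom_def)
qed

section \<open>Consequences of the defining relations of \<open>GT\<^sub>1\<close>\<close>

lemma minv_cancel [simp]:
  "x \<in> carrier malcev \<Longrightarrow> minv x * (x * y) = y" "x \<in> carrier malcev \<Longrightarrow> x * (minv x * y) = y"
  by (simp_all flip: mult.assoc)

lemma minv_mult: "x \<in> carrier malcev \<Longrightarrow> y \<in> carrier malcev \<Longrightarrow> minv (x * y) = minv y * minv x"
  by (rule minv_unique) (simp_all add: malcev_mult_closed mult.assoc)

lemma malcev_idem: "x \<in> carrier malcev \<Longrightarrow> x * x = x \<Longrightarrow> x = 1"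
  using minv_cancel(1)[of x x] by simp

lemma conj_mult:
  "w \<in> carrier malcev \<Longrightarrow> w' \<in> carrier malcev \<Longrightarrow>
    w * (w' * z * minv w') * minv w = (w * w') * z * minv (w * w')"
  by (simp add: minv_mult mult.assoc)

lemma conj_mult_commuting:
  assumes "w \<in> carrier malcev" "b \<in> carrier malcev" "b * z = z * b"
  shows "(w * b) * z * minv (w * b) = w * z * minv w"
proof -
  have "(w * b) * z * minv (w * b) = w * (b * z * minv b) * minv w"
    by (simp only: conj_mult[OF assms(1,2)])
  also have "b * z * minv b = z" by (rule conj_fixes_iff[OF assms(2), THEN iffD2, OF assms(3)])
  finally show ?thesis .
qed

lemma mhom_conj_subst2:
  assumes T: "mhom T" and w: "w \<in> carrier malcev" and g: "g \<in> carrier malcev" "h \<in> carrier malcev"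
    and "T g = conj_by w g'" "T h = conj_by w h'" "g' \<in> carrier malcev" "h' \<in> carrier malcev"
  shows "T (subst2 e g h) = conj_by w (subst2 e g' h')"
  using mhom_subst2_eq[OF T g] mhom_subst2_eq[OF mhom_conj[OF w], of g' h'] assms(5-8)
  by (simp add: conj_by_eq)

lemma mhom_conj_by:
  "mhom T \<Longrightarrow> w \<in> carrier malcev \<Longrightarrow> T (conj_by w z) = conj_by (T w) (T z)"
  by (simp add: conj_by_eq mhom_mult mhom_minv)

abbreviation (input) x01 :: PB4 where "x01 \<equiv> xpure 0 1"
abbreviation (input) x02 :: PB4 where "x02 \<equiv> xpure 0 2"
abbreviation (input) x03 :: PB4 where "x03 \<equiv> xpure 0 3"
abbreviation (input) x12 :: PB4 where "x12 \<equiv> xpure 1 2"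
abbreviation (input) x13 :: PB4 where "x13 \<equiv> xpure 1 3"
abbreviation (input) x23 :: PB4 where "x23 \<equiv> xpure 2 3"

context
  fixes f :: "(F2, 'k::field_char_0) cga"
  assumes GT1: "f \<in> GT1"
begin

lemma f_malcev: "f \<in> carrier malcev"
  using GT1 by (simp add: GT1_def)

abbreviation (input) F :: "'g::group_add \<Rightarrow> 'g \<Rightarrow> ('g, 'k) cga" where
  "F a b \<equiv> subst2 f (of_grp a) (of_grp b)"

lemma F_malcev: "F a b \<in> carrier malcev"
  by (simp add: f_malcev)

lemma subst2_swap:
  assumes "g \<in> carrier malcev" "h \<in> carrier malcev"
  shows "subst2 f h g = minv (subst2 f g h)"
proof -
  note T = mhom_subst2[OF assms]
  have "subst2 (subst2 f cY cX) g h = subst2 (minv f) g h" using GT1 by (simp add: GT1_def)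
  then show ?thesis
    using mhom_subst2_eq[OF T, of cY cX f] mhom_minv[OF T f_malcev] assms by simp
qed

lemma F_swap: "F b a = minv (F a b)"
  by (rule subst2_swap) simp_all

lemma pentagon:
  "F x12 x23 * F (x01 + x02) (x13 + x23) * F x01 x12 = F x01 (x12 + x13) * F (x02 + x12) x23"
  using GT1 by (simp add: GT1_def of_grp_add One_nat_def)

text \<open>The value is idempotent, since \<open>f\<close> is group-like and \<open>1\<close>
  commutes with everything.\<close>

lemma subst2_one_one: "subst2 f 1 1 = 1"
  using subst2_mult_commuting[OF f_malcev, of 1 1 1 1]
  by (intro malcev_idem) (simp_all add: f_malcev)

text \<open>The image of the pentagon under \<open>x\<^sub>0\<^sub>1 \<mapsto> c\<close> and \<open>x\<^sub>i\<^sub>j \<mapsto> 1\<close> otherwise.\<close>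

lemma subst2_one_right:
  assumes c: "c \<in> carrier malcev"
  shows "subst2 f c 1 = 1"
proof -
  define \<rho> where "\<rho> g = c [^]\<^bsub>malcev\<^esub> winding g" for g
  have closed: "\<rho> g \<in> carrier malcev" for g
    unfolding \<rho>_def by (rule malcev.int_pow_closed[OF c])
  have "\<rho> (g + h) = \<rho> g * \<rho> h" for g h
    unfolding \<rho>_def winding_add by (rule malcev.int_pow_mult[OF c])
  moreover have "\<rho> 0 = 1"
    using winding_add[of 0 0] by (simp add: \<rho>_def)
  ultimately have \<rho>: "ghom \<rho>"
    using closed by (simp add: ghom_def malcev_carrier)
  let ?T = "cont_ext \<rho>"
  note T = mhom_cont_ext[OF \<rho> closed]
  have val: "?T (of_grp g) = \<rho> g" for g by (rule cont_ext_ghom_of_grp[OF \<rho>])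
  have TF: "?T (F a b) = subst2 f (\<rho> a) (\<rho> b)" for a b
    using mhom_subst2_eq[OF T of_grp_malcev of_grp_malcev] by (simp only: val)
  have w: "\<rho> g = (if winding g = 1 then c else 1)" if "winding g = 0 \<or> winding g = 1" for g
    using that c by (auto simp: \<rho>_def malcev.int_pow_1)
  have "?T (F x12 x23) * ?T (F (x01 + x02) (x13 + x23)) * ?T (F x01 x12)
      = ?T (F x01 (x12 + x13)) * ?T (F (x02 + x12) x23)"
    using arg_cong[OF pentagon, of ?T] by (simp only: mhom_mult[OF T])
  \<comment> \<open>Two factors on the left and one on the right become \<open>f(c, 1)\<close>; the
    others become \<open>f(1, 1) = 1\<close>.\<close>
  then have "subst2 f c 1 * subst2 f c 1 = subst2 f c 1"
    unfolding TF by (simp add: w winding_add winding_xpure subst2_one_one)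
  then show ?thesis by (intro malcev_idem) (simp_all add: c f_malcev)
qed

lemma subst2_one_left: "c \<in> carrier malcev \<Longrightarrow> subst2 f 1 c = 1"
  using subst2_swap[of c 1] by (simp add: subst2_one_right)

text \<open>Splitting off the commuting factor leaves \<open>f(1, c)\<close>, which is
  trivial.\<close>

lemma subst2_central_right:
  assumes "g \<in> carrier malcev" "h \<in> carrier malcev" "c \<in> carrier malcev" "c * g = g * c" "c * h = h * c"
  shows "subst2 f g (h * c) = subst2 f g h"
  using subst2_mult_commuting[OF f_malcev, of g h 1 c] assms by (simp add: subst2_one_left)

lemma subst2_central_left:
  assumes "g \<in> carrier malcev" "h \<in> carrier malcev" "c \<in> carrier malcev" "c * g = g * c" "c * h = h * c"
  shows "subst2 f (g * c) h = subst2 f g h"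
  using subst2_mult_commuting[OF f_malcev, of g h c 1] assms by (simp add: subst2_one_right)

lemma F_commute:
  assumes "commutes c a" "commutes c b"
  shows "F a b * of_grp c = of_grp c * F a b"
  by (rule subst2_commute[symmetric]) (simp_all add: assms flip: of_grp_add)

lemma subst2_alphaP:
  "g \<in> carrier malcev \<Longrightarrow> h \<in> carrier malcev \<Longrightarrow>
    subst2 (alphaP f) g h = subst2 f g (minv h * minv g)"
  unfolding alphaP_def
  by (simp add: mhom_subst2_eq[OF mhom_subst2] malcev_mult_closed mhom_mult[OF mhom_subst2] mhom_minv[OF mhom_subst2])

lemma subst2_alphaQ:
  "g \<in> carrier malcev \<Longrightarrow> h \<in> carrier malcev \<Longrightarrow>
    subst2 (alphaQ f) g h = subst2 f h (minv h * minv g)"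
  unfolding alphaQ_def
  by (simp add: mhom_subst2_eq[OF mhom_subst2] malcev_mult_closed mhom_mult[OF mhom_subst2] mhom_minv[OF mhom_subst2])

text \<open>If \<open>g + h + z\<close> is central in the group generated by \<open>g, h, z\<close>, it may be ignored in all
  arguments of \<open>f\<close>, so that \<open>z\<close> can replace \<open>h\<^sup>-\<^sup>1 g\<^sup>-\<^sup>1\<close>.\<close>

definition central_triple :: "'g::group_add \<Rightarrow> 'g \<Rightarrow> 'g \<Rightarrow> bool" where
  "central_triple g h z \<longleftrightarrow> commutes (g + (h + z)) g \<and> commutes (g + (h + z)) z"

lemma central_triple_rotate:
  assumes "central_triple g h z"
  shows "central_triple h z g" "commutes (g + (h + z)) h"
proof -
  let ?t = "g + (h + z)"
  have t: "commutes ?t g" "commutes ?t z" using assms by (simp_all add: central_triple_def)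
  \<comment> \<open>A sum that commutes with its first summand equals its cyclic rotation.\<close>
  have "g + ?t = g + (h + (z + g))" using t(1) by (simp add: add.assoc)
  then have eq: "h + (z + g) = ?t" by simp
  have *: "- g + (?t + - z) = h" by (simp add: add.assoc del: add_uminus_conv_diff)
  have "commutes ?t (- g + (?t + - z))"
    by (rule commutes_add[OF commutes_minus[OF t(1)] commutes_add[OF HOL.refl commutes_minus[OF t(2)]]])
  then show h: "commutes ?t h" unfolding * .
  show "central_triple h z g" unfolding central_triple_def eq using t(1) h by simp
qed

lemma central_triple_subst2:
  fixes g h z :: "'g::group_add"
  assumes "central_triple g h z"
  defines "u \<equiv> (minv (of_grp h) * minv (of_grp g) :: ('g, 'k) cga)"
  shows "subst2 f (of_grp g) u = F g z" "subst2 f (of_grp h) u = F h z" "subst2 f u (of_grp g) = F z g"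
proof -
  let ?t = "g + (h + z)"
  have c: "commutes ?t g" "commutes ?t z" "commutes ?t h"
    using assms(1) central_triple_rotate(2)[OF assms(1)] by (simp_all add: central_triple_def)
  have z: "z = (- h + - g) + ?t" by (simp add: add.assoc del: add_uminus_conv_diff)
  have u: "u = of_grp (- h + - g)" by (simp only: u_def minv_of_grp of_grp_add)
  have "commutes ?t (- h + - g)" using c by (intro commutes_add commutes_minus)
  then have comm: "of_grp ?t * of_grp x = of_grp x * (of_grp ?t :: ('g, 'k) cga)" if "x = g \<or> x = h \<or> x = - h + - g" for x
    using that c by (auto simp flip: of_grp_add simp del: add_uminus_conv_diff)
  have F: "F x z = subst2 f (of_grp x) (of_grp (- h + - g) * of_grp ?t)"
    "F z x = subst2 f (of_grp (- h + - g) * of_grp ?t) (of_grp x)" for x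
    by (subst z, simp only: of_grp_add)+
  show "subst2 f (of_grp g) u = F g z" "subst2 f (of_grp h) u = F h z" "subst2 f u (of_grp g) = F z g"
    unfolding F u
    by (rule subst2_central_right[symmetric] subst2_central_left[symmetric]; simp add: comm del: add_uminus_conv_diff)+
qed

text \<open>The expression \<open>Y^-1 X^-1\<close> of the defining hexagon is traded for
  \<open>z\<close>, after which the three entries play cyclically symmetric roles.\<close>

lemma hexagon:
  assumes "central_triple g h z"
  shows "F g h * F z g * F h z = 1"
proof -
  note T = mhom_subst2[of "of_grp g :: (_, 'k) cga" "of_grp h", OF of_grp_malcev of_grp_malcev]
  have "f * subst2 f (minv cY * minv cX) cX * subst2 f cY (minv cY * minv cX) = 1"
    using GT1 by (simp add: GT1_def)
  from arg_cong[OF this, of "\<lambda>x. subst2 x (of_grp g) (of_grp h)"]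
  show ?thesis
    by (simp add: mhom_mult[OF T] mhom_one[OF T] mhom_minv[OF T] mhom_subst2_eq[OF T] malcev_mult_closed
        central_triple_subst2[OF assms])
qed

lemma pentagon_conj:
  "F (pure_conj b x12) (pure_conj b x23)
      * F (pure_conj b x01 + pure_conj b x02) (pure_conj b x13 + pure_conj b x23)
      * F (pure_conj b x01) (pure_conj b x12)
    = F (pure_conj b x01) (pure_conj b x12 + pure_conj b x13) * F (pure_conj b x02 + pure_conj b x12) (pure_conj b x23)"
proof -
  have \<rho>: "ghom (\<lambda>g. of_grp (pure_conj b g) :: (PB4, 'k) cga)"
    by (rule ghom_of_grp) (rule pure_conj_add)
  note T = mhom_cont_ext[OF \<rho> of_grp_malcev]
  have TF: "cont_ext (\<lambda>g. of_grp (pure_conj b g)) (F x y) = F (pure_conj b x) (pure_conj b y)" for x y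
    using mhom_subst2_eq[OF T of_grp_malcev of_grp_malcev] by (simp only: cont_ext_ghom_of_grp[OF \<rho>])
  from arg_cong[OF pentagon, of "cont_ext (\<lambda>g. of_grp (pure_conj b g))"]
  show ?thesis by (simp only: mhom_mult[OF T] TF pure_conj_add)
qed

text \<open>The pentagon for the strand order 1, 0, 2, 3. Centrality of the full twist on 0, 1, 2
  absorbs the conjugation left by \<open>pure_conj_s0\<close>.\<close>

lemma pentagon_102:
  "F x02 x23 * F (x12 + x01) (x03 + x23) * F x01 x02 = F x01 (x02 + x03) * F (x02 + x12) x23"
proof -
  have "x01 + (- x01 + (x12 + x01)) = x12 + x01" by simp
  moreover have "(- x01 + (x12 + x01)) + x02 = x02 + x12"
  proof -
    have "(x01 + (x02 + x12)) + x01 = x01 + (x01 + (x02 + x12))" by (rule pure_twist_012(1))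
    then have "x02 + (x12 + x01) = x01 + (x02 + x12)" by (simp add: add.assoc)
    moreover have "(x01 + (x02 + x12)) + x02 = x02 + (x01 + (x02 + x12))" by (rule pure_twist_012(2))
    ultimately have "x02 + (x12 + (x01 + x02)) = x02 + (x01 + (x02 + x12))"
      by (metis add.assoc)
    then show ?thesis by (simp add: add.assoc)
  qed
  ultimately show ?thesis
    using pentagon_conj[of "- gen S0"] by (simp only: pure_conj_s0)
qed

text \<open>The strand order is 1, 2, 0, 3, and the full twist on 0, 2, 3 absorbs the
  conjugation.\<close>

lemma pentagon_120:
  "F x02 x03 * F (x12 + x01) (x03 + x23) * F x12 x02 = F x12 (x23 + x02) * F (x01 + x02) x03"
proof -
  have "x02 + (- x02 + (x23 + x02)) = x23 + x02" by simp
  moreover have "(- x02 + (x23 + x02)) + x03 = x03 + x23"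
  proof -
    have "(x02 + (x03 + x23)) + x02 = x02 + (x02 + (x03 + x23))" by (rule pure_twist_023(1))
    then have "x03 + (x23 + x02) = x02 + (x03 + x23)" by (simp add: add.assoc)
    moreover have "(x02 + (x03 + x23)) + x03 = x03 + (x02 + (x03 + x23))" by (rule pure_twist_023(2))
    ultimately have "x03 + (x23 + (x02 + x03)) = x03 + (x02 + (x03 + x23))"
      by (metis add.assoc)
    then show ?thesis by (simp add: add.assoc)
  qed
  ultimately show ?thesis
    using pentagon_conj[of "- gen S0 + - gen S1"] by (simp only: pure_conj_s0_s1)
qed

text \<open>The last two treat the strands 1, 2 respectively 2, 3 as one ribbon, matching the
  superscripts with a tilde.\<close>

lemma central_triples:
  "central_triple x01 x02 x12" "central_triple x02 x03 x23"
  "central_triple (x01 + x02) x03 (x13 + x23)" "central_triple x01 (x02 + x03) (x12 + x13)"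
  using pure_twist_012 pure_twist_023 pure_twist_01_2_3 pure_twist_0_1_23
  by (simp_all add: central_triple_def add.assoc)

text \<open>Counterparts of the pentagon for the second and third generator: the left sides are the
  conjugators of the left composite, and the last factor on the right centralizes \<open>x02\<close>
  respectively \<open>x03\<close>.\<close>

lemma transfer_equations:
  "F x12 x23 * F (x01 + x02) (x13 + x23) * F x02 x12
    = F (x02 + x03) (x12 + x13) * F x02 x23 * F (x12 + x01) (x03 + x23)" (is ?eq2)
  "F x12 x23 * F x03 (x13 + x23)
    = F (x02 + x03) (x12 + x13) * F x03 x23 * F x12 (x23 + x02)" (is ?eq3)
proof -
  define A R B C C' p q s r u v w y P Q S where
    defs: "A = F x12 x23" "R = F (x01 + x02) (x13 + x23)" "B = F (x02 + x12) x23"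
      "C = F (x12 + x01) (x03 + x23)" "C' = F x12 (x23 + x02)" "p = F x01 x12" "q = F x02 x12"
      "s = F x01 x02" "r = F x01 (x02 + x03)" "u = F x02 x23" "v = F x03 x23" "w = F x02 x03"
      "y = F (x01 + x02) x03" "P = F x01 (x12 + x13)" "Q = F (x02 + x03) (x12 + x13)"
      "S = F x03 (x13 + x23)"
  have [simp]: "A \<in> carrier malcev" "R \<in> carrier malcev" "B \<in> carrier malcev" "C \<in> carrier malcev"
    "C' \<in> carrier malcev" "p \<in> carrier malcev" "q \<in> carrier malcev" "s \<in> carrier malcev"
    "r \<in> carrier malcev" "u \<in> carrier malcev" "v \<in> carrier malcev" "w \<in> carrier malcev"
    "y \<in> carrier malcev" "P \<in> carrier malcev" "Q \<in> carrier malcev" "S \<in> carrier malcev"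
    unfolding defs by (rule F_malcev)+
  have pent: "A * R * p = P * B" "u * C * s = r * B" "w * C * minv q = C' * y"
    unfolding defs by (rule pentagon, rule pentagon_102) (simp only: pentagon_120 flip: F_swap)
  \<comment> \<open>One hexagon for each central triple, rotated so that its factors occur in the
    order needed for the eliminations.\<close>
  have hex: "minv p * q * s = 1" "minv P * Q * r = 1" "minv R * S * y = 1" "minv u * v * w = 1"
    unfolding defs F_swap[symmetric]
    by (rule hexagon; (rule central_triples | rule central_triple_rotate(1))+)+
  \<comment> \<open>The pentagons for 0, 1, 2, 3 and 1, 0, 2, 3 share the factor \<open>B\<close>;
    eliminating it moves strand 0 past strand 1.\<close>
  have AR: "A * R = P * B * minv p"
    using arg_cong[OF pent(1), of "\<lambda>x. x * minv p"] by (simp add: mult.assoc)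
  have B: "B = minv r * u * C * s"
    using arg_cong[OF pent(2), of "\<lambda>x. minv r * x"] by (simp add: mult.assoc)
  have Q: "Q = P * minv r"
    using arg_cong[OF hex(2), of "\<lambda>x. P * x * minv r"] by (simp add: mult.assoc)
  have q: "s * minv p * q = 1"
    using arg_cong[OF hex(1), of "\<lambda>x. s * x * minv s"] by (simp add: mult.assoc)
  have S: "S = R * minv y"
    using arg_cong[OF hex(3), of "\<lambda>x. R * x * minv y"] by (simp add: mult.assoc)
  have v: "v = u * minv w"
    using arg_cong[OF hex(4), of "\<lambda>x. u * x * minv w"] by (simp add: mult.assoc)
  have C: "C * minv q = minv w * C' * y"
    using arg_cong[OF pent(3), of "\<lambda>x. minv w * x"] by (simp add: mult.assoc)
  have q': "s * minv p = minv q"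
    using arg_cong[OF q, of "\<lambda>x. x * minv q"] by (simp add: mult.assoc)
  have "A * R * q = P * minv r * u * C * (s * minv p * q)"
    unfolding AR B by (simp only: mult.assoc)
  also have "\<dots> = Q * u * C" by (simp only: q Q[symmetric] mult_1_right)
  finally show ?eq2 by (simp only: defs)
  \<comment> \<open>The third pentagon shares \<open>C\<close> with the second; eliminating it moves
    strand 0 past strand 2 as well.\<close>
  have "A * S = (A * R) * minv y" unfolding S by (simp only: mult.assoc)
  also have "\<dots> = Q * u * (C * (s * minv p)) * minv y"
    unfolding AR B Q by (simp only: mult.assoc)
  also have "\<dots> = Q * (u * minv w) * C' * (y * minv y)"
    unfolding q' C by (simp only: mult.assoc)
  also have "\<dots> = Q * v * C'" by (simp add: v[symmetric])
  finally show ?eq3 by (simp only: defs)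
qed

lemma alpha_values:
  fixes g h z :: "'g::group_add"
  assumes "central_triple g h z"
  shows "subst2 (alphaP f) (of_grp g) (of_grp h) = F g z" "subst2 (alphaQ f) (of_grp g) (of_grp h) = F h z"
  using central_triple_subst2[OF assms] by (simp_all add: subst2_alphaP subst2_alphaQ)

lemma F3_to_PB4_gen: "F3_to_PB4 cX1 = of_grp x01" "F3_to_PB4 cX2 = of_grp x02" "F3_to_PB4 cX3 = of_grp x03"
  by (simp_all add: F3_to_PB4_of_grp iota_gen)

lemma F3_to_PB4_alpha:
  "F3_to_PB4 (subst2 (alphaP f) cX1 cX2) = F x01 x12"
  "F3_to_PB4 (subst2 (alphaQ f) cX1 cX2) = F x02 x12"
  "F3_to_PB4 (subst2 (alphaP f) cX2 cX3) = F x02 x23"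
  "F3_to_PB4 (subst2 (alphaQ f) cX2 cX3) = F x03 x23"
  "F3_to_PB4 (subst2 (alphaP f) (cX1 * cX2) cX3) = F (x01 + x02) (x13 + x23)"
  "F3_to_PB4 (subst2 (alphaQ f) (cX1 * cX2) cX3) = F x03 (x13 + x23)"
  "F3_to_PB4 (subst2 (alphaP f) cX1 (cX2 * cX3)) = F x01 (x12 + x13)"
  "F3_to_PB4 (subst2 (alphaQ f) cX1 (cX2 * cX3)) = F (x02 + x03) (x12 + x13)"
  by (simp_all add: mhom_subst2_eq[OF mhom_F3_to_PB4] malcev_mult_closed mhom_mult[OF mhom_F3_to_PB4]
      F3_to_PB4_of_grp iota_gen alpha_values[OF central_triples(1)] alpha_values[OF central_triples(2)]
      alpha_values[OF central_triples(3)] alpha_values[OF central_triples(4)] flip: of_grp_add)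

lemma conj_by_malcev: "w \<in> carrier malcev \<Longrightarrow> z \<in> carrier malcev \<Longrightarrow> conj_by w z \<in> carrier malcev"
  by (simp add: conj_by_eq malcev_mult_closed)

lemma conj_by_conj_by:
  "w \<in> carrier malcev \<Longrightarrow> w' \<in> carrier malcev \<Longrightarrow> conj_by w (conj_by w' z) = conj_by (w * w') z"
  by (simp only: conj_by_eq conj_mult)

text \<open>Both sides of the identity, composed with the embedding into the completed pure braid
  group, conjugate each \<open>x\<^sub>0\<^sub>i\<close>; the conjugating elements agree up to the centralizer of
  \<open>x\<^sub>0\<^sub>i\<close>.\<close>

lemma composite_eq:
  assumes u: "u \<in> carrier malcev"
  shows "Ad (F x12 x23) (alpha_12_3 f (alpha_1_2 f u)) = alpha_1_23 f (alpha_2_3 f u)"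
proof -
  let ?p = "\<lambda>x y. subst2 (alphaP f) x y :: (F3, 'k) cga" and ?q = "\<lambda>x y. subst2 (alphaQ f) x y :: (F3, 'k) cga"
  let ?P12 = "?p cX1 cX2" and ?Q12 = "?q cX1 cX2" and ?P23 = "?p cX2 cX3" and ?Q23 = "?q cX2 cX3"
    and ?R = "?p (cX1 * cX2) cX3" and ?S = "?q (cX1 * cX2) cX3"
    and ?P = "?p cX1 (cX2 * cX3)" and ?Q = "?q cX1 (cX2 * cX3)"
  have mem: "?P12 \<in> carrier malcev" "?Q12 \<in> carrier malcev" "?P23 \<in> carrier malcev"
    "?Q23 \<in> carrier malcev" "?R \<in> carrier malcev" "?S \<in> carrier malcev" "?P \<in> carrier malcev" "?Q \<in> carrier malcev"
    by (simp_all add: f_malcev malcev_mult_closed)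
  note cl = conj_by_malcev[OF _ of_grp_malcev] of_grp_malcev
  define M12 where "M12 = malcev_subst (case_gen3 (conj_by ?P12 cX1) (conj_by ?Q12 cX2) cX3)"
  define M23 where "M23 = malcev_subst (case_gen3 cX1 (conj_by ?P23 cX2) (conj_by ?Q23 cX3))"
  define M12_3 where "M12_3 = malcev_subst (case_gen3 (conj_by ?R cX1) (conj_by ?R cX2) (conj_by ?S cX3))"
  define M1_23 where "M1_23 = malcev_subst (case_gen3 (conj_by ?P cX1) (conj_by ?Q cX2) (conj_by ?Q cX3))"
  have M: "mhom M12" "mhom M23" "mhom M12_3" "mhom M1_23"
    unfolding M12_def M23_def M12_3_def M1_23_def by (intro mhom_malcev_subst3 cl mem)+
  have gen: "M12 cX1 = conj_by ?P12 cX1" "M12 cX2 = conj_by ?Q12 cX2" "M12 cX3 = cX3"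
    "M23 cX1 = cX1" "M23 cX2 = conj_by ?P23 cX2" "M23 cX3 = conj_by ?Q23 cX3"
    "M12_3 cX1 = conj_by ?R cX1" "M12_3 cX2 = conj_by ?R cX2" "M12_3 cX3 = conj_by ?S cX3"
    "M1_23 cX1 = conj_by ?P cX1" "M1_23 cX2 = conj_by ?Q cX2" "M1_23 cX3 = conj_by ?Q cX3"
    unfolding M12_def M23_def M12_3_def M1_23_def by (intro malcev_subst3_gen cl mem)+
  \<comment> \<open>\<open>M12_3\<close> conjugates \<open>X1\<close> and \<open>X2\<close> by the
    same element, hence everything they generate; likewise \<open>M1_23\<close> for
    \<open>X2\<close> and \<open>X3\<close>. This yields a single conjugator for each value of a
    composite.\<close>
  have "M12_3 (subst2 e cX1 cX2) = conj_by ?R (subst2 e cX1 cX2)" for e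
    by (rule mhom_conj_subst2[OF M(3) mem(5)]) (simp_all add: gen)
  moreover have "M1_23 (subst2 e cX2 cX3) = conj_by ?Q (subst2 e cX2 cX3)" for e
    by (rule mhom_conj_subst2[OF M(4) mem(8)]) (simp_all add: gen)
  moreover have conj: "conj_by (conj_by w v) (conj_by w z) = conj_by (w * v) z"
    if "w \<in> carrier malcev" "v \<in> carrier malcev" for w v z :: "(F3, 'k) cga"
    using mhom_conj_by[OF mhom_conj[OF that(1)] that(2), of z]
    by (simp only: conj_by_eq[symmetric] conj_by_conj_by[OF that])
  ultimately have comp:
    "M12_3 (M12 cX1) = conj_by (?R * ?P12) cX1" "M12_3 (M12 cX2) = conj_by (?R * ?Q12) cX2"
    "M12_3 (M12 cX3) = conj_by ?S cX3"
    "M1_23 (M23 cX1) = conj_by ?P cX1" "M1_23 (M23 cX2) = conj_by (?Q * ?P23) cX2"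
    "M1_23 (M23 cX3) = conj_by (?Q * ?Q23) cX3"
    by (simp_all only: gen mhom_conj_by[OF M(3) mem(1)] mhom_conj_by[OF M(3) mem(2)]
        mhom_conj_by[OF M(4) mem(3)] mhom_conj_by[OF M(4) mem(4)]
        conj[OF mem(5,1)] conj[OF mem(5,2)] conj[OF mem(8,3)] conj[OF mem(8,4)])
  note i = mhom_F3_to_PB4
  let ?A = "F x12 x23"
  let ?L = "\<lambda>x. conj_by ?A (F3_to_PB4 (M12_3 (M12 x)))" and ?N = "\<lambda>x. F3_to_PB4 (M1_23 (M23 x))"
  have val: "?L cX1 = conj_by (?A * F (x01 + x02) (x13 + x23) * F x01 x12) (of_grp x01)"
    "?L cX2 = conj_by (?A * F (x01 + x02) (x13 + x23) * F x02 x12) (of_grp x02)"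
    "?L cX3 = conj_by (?A * F x03 (x13 + x23)) (of_grp x03)"
    "?N cX1 = conj_by (F x01 (x12 + x13)) (of_grp x01)"
    "?N cX2 = conj_by (F (x02 + x03) (x12 + x13) * F x02 x23) (of_grp x02)"
    "?N cX3 = conj_by (F (x02 + x03) (x12 + x13) * F x03 x23) (of_grp x03)"
    unfolding comp
    by (simp_all add: mhom_conj_by[OF i] mem malcev_mult_closed mhom_mult[OF i] F3_to_PB4_alpha
        F3_to_PB4_gen conj_by_conj_by f_malcev mult.assoc)
  have drop: "conj_by (w * F x y) (of_grp z) = conj_by w (of_grp z)"
    if "w \<in> carrier malcev" "commutes z x" "commutes z y" for w and x y z :: PB4
    unfolding conj_by_eq by (rule conj_mult_commuting[OF that(1) F_malcev F_commute[OF that(2,3)]])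
  \<comment> \<open>The factor to drop is the last one of the pentagon,
    \<open>F (x02 + x12) x23\<close>.\<close>
  have "?L cX1 = ?N cX1"
    unfolding val pentagon
  proof (rule drop[OF F_malcev])
    show "commutes x01 (x02 + x12)"
      using pure_twist_012(1) by (simp add: add.assoc)
  qed (rule pure_commutes)
  moreover have "?L cX2 = ?N cX2"
    unfolding val transfer_equations
  proof (rule drop[OF malcev_mult_closed[OF F_malcev F_malcev]])
    show "commutes x02 (x12 + x01)"
      using central_triple_rotate(1)[OF central_triples(1)] by (simp add: central_triple_def add.assoc)
    show "commutes x02 (x03 + x23)"
      using pure_twist_023(1) by (simp add: add.assoc)
  qed
  moreover have "?L cX3 = ?N cX3"
    unfolding val transfer_equations
  proof (rule drop[OF malcev_mult_closed[OF F_malcev F_malcev]])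
    show "commutes x03 (x23 + x02)"
      using central_triple_rotate(1)[OF central_triples(2)] by (simp add: central_triple_def add.assoc)
  qed (rule pure_commutes)
  ultimately have gens: "?L (of_grp (gen a)) = ?N (of_grp (gen a))" for a
    by (cases a) simp_all
  have L: "mhom ?L"
    unfolding conj_by_eq by (intro mhom_comp[OF mhom_conj[OF F_malcev]] mhom_comp[OF i] mhom_comp[OF M(3) M(1)])
  have "?L u = ?N u"
    by (rule presgroup_mhom_eqI[OF L mhom_comp[OF i mhom_comp[OF M(4) M(2)]] gens])
  moreover have "F3_to_PB4 (Ad ?A (M12_3 (M12 u))) = ?L u"
    unfolding conj_by_eq using mhom_closed[OF M(3) mhom_closed[OF M(1) u]] by (rule Ad_spec(2)[OF F_malcev])
  ultimately have "Ad ?A (M12_3 (M12 u)) = M1_23 (M23 u)"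
    by (simp only: F3_to_PB4_inject[symmetric])
  then show ?thesis
    using u mhom_closed[OF M(1) u] mhom_closed[OF M(2) u]
    by (simp add: alpha_12_3_def alpha_1_2_def alpha_1_23_def alpha_2_3_def endF3_def
        M12_def M23_def M12_3_def M1_23_def)
qed

end

lemma AutoGroup_mult:
  assumes "a \<in> carrier (AutoGroup G)" "b \<in> carrier (AutoGroup G)"
  shows "a \<otimes>\<^bsub>AutoGroup G\<^esub> b = compose (carrier G) a b"
  using assms by (auto simp: AutoGroup_def BijGroup_def auto_def)

theorem mainTheorem7:
  fixes f :: "(F2, 'k::field_char_0) cga"
  assumes "f \<in> GT1"
  shows "alpha f \<in> carrier (AutoGroup malcev) \<and>
    {Ad (subst2 f (cx 1 2) (cx 2 3)), alpha_12_3 f, alpha_1_2 f, alpha_1_23 f, alpha_2_3 f}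
      \<subseteq> carrier (AutoGroup malcev) \<and>
    Ad (subst2 f (cx 1 2) (cx 2 3))
        \<otimes>\<^bsub>AutoGroup malcev\<^esub> alpha_12_3 f \<otimes>\<^bsub>AutoGroup malcev\<^esub> alpha_1_2 f
      = alpha_1_23 f \<otimes>\<^bsub>AutoGroup malcev\<^esub> alpha_2_3 f"
proof -
  let ?S = "carrier malcev :: (F3, 'k) cga set" and ?A = "Ad (subst2 f (cx 1 2) (cx 2 3))"
  note f = f_malcev[OF assms]
  have Ad: "?A \<in> carrier (AutoGroup malcev)" by (rule Ad_auto) (simp add: f)
  have al: "alpha_12_3 f \<in> carrier (AutoGroup malcev)" "alpha_1_2 f \<in> carrier (AutoGroup malcev)"
    "alpha_1_23 f \<in> carrier (AutoGroup malcev)" "alpha_2_3 f \<in> carrier (AutoGroup malcev)"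
    using alpha_F3_auto[OF f] by simp_all
  have prod: "?A \<otimes>\<^bsub>AutoGroup malcev\<^esub> alpha_12_3 f \<in> carrier (AutoGroup malcev)"
    by (rule monoid.m_closed[OF group.is_monoid[OF group.AutoGroup[OF group_malcev]] Ad al(1)])
  \<comment> \<open>Multiplication in \<open>AutoGroup\<close> composes extensional functions, so
    only group-like arguments have to be compared.\<close>
  have "compose ?S (compose ?S ?A (alpha_12_3 f)) (alpha_1_2 f) = compose ?S (alpha_1_23 f) (alpha_2_3 f)"
  proof
    fix u
    have "alpha_1_2 f u \<in> ?S" if "u \<in> ?S"
      using al(2) that by (auto simp: AutoGroup_def auto_def hom_def)
    then show "compose ?S (compose ?S ?A (alpha_12_3 f)) (alpha_1_2 f) u = compose ?S (alpha_1_23 f) (alpha_2_3 f) u"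
      using composite_eq[OF assms] by (simp add: compose_def)
  qed
  then show ?thesis
    using alpha_auto[OF f] Ad al prod by (simp add: AutoGroup_mult)
qed

end
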